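(* Let $P$ denote a projection onto the subspace of $\mathcal{U}$ consisting of continuous (piecewise polynomial) functions with zero boundary values, and let $Q=I-P$. Define $$E_{P}=P\left(P^TD_{0}P\right)^{-1}P^T,\qquad E_{Q}=Q\left(Q^TF_{0}Q\right)^{-1}Q^T,$$ and $$E_{\varepsilon}=\frac{1}{\varepsilon}E_{P}+\left(I-E_{P}D_0\right)E_{Q}\left(I-D_0E_{P}\right).$$ Then, as $\varepsilon\to0$, $$\frac{1}{\varepsilon}E_{\varepsilon}M_{t}\left(I-S_{\varepsilon}\right)=I+\mathcal{O}\left(\varepsilon\right).$$
   Context: Setting. Let $\mathcal{D}\subset\mathbb{R}^n$, $n\le 3$, be a spatial domain decomposed into a finite set $\mathcal{E}$ of (possibly curved) elements $\kappa$, each the image of a reference element $\hat\kappa$, and let $\mathcal{F}$ be the set of interior and boundary element faces. $\mathcal{U}$ is the discontinuous Galerkin space of functions in $L^2(\mathcal{D})$ whose pullback to the reference element is, on each element, a polynomial of fixed degree $r$; $N=\dim\mathcal{U}$, a basis of $\mathcal{U}$ is fixed, and $\mathbf{u},\mathbf{v}\in\mathbb{R}^N$ denote the coefficient vectors of $u,v\in\mathcal{U}$ (so $P$, $Q$ are $N\times N$ matrices acting on coefficient vectors). Each face has a fixed (arbitrary sign) unit normal $\mathbf{n}$; on an interior face shared by $\kappa,\kappa'$ with $\mathbf{n}$ pointing from $\kappa$ to $\kappa'$, $\llbracket u\rrbracket=u_\kappa-u_{\kappa'}$ and $\{u\}=(u_\kappa+u_{\kappa'})/2$; on a boundary face of $\kappa$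 ($\mathbf n$ outward), $\llbracket u\rrbracket=u_\kappa$ and $\{u\}=u_\kappa$. Angular quadrature: directions $\boldsymbol{\Omega}_d\in\mathbb{S}^2$ and weights $w_d>0$, $d=1,\dots,N_\Omega$ (if $n<3$ only the first $n$ components of $\boldsymbol\Omega_d$ are used in spatial expressions). Each $\boldsymbol{\Omega}_d$ has a reversed direction $\boldsymbol\Omega_{d'}=-\boldsymbol\Omega_d$ with $w_{d'}=w_d$, and $\sum_d w_d=4\pi$, $\sum_d w_d\boldsymbol\Omega_d\boldsymbol\Omega_d^T=\frac{4\pi}{3}I$, $\sum_d w_d\boldsymbol\Omega_d=\mathbf 0$, $\sum_d w_d\boldsymbol\Omega_d|\boldsymbol\Omega_d\cdot\mathbf n|=\mathbf 0$. Matrices ($\sigma_t>0$ total opacity, $\sigma_a$ absorption opacity, both given functions independent of $\varepsilon$): $\mathbf{G}=(G_1,\dots,G_n)$ is a vector of $N\times N$ matrices, $\boldsymbol\Omega_d\cdot\mathbf G=\sum_j(\boldsymbol\Omega_d)_jG_j$, and $$\mathbf v^T(\boldsymbol\Omega_d\cdot\mathbf G)\mathbf u=\sum_{\kappa\in\mathcal E}\int_\kappa(\boldsymbol\Omega_d\cdot\nabla u)v\,d\mathbf x,\quad \mathbf v^TM_t\mathbf u=\sum_\kappa\int_\kappa\sigma_tuv\,d\mathbf x,\quad \mathbf v^TM_a\mathbf u=\sum_\kappa\int_\kappa\sigma_auv\,d\mathbf x,$$ $$\mathbf v^TF^{(d)}\mathbf u=-\sum_{\Gamma\in\mathcal F}\int_\Gamma\boldsymbol\Omega_d\cdot\mathbf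 n\,\llbracket u\rrbracket\{v\}\,dS+\frac12\sum_{\Gamma\in\mathcal F}\int_\Gamma|\boldsymbol\Omega_d\cdot\mathbf n|\,\llbracket u\rrbracket\llbracket v\rrbracket\,dS,$$ $$\mathbf v^T\tilde F^{(d)}\mathbf u=\sum_{\Gamma\in\mathcal F}\int_\Gamma\boldsymbol\Omega_d\cdot\mathbf n\,\{u\}\llbracket v\rrbracket\,dS+\frac12\sum_{\Gamma\in\mathcal F}\int_\Gamma|\boldsymbol\Omega_d\cdot\mathbf n|\,\llbracket u\rrbracket\llbracket v\rrbracket\,dS.$$ Sweep matrix: $S_\varepsilon=\sum_dw_d\left(I+\varepsilon M_t^{-1}(\boldsymbol\Omega_d\cdot\mathbf G+F^{(d)})\right)^{-1}\frac1{4\pi}\left(I-\varepsilon^2M_t^{-1}M_a\right)$. DSA ingredients: $F_0=\frac1{4\pi}\sum_dw_dF^{(d)}$, $\mathbf F_1=\frac1{4\pi}\sum_dw_d\boldsymbol\Omega_dF^{(d)}$, $\tilde{\mathbf F}_1=\frac1{4\pi}\sum_dw_d\boldsymbol\Omega_d\tilde F^{(d)}$ (vectors of matrices), and $$D_0=\tfrac13\mathbf G^T\cdot M_t^{-1}\mathbf G-\tilde{\mathbf F}_1\cdot M_t^{-1}\mathbf G+\mathbf G^T\cdot M_t^{-1}\mathbf F_1+M_a,$$ where dot products are over the component index, e.g. $\mathbf G^T\cdot M_t^{-1}\mathbf G=\sum_jG_j^TM_t^{-1}G_j$. Conventions: $(P^TD_0P)^{-1}$ is the inverse of $P^TD_0P$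 as a map from the range of $P$ to the range of $P^T$, and $(Q^TF_0Q)^{-1}$ the inverse of $Q^TF_0Q$ as a map from the range of $Q$ to the range of $Q^T$; both are assumed to exist. Standing assumptions: $\varepsilon\|M_t^{-1}(\boldsymbol\Omega_d\cdot\mathbf G+F^{(d)})\|<1$ and $\varepsilon^2\|M_t^{-1}M_a\|<1$. The mesh, $\mathcal U$, opacities and quadrature are fixed and $\mathcal O(\varepsilon)$ denotes a matrix whose norm is at most $C\varepsilon$ for all sufficiently small $\varepsilon>0$. *)

theory Defs
  imports "HOL-Analysis.Analysis"
begin

section \<open>Data\<close>

text \<open>
  The spatial dimension is \<open>n = CARD('n)\<close> and the dimension of the discontinuous Galerkin space is
  \<open>N = CARD('N)\<close>.  A piecewise function is a family of functions indexed by the elements: \<open>u \<kappa>\<close> is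
  \<open>u\<close> on the (closed) element \<open>\<kappa>\<close>, including its one-sided trace \<open>u\<^sub>\<kappa>\<close> on the faces of \<open>\<kappa>\<close>.
\<close>

type_synonym 'n piecewise = "(real^'n) set \<Rightarrow> real^'n \<Rightarrow> real"

text \<open>
  \<open>dg_map \<kappa>\<close> maps the reference element onto \<open>\<kappa>\<close>.  \<open>dg_side \<Gamma>\<close> fixes the sign of the normal of the
  face \<open>\<Gamma>\<close>: it is the adjacent element out of which the normal points.  \<open>q_cpt\<close> numbers the
  spatial coordinates, selecting the first \<open>n\<close> components of a direction in \<open>\<real>\<^sup>3\<close>.
\<close>

record ('n, 'N) transport =
  dg_dom   :: "(real^'n) set"
  dg_ref   :: "(real^'n) set"
  dg_elems :: "(real^'n) set set"
  dg_map   :: "(real^'n) set \<Rightarrow> real^'n \<Rightarrow> real^'n"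
  dg_side  :: "(real^'n) set \<Rightarrow> (real^'n) set"
  dg_deg   :: nat
  dg_basis :: "'N \<Rightarrow> 'n piecewise"
  sig_t    :: "real^'n \<Rightarrow> real"
  sig_a    :: "real^'n \<Rightarrow> real"
  q_num    :: nat
  q_dir    :: "nat \<Rightarrow> real^3"
  q_wt     :: "nat \<Rightarrow> real"
  q_cpt    :: "'n \<Rightarrow> 3"


section \<open>Mesh and faces\<close>

definition C2_diffeo_on :: "(real^'n::finite) set \<Rightarrow> (real^'n \<Rightarrow> real^'n) \<Rightarrow> bool" where
  "C2_diffeo_on U f \<longleftrightarrow> open U \<and> inj_on f U \<and>
     (\<forall>x\<in>U. det (jacobian f (at x)) \<noteq> 0) \<and>
     (\<exists>(f' :: real^'n \<Rightarrow> (real^'n) \<Rightarrow>\<^sub>L (real^'n)) f''.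
        (\<forall>x\<in>U. (f has_derivative blinfun_apply (f' x)) (at x) \<and>
                (f' has_derivative blinfun_apply (f'' x)) (at x)) \<and>
        continuous_on U f'')"

definition elem_faces :: "('n::finite, 'N) transport \<Rightarrow> (real^'n) set \<Rightarrow> (real^'n) set set" where
  "elem_faces X \<kappa> = {dg_map X \<kappa> ` F | F. F facet_of dg_ref X}"

definition faces :: "('n::finite, 'N) transport \<Rightarrow> (real^'n) set set" where
  "faces X = (\<Union>\<kappa>\<in>dg_elems X. elem_faces X \<kappa>)"

definition adjacent :: "('n::finite, 'N) transport \<Rightarrow> (real^'n) set \<Rightarrow> (real^'n) set set" where
  "adjacent X \<Gamma> = {\<kappa> \<in> dg_elems X. \<Gamma> \<in> elem_faces X \<kappa>}"

definition boundary_face :: "('n::finite, 'N) transport \<Rightarrow> (real^'n) set \<Rightarrow> bool" where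
  "boundary_face X \<Gamma> \<longleftrightarrow> \<Gamma> \<subseteq> frontier (dg_dom X)"

text \<open>The element \<open>\<kappa>'\<close> on the other side of an interior face.\<close>

definition other_side :: "('n::finite, 'N) transport \<Rightarrow> (real^'n) set \<Rightarrow> (real^'n) set" where
  "other_side X \<Gamma> = (THE \<kappa>'. \<kappa>' \<in> adjacent X \<Gamma> \<and> \<kappa>' \<noteq> dg_side X \<Gamma>)"

text \<open>
  The mesh is conforming: a face lies on the boundary of the domain and belongs to one element, or
  it is shared by exactly two elements.
\<close>

definition valid_mesh :: "('n::finite, 'N) transport \<Rightarrow> bool" where
  "valid_mesh X \<longleftrightarrow>
     open (dg_dom X) \<and>
     polytope (dg_ref X) \<and> interior (dg_ref X) \<noteq> {} \<and>
     finite (dg_elems X) \<and>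
     (\<forall>\<kappa>\<in>dg_elems X. \<kappa> = dg_map X \<kappa> ` dg_ref X \<and>
        (\<exists>U. dg_ref X \<subseteq> U \<and> C2_diffeo_on U (dg_map X \<kappa>))) \<and>
     closure (dg_dom X) = \<Union>(dg_elems X) \<and>
     (\<forall>\<kappa>\<in>dg_elems X. interior \<kappa> \<subseteq> dg_dom X) \<and>
     (\<forall>\<kappa>\<in>dg_elems X. \<forall>\<kappa>'\<in>dg_elems X. \<kappa> \<noteq> \<kappa>' \<longrightarrow> interior \<kappa> \<inter> interior \<kappa>' = {}) \<and>
     (\<forall>\<Gamma>\<in>faces X. dg_side X \<Gamma> \<in> adjacent X \<Gamma> \<and>
        card (adjacent X \<Gamma>) = (if boundary_face X \<Gamma> then 1 else 2))"


section \<open>Normals and surface integrals\<close>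

definition facet_normal :: "(real^'n::finite) set \<Rightarrow> (real^'n) set \<Rightarrow> real^'n" where
  "facet_normal K F =
     (THE a. norm a = 1 \<and> (\<exists>c. (\<forall>x\<in>K. a \<bullet> x \<le> c) \<and> F = {x\<in>K. a \<bullet> x = c}))"

text \<open>
  Integration over a flat facet against \<open>(n-1)\<close>-dimensional Lebesgue measure: the right prism of
  height 1 over \<open>F\<close> has, by Fubini, \<open>n\<close>-dimensional measure equal to the \<open>(n-1)\<close>-dimensional measure
  of \<open>F\<close>, and the integrand is constant along the normal direction (\<open>closest_point F\<close> is the
  projection of the prism onto its base).  For \<open>n = 1\<close> this is evaluation at the point.
\<close>

definition facet_prism :: "(real^'n::finite) set \<Rightarrow> (real^'n) set \<Rightarrow> (real^'n) set" where
  "facet_prism K F = {x + t *\<^sub>R facet_normal K F | x t. x \<in> F \<and> 0 \<le> t \<and> t \<le> 1}"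

definition facet_integral ::
    "(real^'n::finite) set \<Rightarrow> (real^'n) set \<Rightarrow> (real^'n \<Rightarrow> real) \<Rightarrow> real" where
  "facet_integral K F f = (LINT y : facet_prism K F | lebesgue. f (closest_point F y))"

definition ref_facet ::
    "('n::finite, 'N) transport \<Rightarrow> (real^'n) set \<Rightarrow> (real^'n) set \<Rightarrow> (real^'n) set" where
  "ref_facet X \<kappa> \<Gamma> = {z \<in> dg_ref X. dg_map X \<kappa> z \<in> \<Gamma>}"

text \<open>
  With \<open>J\<close> the Jacobian matrix of the element map and \<open>a\<close> the outward unit normal of a facet of the
  reference element, \<open>J\<^sup>-\<^sup>T a\<close> is an outward normal of the image of the facet, and the surface
  element transforms by Nanson's formula \<open>dS = \<bar>det J\<bar> \<parallel>J\<^sup>-\<^sup>T a\<parallel> dS\<^sub>0\<close>.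
\<close>

definition conormal ::
    "('n::finite, 'N) transport \<Rightarrow> (real^'n) set \<Rightarrow> (real^'n) set \<Rightarrow> real^'n \<Rightarrow> real^'n" where
  "conormal X \<kappa> \<Gamma> z =
     matrix_inv (transpose (jacobian (dg_map X \<kappa>) (at z)))
       *v facet_normal (dg_ref X) (ref_facet X \<kappa> \<Gamma>)"

definition face_normal ::
    "('n::finite, 'N) transport \<Rightarrow> (real^'n) set \<Rightarrow> real^'n \<Rightarrow> real^'n" where
  "face_normal X \<Gamma> x =
     (let \<kappa> = dg_side X \<Gamma>;
          v = conormal X \<kappa> \<Gamma> (inv_into (dg_ref X) (dg_map X \<kappa>) x)
      in v /\<^sub>R norm v)"

definition face_integral ::
    "('n::finite, 'N) transport \<Rightarrow> (real^'n) set \<Rightarrow> (real^'n \<Rightarrow> real) \<Rightarrow> real" where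
  "face_integral X \<Gamma> f =
     (let \<kappa> = dg_side X \<Gamma>
      in facet_integral (dg_ref X) (ref_facet X \<kappa> \<Gamma>)
           (\<lambda>z. f (dg_map X \<kappa> z) *
                (\<bar>det (jacobian (dg_map X \<kappa>) (at z))\<bar> * norm (conormal X \<kappa> \<Gamma> z))))"

definition jump ::
    "('n::finite, 'N) transport \<Rightarrow> 'n piecewise \<Rightarrow> (real^'n) set \<Rightarrow> real^'n \<Rightarrow> real" where
  "jump X u \<Gamma> x =
     (if boundary_face X \<Gamma> then u (dg_side X \<Gamma>) x
      else u (dg_side X \<Gamma>) x - u (other_side X \<Gamma>) x)"

definition avg ::
    "('n::finite, 'N) transport \<Rightarrow> 'n piecewise \<Rightarrow> (real^'n) set \<Rightarrow> real^'n \<Rightarrow> real" where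
  "avg X u \<Gamma> x =
     (if boundary_face X \<Gamma> then u (dg_side X \<Gamma>) x
      else (u (dg_side X \<Gamma>) x + u (other_side X \<Gamma>) x) / 2)"


section \<open>The discontinuous Galerkin space\<close>

definition poly_degree_le :: "nat \<Rightarrow> (real^'n::finite \<Rightarrow> real) \<Rightarrow> bool" where
  "poly_degree_le r p \<longleftrightarrow>
     (\<exists>c :: ('n \<Rightarrow> nat) \<Rightarrow> real.
        p = (\<lambda>x. \<Sum>\<alpha> | (\<Sum>i\<in>UNIV. \<alpha> i) \<le> r. c \<alpha> * (\<Prod>i\<in>UNIV. (x $ i) ^ \<alpha> i)))"

text \<open>
  Off the element, the component \<open>u \<kappa>\<close> is set to 0, so that piecewise functions agreeing on all
  elements are equal.
\<close>

definition dg_space :: "('n::finite, 'N) transport \<Rightarrow> 'n piecewise set" where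
  "dg_space X = {u.
     (\<forall>\<kappa>\<in>dg_elems X. (\<exists>p. poly_degree_le (dg_deg X) p \<and> (\<forall>z\<in>dg_ref X. u \<kappa> (dg_map X \<kappa> z) = p z)) \<and>
                      (\<forall>x. x \<notin> \<kappa> \<longrightarrow> u \<kappa> x = 0)) \<and>
     (\<forall>\<kappa>. \<kappa> \<notin> dg_elems X \<longrightarrow> u \<kappa> = (\<lambda>x. 0))}"

definition dg_fun :: "('n::finite, 'N::finite) transport \<Rightarrow> real^'N \<Rightarrow> 'n piecewise" where
  "dg_fun X c = (\<lambda>\<kappa> x. \<Sum>i\<in>UNIV. c $ i * dg_basis X i \<kappa> x)"

definition valid_basis :: "('n::finite, 'N::finite) transport \<Rightarrow> bool" where
  "valid_basis X \<longleftrightarrow>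
     (\<forall>i. dg_basis X i \<in> dg_space X) \<and> (\<forall>u\<in>dg_space X. \<exists>!c. u = dg_fun X c)"

definition continuous_zero_bdry :: "('n::finite, 'N) transport \<Rightarrow> 'n piecewise set" where
  "continuous_zero_bdry X = {u \<in> dg_space X.
     \<exists>g. continuous_on (closure (dg_dom X)) g \<and>
         (\<forall>\<kappa>\<in>dg_elems X. \<forall>x\<in>\<kappa>. u \<kappa> x = g x) \<and>
         (\<forall>x\<in>frontier (dg_dom X). g x = 0)}"

definition projection_onto :: "(real^'N) set \<Rightarrow> real^'N::finite^'N \<Rightarrow> bool" where
  "projection_onto V P \<longleftrightarrow> P ** P = P \<and> range ((*v) P) = V"


section \<open>Opacities and angular quadrature\<close>

definition valid_opacities :: "('n::finite, 'N) transport \<Rightarrow> bool" where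
  "valid_opacities X \<longleftrightarrow>
     set_integrable lebesgue (dg_dom X) (sig_t X) \<and>
     set_integrable lebesgue (dg_dom X) (sig_a X) \<and>
     (\<forall>x\<in>dg_dom X. sig_t X x > 0)"

definition sdir :: "('n::finite, 'N) transport \<Rightarrow> nat \<Rightarrow> real^'n" where
  "sdir X d = (\<chi> j. q_dir X d $ q_cpt X j)"

text \<open>The components of a vector of type \<open>real^3\<close> are numbered 1, 2, 3, where \<open>3 = 0\<close> in type \<open>3\<close>.\<close>

definition valid_quadrature :: "('n::finite, 'N) transport \<Rightarrow> bool" where
  "valid_quadrature X \<longleftrightarrow>
     bij_betw (q_cpt X) UNIV (of_nat ` {1..CARD('n)}) \<and>
     (\<forall>d\<in>{1..q_num X}. norm (q_dir X d) = 1 \<and> q_wt X d > 0 \<and>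
        (\<exists>d'\<in>{1..q_num X}. q_dir X d' = - q_dir X d \<and> q_wt X d' = q_wt X d)) \<and>
     (\<Sum>d=1..q_num X. q_wt X d) = 4 * pi \<and>
     (\<forall>i j. (\<Sum>d=1..q_num X. q_wt X d * (q_dir X d $ i * q_dir X d $ j))
              = 4 * pi / 3 * (if i = j then 1 else 0)) \<and>
     (\<Sum>d=1..q_num X. q_wt X d *\<^sub>R q_dir X d) = 0 \<and>
     (\<forall>\<Gamma>\<in>faces X. \<forall>x\<in>\<Gamma>.
        (\<Sum>d=1..q_num X. (q_wt X d * \<bar>sdir X d \<bullet> face_normal X \<Gamma> x\<bar>) *\<^sub>R q_dir X d) = 0)"


section \<open>Matrices\<close>

text \<open>The matrix \<open>A\<close> with \<open>v\<^sup>T A u = a(u, v)\<close> for coefficient vectors \<open>u\<close>, \<open>v\<close>.\<close>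

definition form_matrix ::
    "('n::finite, 'N::finite) transport \<Rightarrow> ('n piecewise \<Rightarrow> 'n piecewise \<Rightarrow> real) \<Rightarrow> real^'N^'N" where
  "form_matrix X a = (\<chi> i j. a (dg_basis X j) (dg_basis X i))"

definition mass_matrix ::
    "('n::finite, 'N::finite) transport \<Rightarrow> (real^'n \<Rightarrow> real) \<Rightarrow> real^'N^'N" where
  "mass_matrix X \<sigma> =
     form_matrix X (\<lambda>u v. \<Sum>\<kappa>\<in>dg_elems X. LINT x : \<kappa> | lebesgue. \<sigma> x * u \<kappa> x * v \<kappa> x)"

abbreviation Mt :: "('n::finite, 'N::finite) transport \<Rightarrow> real^'N^'N" where
  "Mt X \<equiv> mass_matrix X (sig_t X)"

abbreviation Ma :: "('n::finite, 'N::finite) transport \<Rightarrow> real^'N^'N" where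
  "Ma X \<equiv> mass_matrix X (sig_a X)"

definition G_mat :: "('n::finite, 'N::finite) transport \<Rightarrow> 'n \<Rightarrow> real^'N^'N" where
  "G_mat X j =
     form_matrix X (\<lambda>u v. \<Sum>\<kappa>\<in>dg_elems X.
       LINT x : \<kappa> | lebesgue. frechet_derivative (u \<kappa>) (at x) (axis j 1) * v \<kappa> x)"

definition dir_G :: "('n::finite, 'N::finite) transport \<Rightarrow> nat \<Rightarrow> real^'N^'N" where
  "dir_G X d = (\<Sum>j\<in>UNIV. sdir X d $ j *\<^sub>R G_mat X j)"

definition F_mat :: "('n::finite, 'N::finite) transport \<Rightarrow> nat \<Rightarrow> real^'N^'N" where
  "F_mat X d =
     form_matrix X (\<lambda>u v.
       - (\<Sum>\<Gamma>\<in>faces X. face_integral X \<Gamma>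
            (\<lambda>x. (sdir X d \<bullet> face_normal X \<Gamma> x) * jump X u \<Gamma> x * avg X v \<Gamma> x))
       + 1/2 * (\<Sum>\<Gamma>\<in>faces X. face_integral X \<Gamma>
            (\<lambda>x. \<bar>sdir X d \<bullet> face_normal X \<Gamma> x\<bar> * jump X u \<Gamma> x * jump X v \<Gamma> x)))"

definition Ft_mat :: "('n::finite, 'N::finite) transport \<Rightarrow> nat \<Rightarrow> real^'N^'N" where
  "Ft_mat X d =
     form_matrix X (\<lambda>u v.
       (\<Sum>\<Gamma>\<in>faces X. face_integral X \<Gamma>
            (\<lambda>x. (sdir X d \<bullet> face_normal X \<Gamma> x) * avg X u \<Gamma> x * jump X v \<Gamma> x))
       + 1/2 * (\<Sum>\<Gamma>\<in>faces X. face_integral X \<Gamma>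
            (\<lambda>x. \<bar>sdir X d \<bullet> face_normal X \<Gamma> x\<bar> * jump X u \<Gamma> x * jump X v \<Gamma> x)))"

definition F0 :: "('n::finite, 'N::finite) transport \<Rightarrow> real^'N^'N" where
  "F0 X = (1 / (4 * pi)) *\<^sub>R (\<Sum>d=1..q_num X. q_wt X d *\<^sub>R F_mat X d)"

definition F1 :: "('n::finite, 'N::finite) transport \<Rightarrow> 'n \<Rightarrow> real^'N^'N" where
  "F1 X j = (1 / (4 * pi)) *\<^sub>R (\<Sum>d=1..q_num X. (q_wt X d * sdir X d $ j) *\<^sub>R F_mat X d)"

definition Ft1 :: "('n::finite, 'N::finite) transport \<Rightarrow> 'n \<Rightarrow> real^'N^'N" where
  "Ft1 X j = (1 / (4 * pi)) *\<^sub>R (\<Sum>d=1..q_num X. (q_wt X d * sdir X d $ j) *\<^sub>R Ft_mat X d)"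

definition sweep_op :: "('n::finite, 'N::finite) transport \<Rightarrow> nat \<Rightarrow> real^'N^'N" where
  "sweep_op X d = matrix_inv (Mt X) ** (dir_G X d + F_mat X d)"

definition S_mat :: "('n::finite, 'N::finite) transport \<Rightarrow> real \<Rightarrow> real^'N^'N" where
  "S_mat X \<epsilon> =
     (\<Sum>d=1..q_num X. q_wt X d *\<^sub>R
        (matrix_inv (mat 1 + \<epsilon> *\<^sub>R sweep_op X d) **
         ((1 / (4 * pi)) *\<^sub>R (mat 1 - \<epsilon>\<^sup>2 *\<^sub>R (matrix_inv (Mt X) ** Ma X)))))"

definition D0 :: "('n::finite, 'N::finite) transport \<Rightarrow> real^'N^'N" where
  "D0 X =
     (1/3) *\<^sub>R (\<Sum>j\<in>UNIV. transpose (G_mat X j) ** matrix_inv (Mt X) ** G_mat X j)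
     - (\<Sum>j\<in>UNIV. Ft1 X j ** matrix_inv (Mt X) ** G_mat X j)
     + (\<Sum>j\<in>UNIV. transpose (G_mat X j) ** matrix_inv (Mt X) ** F1 X j)
     + Ma X"

text \<open>
  \<open>P (P\<^sup>T A P)\<^sup>-\<^sup>1 P\<^sup>T\<close>, where \<open>P\<^sup>T A P\<close> is inverted as a map from the range of \<open>P\<close> to the range of
  \<open>P\<^sup>T\<close>.
\<close>

definition range_invertible :: "real^'N::finite^'N \<Rightarrow> real^'N^'N \<Rightarrow> bool" where
  "range_invertible P A \<longleftrightarrow>
     bij_betw ((*v) (transpose P ** A ** P)) (range ((*v) P)) (range ((*v) (transpose P)))"

definition range_solve :: "real^'N::finite^'N \<Rightarrow> real^'N^'N \<Rightarrow> real^'N^'N" where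
  "range_solve P A =
     matrix (\<lambda>x. P *v inv_into (range ((*v) P)) ((*v) (transpose P ** A ** P)) (transpose P *v x))"

definition E_P :: "('n::finite, 'N::finite) transport \<Rightarrow> real^'N^'N \<Rightarrow> real^'N^'N" where
  "E_P X P = range_solve P (D0 X)"

definition E_Q :: "('n::finite, 'N::finite) transport \<Rightarrow> real^'N^'N \<Rightarrow> real^'N^'N" where
  "E_Q X Q = range_solve Q (F0 X)"

definition E_eps :: "('n::finite, 'N::finite) transport \<Rightarrow> real^'N^'N \<Rightarrow> real \<Rightarrow> real^'N^'N" where
  "E_eps X P \<epsilon> =
     (1 / \<epsilon>) *\<^sub>R E_P X P
     + (mat 1 - E_P X P ** D0 X) ** E_Q X (mat 1 - P) ** (mat 1 - D0 X ** E_P X P)"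

abbreviation opnorm :: "real^'N::finite^'N \<Rightarrow> real" where
  "opnorm A \<equiv> onorm ((*v) A)"

end

theory Submission
  imports Defs
begin

text \<open>
  Expanding the resolvents in the sweep matrix gives \<open>M\<^sub>t (I - S\<^sub>\<epsilon>) = \<epsilon>
  F\<^sub>0 + \<epsilon>\<^sup>2 D + O(\<epsilon>\<^sup>3)\<close> with \<open>D = M\<^sub>a - (1/4\<pi>)
  \<Sum>\<^sub>d w\<^sub>d H\<^sub>d M\<^sub>t\<^sup>-\<^sup>1 H\<^sub>d\<close> and \<open>H\<^sub>d =
  \<Omega>\<^sub>d \<cdot> G + F\<^sup>(\<^sup>d\<^sup>)\<close>. A continuous function with zero boundary
  values has no jumps, whence \<open>F\<^sub>0 P = 0\<close> and \<open>P\<^sup>T F\<^sub>0 = 0\<close>, and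
  integration by parts on the elements gives \<open>P\<^sup>T H\<^sub>d = - P\<^sup>T (\<Omega>\<^sub>d
  \<cdot> G)\<^sup>T\<close>, so that \<open>P\<^sup>T D = P\<^sup>T D\<^sub>0\<close> by the moments of the
  quadrature. Hence \<open>E\<^sub>P F\<^sub>0 = 0\<close>, \<open>E\<^sub>Q F\<^sub>0 = Q\<close>, and the
  terms of order 0 in \<open>\<epsilon>\<close> add up to \<open>E\<^sub>P D\<^sub>0 + (I - E\<^sub>P
  D\<^sub>0) Q = E\<^sub>P D\<^sub>0 P + Q = P + Q = I\<close>.

  The integration by parts rests on a divergence theorem for the image of a polytope \<open>K\<close> under
  a diffeomorphism \<open>\<Phi>\<close>. It is obtained from a cutoff function
  \<open>\<psi>\<^sub>\<delta>\<close> on \<open>K\<close> that is a product of ramps in the scaled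
  distances to the facets: the integral of \<open>\<partial>\<^sub>e ((w \<psi>\<^sub>\<delta>) \<circ>
  \<Phi>\<^sup>-\<^sup>1)\<close> vanishes, and as \<open>\<delta> \<rightarrow> 0\<close> the gradient of
  \<open>\<psi>\<^sub>\<delta>\<close> concentrates on the facets. Summation over the elements needs that
  the two sides of an interior face contribute opposite fluxes, which is a change of variables between the
  two parametrizations of the face.
\<close>

section \<open>Change of variables for an arbitrary finite index type\<close>

text \<open>The expansion produces \<open>D\<close>, the preconditioner contains \<open>D0\<close>,
  and the two agree only after multiplication by \<open>P^T\<close>. That is enough:
  \<open>E_P\<close> sees its argument only through \<open>P^T\<close>, and \<open>E_Q\<close> meets
  \<open>D\<close> only at order \<epsilon>. The factor \<open>I - D0 E_P\<close> acts as the
  identity on the range of \<open>F0\<close>. A surface integral is by definition a volume integral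
  over a prism of height 1. The cutoff is chosen so that one explicit substitution carries the
  boundary layer of a facet onto the prism, and comparing two parametrizations of a face becomes a
  change of variables between prisms. Both Jacobians reduce to rank-one perturbations of the
  identity. The divergence theorem is proved in the coordinates of the element and then pulled back,
  so that the transformed direction field is never differentiated. The opposite signs of the two
  fluxes through an interior face are not part of the data; they follow from the disjointness of the
  element interiors.\<close>

lemma det_reindex:
  fixes A :: "real^'n::finite^'n" and r :: "'m::finite \<Rightarrow> 'n"
  assumes r: "bij r"
  shows "det (\<chi> i j. A $ r i $ r j) = det A"
proof -
  \<comment> \<open>Conjugation by \<open>r\<close> matches the two Leibniz sums term by term,
    because it preserves signs.\<close>
  let ?c = "map_permutation UNIV (inv r)"
  have ir: "bij (inv r)" and inj: "inj (inv r)" "inj r" "surj r"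
    using r by (auto simp: bij_imp_bij_inv bij_is_inj bij_is_surj)
  have bij: "bij_betw ?c {p. p permutes (UNIV :: 'n set)} {p. p permutes (UNIV :: 'm set)}"
  proof (rule bij_betw_byWitness[where f' = "map_permutation UNIV r"])
    show "\<forall>p\<in>{p. p permutes UNIV}. map_permutation UNIV r (?c p) = p"
      using ir inj by (auto intro!: map_permutation_compose_inv simp: bij_def surj_f_inv_f)
    show "\<forall>p\<in>{p. p permutes UNIV}. ?c (map_permutation UNIV r p) = p"
      using r by (auto intro!: map_permutation_compose_inv simp: inv_f_f bij_is_inj)
    show "?c ` {p. p permutes UNIV} \<subseteq> {p. p permutes UNIV}"
      using ir by (auto intro!: map_permutation_permutes)
    show "map_permutation UNIV r ` {p. p permutes UNIV} \<subseteq> {p. p permutes UNIV}"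
      using r by (auto intro!: map_permutation_permutes)
  qed
  have "det (\<chi> i j. A $ r i $ r j) =
      (\<Sum>p | p permutes (UNIV :: 'm set). of_int (sign p) * (\<Prod>i\<in>UNIV. A $ r i $ r (p i)))"
    by (simp add: det_def)
  also have "\<dots> = (\<Sum>p | p permutes (UNIV :: 'n set).
      of_int (sign (?c p)) * (\<Prod>i\<in>UNIV. A $ r i $ r (?c p i)))"
    by (rule sum.reindex_bij_betw[OF bij, symmetric])
  also have "\<dots> = (\<Sum>p | p permutes (UNIV :: 'n set). of_int (sign p)
      * (\<Prod>i\<in>UNIV. A $ i $ p i))"
  proof (rule sum.cong[OF refl])
    fix p :: "'n \<Rightarrow> 'n" assume "p \<in> {p. p permutes UNIV}"
    then have p: "p permutes UNIV" by simp
    have s: "sign (?c p) = sign p"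
      by (rule sign_map_permutation) (use p inj in auto)
    have "?c p i = inv r (p (r i))" for i
      using map_permutation_apply[OF inj(1), of "r i" p] inj by (simp add: inv_f_f)
    then have "(\<Prod>i\<in>UNIV. A $ r i $ r (?c p i)) = (\<Prod>i\<in>UNIV. A $ r i $ p (r i))"
      using inj by (simp add: surj_f_inv_f)
    also have "\<dots> = (\<Prod>i\<in>UNIV. A $ i $ p i)"
      by (rule prod.reindex_bij_betw[OF r])
    finally show "of_int (sign (?c p)) * (\<Prod>i\<in>UNIV. A $ r i $ r (?c p i)) =
        of_int (sign p) * (\<Prod>i\<in>UNIV. A $ i $ p i)"
      using s by simp
  qed
  finally show ?thesis by (simp add: det_def)
qed

text \<open>
  The change-of-variables theorem of the library needs a well-ordered index type, so it is transported along
  a relabelling of the coordinates.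
\<close>

typedef 'a idx = "UNIV :: 'a set" by simp

instance idx :: (finite) finite
proof
  have "(UNIV :: 'a idx set) = range Abs_idx"
    by (metis Rep_idx_inverse surj_def)
  then show "finite (UNIV :: 'a idx set)" by (metis finite finite_imageI)
qed

instantiation idx :: (finite) wellorder
begin

definition less_eq_idx :: "'a idx \<Rightarrow> 'a idx \<Rightarrow> bool" where
  "less_eq_idx x y \<longleftrightarrow> to_nat (Rep_idx x) \<le> to_nat (Rep_idx y)"

definition less_idx :: "'a idx \<Rightarrow> 'a idx \<Rightarrow> bool" where
  "less_idx x y \<longleftrightarrow> to_nat (Rep_idx x) < to_nat (Rep_idx y)"

instance
proof
  fix P :: "'a idx \<Rightarrow> bool" and a
  assume *: "\<And>x. (\<And>y. y < x \<Longrightarrow> P y) \<Longrightarrow> P x"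
  show "P a"
    by (induction a rule: measure_induct_rule[of "\<lambda>x. to_nat (Rep_idx x)"])
      (auto intro: * simp: less_idx_def)
qed (auto simp: less_eq_idx_def less_idx_def Rep_idx_inject)

end

lemma bij_Rep_idx: "bij (Rep_idx :: 'a idx \<Rightarrow> 'a)"
  by (metis Abs_idx_inverse UNIV_I Rep_idx_inject bijI surj_def injI)

section \<open>Lebesgue measure under a relabelling of coordinates\<close>

definition relabel :: "('m \<Rightarrow> 'n) \<Rightarrow> 'a^'n \<Rightarrow> 'a^'m" where
  "relabel r x = (\<chi> i. x $ r i)"

lemma relabel_relabel: "relabel s (relabel r x) = relabel (r \<circ> s) x"
  by (simp add: relabel_def vec_eq_iff)

lemma relabel_id [simp]: "relabel id x = x" "relabel (\<lambda>i. i) x = x"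
  by (simp_all add: relabel_def vec_eq_iff)

lemma linear_relabel: "linear (relabel r :: real^'n::finite \<Rightarrow> real^'m::finite)"
  by (auto simp: relabel_def linear_iff vec_eq_iff)

text \<open>Lebesgue measure is determined by its values on boxes, and a relabelling only permutes
  the side lengths of a box.\<close>

lemma lborel_relabel:
  fixes r :: "'m::finite \<Rightarrow> 'n::finite"
  assumes r: "bij r"
  shows "lborel = distr lborel borel (relabel r :: real^'n \<Rightarrow> real^'m)"
proof (rule lborel_eqI)
  have meas: "(relabel r :: real^'n \<Rightarrow> real^'m) \<in> borel_measurable borel"
    by (intro borel_measurable_continuous_onI linear_continuous_on
        linear_conv_bounded_linear[THEN iffD1] linear_relabel)
  fix l u :: "real^'m" assume lu: "\<And>b. b \<in> Basis \<Longrightarrow> l \<bullet> b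
      \<le> u \<bullet> b"
  let ?k = "relabel (inv r) :: real^'m \<Rightarrow> real^'n"
  have rr: "surj r" "inj r" using r by (auto simp: bij_def)
  have vim: "relabel r -` box l u = box (?k l) (?k u)"
  proof -
    have "relabel r x \<in> box l u \<longleftrightarrow> x \<in> box (?k l) (?k u)" for x
      unfolding mem_box_cart relabel_def vec_lambda_beta
      using rr by (metis surj_f_inv_f inv_f_f)
    then show ?thesis by auto
  qed
  have le: "l $ i \<le> u $ i" for i
  proof -
    have "axis i (1::real) \<in> Basis" by (auto simp: Basis_vec_def)
    from lu[OF this] show ?thesis by (simp add: inner_axis)
  qed
  have ne: "cbox l u \<noteq> {}" "cbox (?k l) (?k u) \<noteq> {}"
    using le by (auto simp: interval_ne_empty_cart relabel_def)
  have "emeasure (distr lborel borel (relabel r)) (box l u) = emeasure lborel (box (?k l) (?k u))"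
    using meas by (simp add: emeasure_distr vim)
  also have "\<dots> = ennreal (measure lborel (cbox (?k l) (?k u)))"
  proof -
    have "?k l \<bullet> b \<le> ?k u \<bullet> b" if "b \<in> Basis" for b
      using that le by (auto simp: Basis_vec_def inner_axis relabel_def)
    then show ?thesis by (simp add: emeasure_lborel_box content_cbox inner_diff_left)
  qed
  also have "measure lborel (cbox (?k l) (?k u)) = (\<Prod>i\<in>UNIV. ?k u $ i - ?k l $ i)"
    using ne by (simp add: content_cbox_cart)
  also have "\<dots> = (\<Prod>i\<in>UNIV. u $ i - l $ i)"
    unfolding relabel_def vec_lambda_beta
    using prod.reindex_bij_betw[OF bij_imp_bij_inv[OF r], of "\<lambda>i. u $ i - l $ i"] by simp
  also have "\<dots> = measure lborel (cbox l u)"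
    using ne by (simp add: content_cbox_cart)
  also have "\<dots> = prod ((\<bullet>) (u - l)) Basis"
    using lu by (simp add: content_cbox inner_diff_left)
  finally show "emeasure (distr lborel borel (relabel r)) (box l u)
      = ennreal (prod ((\<bullet>) (u - l)) Basis)" .
qed simp

text \<open>The Borel statement passes to the completion: the image measure is again
  \<open>lborel\<close>, so preimages of null sets are null sets.\<close>

lemma
  fixes r :: "'m::finite \<Rightarrow> 'n::finite"
  assumes r: "bij r"
  shows lebesgue_relabel: "distr lebesgue lebesgue (relabel r :: real^'n \<Rightarrow> real^'m) = lebesgue"
    and measurable_relabel: "(relabel r :: real^'n \<Rightarrow> real^'m) \<in> lebesgue
        \<rightarrow>\<^sub>M lebesgue"
proof -
  let ?h = "relabel r :: real^'n \<Rightarrow> real^'m"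
  have meas: "?h \<in> borel_measurable borel"
    by (intro borel_measurable_continuous_onI linear_continuous_on
        linear_conv_bounded_linear[THEN iffD1] linear_relabel)
  have eq0: "distr lebesgue lborel ?h = lborel"
    using meas lborel_relabel[OF r] by (simp add: distr_completion cong: distr_cong)
  have m1: "?h \<in> lebesgue \<rightarrow>\<^sub>M lborel" using meas by (simp add: measurable_completion)
  show "?h \<in> lebesgue \<rightarrow>\<^sub>M lebesgue"
    by (rule completion.measurable_completion2[OF m1]) (simp add: eq0)
  show "distr lebesgue lebesgue ?h = lebesgue"
    using completion.completion_distr_eq[OF m1] by (simp add: eq0)
qed

lemma set_integral_relabel:
  fixes r :: "'m::finite \<Rightarrow> 'n::finite" and f :: "real^'m \<Rightarrow> real"
  assumes r: "bij r"
  shows "set_integrable lebesgue S f \<longleftrightarrow>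
           set_integrable lebesgue (relabel (inv r) ` S) (\<lambda>x. f (relabel r x))"
    and "(LINT x:S|lebesgue. f x) = (LINT x:relabel (inv r) ` S|lebesgue. f (relabel r x))"
proof -
  let ?h = "relabel r :: real^'n \<Rightarrow> real^'m" and ?k
      = "relabel (inv r) :: real^'m \<Rightarrow> real^'n"
  have hk: "?h (?k y) = y" "?k (?h x) = x" for x y
    using r by (simp_all add: relabel_relabel o_def bij_is_inj bij_is_surj surj_f_inv_f inv_f_f)
  have ind: "indicator (?k ` S) x = (indicator S (?h x) :: real)" for x
  proof -
    have "x \<in> ?k ` S \<longleftrightarrow> ?h x \<in> S"
        by (auto simp: hk intro: image_eqI[where x = "?h x"])
    then show ?thesis by (auto simp: indicator_def)
  qed
  have hm: "?h \<in> lebesgue \<rightarrow>\<^sub>M lebesgue" and km: "?k \<in> lebesgue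
      \<rightarrow>\<^sub>M lebesgue"
    using measurable_relabel r bij_imp_bij_inv by blast+
  let ?F = "\<lambda>x. indicator S x *\<^sub>R f x"
  have mm: "?F \<in> borel_measurable lebesgue
      \<longleftrightarrow> (\<lambda>x. ?F (?h x)) \<in> borel_measurable lebesgue"
  proof
    assume "(\<lambda>x. ?F (?h x)) \<in> borel_measurable lebesgue"
    from measurable_compose[OF km this] show "?F \<in> borel_measurable lebesgue" by (simp add: hk)
  qed (rule measurable_compose[OF hm])
  have "integrable lebesgue ?F \<longleftrightarrow> integrable lebesgue (\<lambda>x. ?F (?h x))"
  proof (cases "?F \<in> borel_measurable lebesgue")
    case True
    then have "integrable (distr lebesgue lebesgue ?h) ?F = integrable lebesgue (\<lambda>x. ?F (?h x))"
      by (intro integrable_distr_eq hm)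
    then show ?thesis by (simp only: lebesgue_relabel[OF r])
  qed (use mm borel_measurable_integrable in blast)
  then show 1: "set_integrable lebesgue S f \<longleftrightarrow> set_integrable lebesgue (?k ` S)
      (\<lambda>x. f (?h x))"
    unfolding set_integrable_def ind .
  have "integral\<^sup>L lebesgue ?F = integral\<^sup>L lebesgue (\<lambda>x. ?F (?h x))"
  \<comment> \<open>If \<open>?F\<close> is not measurable, neither function is integrable and both
    integrals have the default value 0.\<close>
  proof (cases "?F \<in> borel_measurable lebesgue")
    case True
    then have "integral\<^sup>L (distr lebesgue lebesgue ?h) ?F
        = integral\<^sup>L lebesgue (\<lambda>x. ?F (?h x))"
      by (intro integral_distr hm)
    then show ?thesis by (simp only: lebesgue_relabel[OF r])
  next
    case False
    then have "\<not> integrable lebesgue ?F" "\<not> integrable lebesgue (\<lambda>x. ?F (?h x))"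
      using mm borel_measurable_integrable by blast+
    from this[THEN not_integrable_integral_eq] show ?thesis by simp
  qed
  then show "(LINT x:S|lebesgue. f x) = (LINT x:?k ` S|lebesgue. f (?h x))"
    unfolding set_lebesgue_integral_def ind .
qed

text \<open>Real integrands are treated as one-component vectors, the form in which the theorem on
  absolutely integrable functions applies. The second equation also covers non-integrable
  integrands: by the first claim both sides are then 0.\<close>

lemma change_of_variables_wellorder:
  fixes f :: "real^'m::{finite,wellorder} \<Rightarrow> real" and g :: "real^'m::_ \<Rightarrow> real^'m::_"
  assumes S: "S \<in> sets lebesgue"
    and der: "\<And>x. x \<in> S \<Longrightarrow> (g has_derivative g' x) (at x within S)"
    and inj: "inj_on g S"
  shows "set_integrable lebesgue (g ` S) f \<longleftrightarrow>
           set_integrable lebesgue S (\<lambda>x. \<bar>det (matrix (g' x))\<bar> * f (g x))"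
    and "(LINT x:g ` S|lebesgue. f x) = (LINT x:S|lebesgue. \<bar>det (matrix (g' x))\<bar> * f (g x))"
proof -
  let ?D = "\<lambda>x. \<bar>det (matrix (g' x))\<bar> * f (g x)"
  have *: "(\<lambda>x. \<bar>det (matrix (g' x))\<bar> *\<^sub>R vec (f (g x)) :: real^1)
      = (\<lambda>x. vec (?D x))"
    by (auto simp: vec_eq_iff)
  have v: "(\<lambda>x. vec (h x) :: real^1) absolutely_integrable_on T
      \<longleftrightarrow> h absolutely_integrable_on T"
    for h :: "real^'m::_ \<Rightarrow> real" and T
  proof
    assume "(\<lambda>x. vec (h x) :: real^1) absolutely_integrable_on T"
    from absolutely_integrable_linear[OF this bounded_linear_vec_nth[of 1]]
    show "h absolutely_integrable_on T" by (simp add: o_def)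
  next
    have "bounded_linear (vec :: real \<Rightarrow> real^1)"
      by (intro linear_conv_bounded_linear[THEN iffD1] linearI) (auto simp: vec_eq_iff)
    then show "(\<lambda>x. vec (h x) :: real^1) absolutely_integrable_on T"
        if "h absolutely_integrable_on T"
      using absolutely_integrable_linear[OF that] by (simp add: o_def)
  qed
  show 1: "set_integrable lebesgue (g ` S) f \<longleftrightarrow> set_integrable lebesgue S ?D"
    using absolutely_integrable_change_of_variables[OF S der inj, of "\<lambda>x. vec (f x) :: real^1"]
    by (simp only: * v)
  show "(LINT x:g ` S|lebesgue. f x) = (LINT x:S|lebesgue. ?D x)"
  proof (cases "set_integrable lebesgue S ?D")
    case True
    have A: "integral (g ` S) (\<lambda>x. vec (f x) :: real^1) = integral S (\<lambda>x. vec (?D x))"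
      unfolding *[symmetric] using True 1
      by (intro integral_change_of_variables[OF S _ inj] der) (auto simp: v)
    have B: "integral T (\<lambda>x. vec (h x) :: real^1) $ 1 = integral T h"
      if "h absolutely_integrable_on T" for h :: "real^'m::_ \<Rightarrow> real" and T
    proof -
      have "(\<lambda>x. vec (h x) :: real^1) integrable_on T"
        using that v set_lebesgue_integral_eq_integral(1) by blast
      from integral_linear[OF this, of "\<lambda>x. x $ 1"] show ?thesis
        by (simp add: o_def bounded_linear_vec_nth)
    qed
    have "integral (g ` S) f = integral S ?D"
      unfolding B[OF True, symmetric] B[OF True[folded 1], symmetric] A ..
    then show ?thesis using True 1 by (simp add: set_lebesgue_integral_eq_integral)
  next
    case False
    then show ?thesis using 1
      by (simp add: set_integrable_def set_lebesgue_integral_def not_integrable_integral_eq)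
  qed
qed

text \<open>The map is conjugated by a relabelling of the coordinates. The equation of the integrals
  includes the non-integrable case, so that integrals can be pulled back before integrability is
  known.\<close>

theorem change_of_variables:
  fixes f :: "real^'n::finite \<Rightarrow> real" and g :: "real^'n \<Rightarrow> real^'n"
  assumes S: "S \<in> sets lebesgue"
    and der: "\<And>x. x \<in> S \<Longrightarrow> (g has_derivative g' x) (at x within S)"
    and inj: "inj_on g S"
  shows "set_integrable lebesgue (g ` S) f \<longleftrightarrow>
           set_integrable lebesgue S (\<lambda>x. \<bar>det (matrix (g' x))\<bar> * f (g x))"
    and "(LINT x:g ` S|lebesgue. f x) = (LINT x:S|lebesgue. \<bar>det (matrix (g' x))\<bar> * f (g x))"
proof -
  define r where "r = inv (Rep_idx :: 'n idx \<Rightarrow> 'n)"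
  have r: "bij r" "bij (inv r)"
    unfolding r_def by (auto intro!: bij_imp_bij_inv bij_Rep_idx)
  let ?h = "relabel r :: real^('n idx) \<Rightarrow> real^'n" and ?k
      = "relabel (inv r) :: real^'n \<Rightarrow> real^('n idx)"
  have hk: "?h (?k y) = y" "?k (?h x) = x" for x y
    using r by (simp_all add: relabel_relabel o_def bij_is_inj bij_is_surj surj_f_inv_f inv_f_f)
  have kS: "?k ` S \<in> sets lebesgue"
  proof -
    have "?k ` S = ?h -` S \<inter> space lebesgue" using hk by (auto simp: image_iff) metis
    then show ?thesis using measurable_sets[OF measurable_relabel[OF r(1)] S] by simp
  qed
  let ?g = "\<lambda>x. ?k (g (?h x))" and ?g' = "\<lambda>x v. ?k (g' (?h x) (?h v))"
  have der': "(?g has_derivative ?g' x) (at x within ?k ` S)" if "x \<in> ?k ` S" for x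
  proof -
    have hx: "?h x \<in> S" and im: "?h ` ?k ` S = S" using that hk by (auto simp: image_image)
    have d1: "(?h has_derivative ?h) (at x within ?k ` S)"
      by (simp add: linear_imp_has_derivative linear_relabel)
    have d2: "(g has_derivative g' (?h x)) (at (?h x) within ?h ` ?k ` S)"
      using der[OF hx] im by simp
    have d3: "((\<lambda>y. g (?h y)) has_derivative (\<lambda>v. g' (?h x) (?h v))) (at x within ?k ` S)"
      using diff_chain_within[OF d1 d2] by (simp add: o_def)
    show ?thesis
      using bounded_linear.has_derivative[OF linear_conv_bounded_linear[THEN iffD1, OF linear_relabel] d3] .
  qed
  have inj': "inj_on ?g (?k ` S)"
    using inj by (auto simp: inj_on_def hk dest!: arg_cong[of _ _ ?h])
  have img: "?g ` ?k ` S = ?k ` g ` S" by (simp add: image_image hk)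
  \<comment> \<open>The Jacobian of the conjugated map is the old one with rows and columns
    renumbered alike, which leaves the determinant unchanged.\<close>
  have det: "det (matrix (?g' x)) = det (matrix (g' (?h x)))" if "x \<in> ?k ` S" for x
  proof -
    have "?h x \<in> S" using that hk by auto
    have ax: "?h (axis j 1) = axis (inv r j) 1" for j
      using r by (auto simp: relabel_def axis_def vec_eq_iff)
        (metis bij_inv_eq_iff bij_is_surj surj_f_inv_f)+
    have "matrix (?g' x) = (\<chi> i j. matrix (g' (?h x)) $ inv r i $ inv r j)"
      by (simp add: matrix_def vec_eq_iff ax) (simp add: relabel_def)
    then show ?thesis using det_reindex[OF r(2)] by metis
  qed
  have kS_sub: "indicator (?k ` S) x *\<^sub>R (\<bar>det (matrix (?g' x))\<bar> * f (?h (?g x))) =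
      indicator (?k ` S) x *\<^sub>R (\<bar>det (matrix (g' (?h x)))\<bar> * f (g (?h x)))" for x
    using det by (auto simp: indicator_def hk)
  have cov1: "set_integrable lebesgue (?k ` g ` S) (\<lambda>x. f (?h x)) \<longleftrightarrow>
      set_integrable lebesgue (?k ` S) (\<lambda>x. \<bar>det (matrix (?g' x))\<bar> * f (?h (?g x)))"
    unfolding img[symmetric] by (rule change_of_variables_wellorder(1)[OF kS _ inj']) (rule der')
  have cov2: "(LINT x:?k ` g ` S|lebesgue. f (?h x)) =
      (LINT x:?k ` S|lebesgue. \<bar>det (matrix (?g' x))\<bar> * f (?h (?g x)))"
    unfolding img[symmetric] by (rule change_of_variables_wellorder(2)[OF kS _ inj']) (rule der')
  have "set_integrable lebesgue (g ` S) f \<longleftrightarrow> set_integrable lebesgue (?k ` g ` S)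
      (\<lambda>x. f (?h x))"
    by (rule set_integral_relabel(1)[OF r(1)])
  also have "\<dots> \<longleftrightarrow> set_integrable lebesgue (?k ` S)
      (\<lambda>x. \<bar>det (matrix (g' (?h x)))\<bar> * f (g (?h x)))"
    unfolding cov1 by (simp only: set_integrable_def kS_sub)
  also have "\<dots> \<longleftrightarrow> set_integrable lebesgue S
      (\<lambda>x. \<bar>det (matrix (g' x))\<bar> * f (g x))"
    by (rule set_integral_relabel(1)[OF r(1), symmetric])
  finally show "set_integrable lebesgue (g ` S) f \<longleftrightarrow>
      set_integrable lebesgue S (\<lambda>x. \<bar>det (matrix (g' x))\<bar> * f (g x))" .
  have "(LINT x:g ` S|lebesgue. f x) = (LINT x:?k ` g ` S|lebesgue. f (?h x))"
    by (rule set_integral_relabel(2)[OF r(1)])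
  also have "\<dots> = (LINT x:?k ` S|lebesgue. \<bar>det (matrix (g' (?h x)))\<bar> * f (g (?h x)))"
    unfolding cov2 by (simp only: set_lebesgue_integral_def kS_sub)
  also have "\<dots> = (LINT x:S|lebesgue. \<bar>det (matrix (g' x))\<bar> * f (g x))"
    by (rule set_integral_relabel(2)[OF r(1), symmetric])
  finally show "(LINT x:g ` S|lebesgue. f x) = (LINT x:S|lebesgue. \<bar>det (matrix (g' x))\<bar>
      * f (g x))" .
qed

section \<open>Determinants of rank-one perturbations\<close>

text \<open>Cramer's rule for the identity matrix.\<close>

lemma det_mat1_row:
  fixes a :: "real^'n::finite"
  shows "det (\<chi> i. if i = k then a else axis i 1) = a $ k"
proof -
  have r: "row i (mat 1 :: real^'n^'n) = axis i 1" for i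
    by (simp add: vec_eq_iff row_def mat_def axis_def)
  have s: "(\<Sum>i\<in>UNIV. a $ i *s axis i 1) = a"
    by (simp add: vec_eq_iff axis_def if_distrib cong: if_cong)
  show ?thesis
    using cramer_lemma_transpose[of k a "mat 1 :: real^'n^'n"] unfolding r s by simp
qed

text \<open>The multiples of row \<open>k\<close> that are added to other rows are removed one by
  one by row operations.\<close>

lemma det_shear_row:
  fixes a w :: "real^'n::finite"
  assumes "finite T" "k \<notin> T"
  shows "det (\<chi> i. if i = k then a else axis i 1
      + (if i \<in> T then w $ i else 0) *\<^sub>R a) = a $ k"
  using assms
proof (induction T rule: finite_induct)
  case empty
  have "(\<chi> i. if i = k then a else axis i 1 + (if i \<in> {} then w $ i else 0) *\<^sub>R a) =
      (\<chi> i. if i = k then a else axis i 1)" by (simp add: vec_eq_iff)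
  then show ?case using det_mat1_row[of k a] by simp
next
  case (insert l T)
  let ?A = "\<chi> i. if i = k then a else axis i 1 + (if i \<in> T then w $ i else 0) *\<^sub>R a"
  have "det (\<chi> i. if i = l then row l ?A + w $ l *s row k ?A else row i ?A) = det ?A"
    using insert by (intro det_row_operation) auto
  also have "(\<chi> i. if i = l then row l ?A + w $ l *s row k ?A else row i ?A) =
      (\<chi> i. if i = k then a else axis i 1 + (if i \<in> insert l T then w $ i else 0) *\<^sub>R a)"
    using insert by (auto simp: vec_eq_iff row_def)
  finally show ?case using insert by simp
qed

text \<open>Rows are perturbed one at a time. By linearity in the new row \<open>k\<close>, its
  unperturbed part gives the induction hypothesis, and its perturbation \<open>w $ k *s a\<close>
  gives the shear determinant.\<close>

lemma det_rank_one_rows: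
  fixes a w :: "real^'n::finite"
  assumes "finite T"
  shows "det (\<chi> i. axis i 1 + (if i \<in> T then w $ i else 0) *\<^sub>R a)
      = 1 + (\<Sum>i\<in>T. w $ i * a $ i)"
  using assms
proof (induction T rule: finite_induct)
  case empty
  have "(\<chi> i. axis i 1 + (if i \<in> {} then w $ i else 0) *\<^sub>R a) = (mat 1 :: real^'n^'n)"
    by (simp add: vec_eq_iff mat_def axis_def)
  then show ?case by simp
next
  case (insert k T)
  let ?c = "\<lambda>i. axis i 1 + (if i \<in> T then w $ i else 0) *\<^sub>R a"
  have eq: "(\<chi> i. axis i 1 + (if i \<in> insert k T then w $ i else 0) *\<^sub>R a) =
      (\<chi> i. if i = k then ?c i + w $ k *s a else ?c i)"
    using insert by (auto simp: vec_eq_iff)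
  have add: "det (\<chi> i. if i = k then ?c i + w $ k *s a else ?c i) =
      det (\<chi> i. if i = k then ?c i else ?c i) + det (\<chi> i. if i = k then w $ k *s a else ?c i)"
    by (rule det_row_add[of k ?c "\<lambda>_. w $ k *s a" ?c])
  have mul: "det (\<chi> i. if i = k then w $ k *s a else ?c i)
      = w $ k * det (\<chi> i. if i = k then a else ?c i)"
    by (rule det_row_mul[of k "w $ k" "\<lambda>_. a" ?c])
  have row: "det (\<chi> i. if i = k then a else ?c i) = a $ k"
    using insert by (intro det_shear_row)
  have same: "(\<chi> i. if i = k then ?c i else ?c i) = (\<chi> i. ?c i)"
    by (simp add: vec_eq_iff)
  show ?case
    unfolding eq add mul row same insert.IH using insert by simp
qed

text \<open>The matrix determinant lemma. It evaluates the Jacobians of the two substitutions that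
  act along a facet normal.\<close>

lemma det_rank_one:
  fixes a w :: "real^'n::finite"
  shows "det (matrix (\<lambda>v. v + (a \<bullet> v) *\<^sub>R w)) = 1 + a \<bullet> w"
proof -
  have eq: "matrix (\<lambda>v. v + (a \<bullet> v) *\<^sub>R w)
      = (\<chi> i. axis i 1 + (if i \<in> UNIV then w $ i else 0) *\<^sub>R a)"
    by (simp add: matrix_def vec_eq_iff inner_axis) (simp add: axis_def eq_commute)
  have "det (matrix (\<lambda>v. v + (a \<bullet> v) *\<^sub>R w)) = 1 + (\<Sum>i\<in>UNIV. w $ i * a $ i)"
    unfolding eq by (rule det_rank_one_rows) simp
  also have "(\<Sum>i\<in>UNIV. w $ i * a $ i) = a \<bullet> w"
    by (simp add: inner_vec_def mult.commute)
  finally show ?thesis .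
qed


section \<open>Polytopes with interior points\<close>

definition facet_level :: "(real^'n::finite) set \<Rightarrow> (real^'n) set \<Rightarrow> real" where
  "facet_level K F = facet_normal K F \<bullet> (SOME x. x \<in> F)"

text \<open>For a facet of a solid polytope this is the signed distance to its hyperplane, positive
  on the side of the polytope. The point chosen in \<open>facet_level\<close> is immaterial, because
  the facet lies in one hyperplane.\<close>

definition gap :: "(real^'n::finite) set \<Rightarrow> (real^'n) set \<Rightarrow> real^'n
    \<Rightarrow> real" where
  "gap K F z = facet_level K F - facet_normal K F \<bullet> z"

locale solid_polytope =
  fixes K :: "(real^'n::finite) set"
  assumes polytope: "polytope K" and interior_ne: "interior K \<noteq> {}"
begin

lemma compact_K: "compact K" using polytope polytope_imp_compact by blast
lemma convex_K: "convex K" using polytope polytope_imp_convex by blast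
lemma closed_K: "closed K" using compact_K compact_imp_closed by blast

lemma aff_dim_K: "aff_dim K = int CARD('n)"
  using aff_dim_nonempty_interior[OF interior_ne] by simp

lemma affine_hull_K: "affine hull K = UNIV"
  using interior_ne affine_hull_nonempty_interior by blast

lemma finite_facets: "finite {F. F facet_of K}"
  using polytope finite_polytope_facets by blast

text \<open>Both sides are affine of dimension n - 1; for the facet this uses that \<open>K\<close>
  is full-dimensional.\<close>

lemma affine_hull_facet:
  assumes F: "F facet_of K" and a: "norm a = 1" and sub: "F \<subseteq> {x. a \<bullet> x = c}"
  shows "affine hull F = {x. a \<bullet> x = c}"
proof (rule affine_dim_equal)
  have "a \<noteq> 0" using a by auto
  show "affine hull F \<noteq> {}" using F by (simp add: facet_of_def)
  show "affine hull F \<subseteq> {x. a \<bullet> x = c}"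
    by (simp add: affine_hyperplane hull_minimal sub)
  show "aff_dim (affine hull F) = aff_dim {x. a \<bullet> x = c}"
    using F \<open>a \<noteq> 0\<close> aff_dim_K
        by (simp add: facet_of_def aff_dim_affine_hull aff_dim_hyperplane)
qed (auto simp: affine_hyperplane)

text \<open>A facet spans its hyperplane, so a vector orthogonal to all chords from one point has no
  tangential part. This serves both for the uniqueness of normals and for transporting normals
  between curved elements.\<close>

lemma normal_parallel:
  assumes F: "F facet_of K" and a: "norm a = 1" and sub: "F \<subseteq> {x. a \<bullet> x = c}"
    and x0: "x0 \<in> F" and N: "\<And>x. x \<in> F \<Longrightarrow> N \<bullet> (x - x0) = 0"
  shows "N = (a \<bullet> N) *\<^sub>R a"
proof -
  have aa: "a \<bullet> a = 1" using a by (simp add: norm_eq_1)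
  have "affine hull F \<subseteq> {x. N \<bullet> x = N \<bullet> x0}"
    using N by (intro hull_minimal) (auto simp: affine_hyperplane inner_diff_right)
  then have H: "{x. a \<bullet> x = c} \<subseteq> {x. N \<bullet> x = N \<bullet> x0}"
    using affine_hull_facet[OF F a sub] by simp
  define w where "w = N - (a \<bullet> N) *\<^sub>R a"
  have aw: "a \<bullet> w = 0" by (simp add: w_def inner_diff_right aa)
  have "x0 + w \<in> {x. a \<bullet> x = c}" using sub x0 aw by (auto simp: inner_add_right)
  with H have "N \<bullet> (x0 + w) = N \<bullet> x0" by blast
  then have "N \<bullet> w = 0" by (simp add: inner_add_right)
  then have "w \<bullet> w = 0" using aw by (simp add: w_def inner_diff_left inner_commute)
  then show ?thesis by (simp add: w_def)
qed

lemma supporting_normal_unique: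
  assumes F: "F facet_of K"
    and 1: "norm a1 = 1" "\<forall>x\<in>K. a1 \<bullet> x \<le> c1" "F = {x\<in>K. a1 \<bullet> x = c1}"
    and 2: "norm a2 = 1" "\<forall>x\<in>K. a2 \<bullet> x \<le> c2" "F = {x\<in>K. a2 \<bullet> x = c2}"
  shows "a1 = a2"
proof -
  obtain x0 where x0: "x0 \<in> F" using F by (auto simp: facet_of_def)
  have mem: "a1 \<bullet> y = c1" "a2 \<bullet> y = c2" if "y \<in> F" for y
    using that 1(3) 2(3) by blast+
  have eq: "a2 = (a1 \<bullet> a2) *\<^sub>R a1"
    by (rule normal_parallel[OF F 1(1) _ x0, of c1])
        (use mem x0 in \<open>auto simp: inner_diff_right\<close>)
  have "norm a2 = \<bar>a1 \<bullet> a2\<bar> * norm a1" by (subst eq) simp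
  then have "\<bar>a1 \<bullet> a2\<bar> = 1" using 1(1) 2(1) by simp
  then consider "a1 \<bullet> a2 = 1" | "a1 \<bullet> a2 = -1" by linarith
  then show ?thesis
  proof cases
    case 1 then show ?thesis using eq by simp
  next
    \<comment> \<open>Opposite normals would put all of \<open>K\<close> into the hyperplane of the
      facet.\<close>
    assume "a1 \<bullet> a2 = -1"
    then have a2: "a2 = - a1" using eq by simp
    have "c2 = - c1" using mem[OF x0] a2 by simp
    then have "a1 \<bullet> x = c1" if "x \<in> K" for x
      using that 1(2) 2(2) a2 by fastforce
    then have "F = K" using 1(3) by blast
    then show ?thesis using F by simp
  qed
qed

text \<open>The family of half-spaces is taken minimal, since only then does each bounding
  hyperplane cut out a facet. The affine hull of \<open>K\<close> drops out because it is the whole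
  space.\<close>

lemma halfspace_representation:
  obtains I and a :: "(real^'n) set \<Rightarrow> real^'n" and b where
    "K = {x. \<forall>h\<in>I. a h \<bullet> x
        \<le> b h}" "\<And>h. h \<in> I \<Longrightarrow> norm (a h) = 1"
    "\<And>C. C facet_of K \<longleftrightarrow> (\<exists>h\<in>I. C
        = K \<inter> {x. a h \<bullet> x = b h})"
proof -
  have "polyhedron K" using polytope polytope_imp_polyhedron by blast
  then obtain I where fin: "finite I" and K: "K = affine hull K \<inter> \<Inter>I"
    and hs: "\<forall>h\<in>I. \<exists>a b. a \<noteq> 0 \<and> h = {x. a \<bullet> x \<le> b}"
    and min: "\<forall>F'. F' \<subset> I \<longrightarrow> K \<subset> affine hull K \<inter> \<Inter>F'"
    unfolding polyhedron_Int_affine_minimal by blast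
  have "\<exists>a b. norm a = 1 \<and> h = {x. a \<bullet> x \<le> b}" if "h \<in> I" for h
  proof -
    obtain a b where ab: "a \<noteq> 0" "h = {x. a \<bullet> x \<le> b}"
        using hs \<open>h \<in> I\<close> by blast
    then have "h = {x. (a /\<^sub>R norm a) \<bullet> x \<le> b / norm a}"
      by (simp add: field_simps)
    then show ?thesis using ab by (intro exI[of _ "a /\<^sub>R norm a"] exI[of _ "b / norm a"]) simp
  qed
  then obtain a b where ab: "\<And>h. h \<in> I \<Longrightarrow> norm (a h :: real^'n) = 1 \<and> h
      = {x. a h \<bullet> x \<le> b h}"
    by metis
  show thesis
  proof (rule that)
    show "K = {x. \<forall>h\<in>I. a h \<bullet> x \<le> b h}"
    proof -
      have "K = \<Inter>I" using K affine_hull_K by simp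
      also have "\<dots> = {x. \<forall>h\<in>I. a h \<bullet> x \<le> b h}" using ab by blast
      finally show ?thesis .
    qed
    show "C facet_of K \<longleftrightarrow> (\<exists>h\<in>I. C
        = K \<inter> {x. a h \<bullet> x = b h})" for C
    proof -
      have "C facet_of K \<longleftrightarrow> (\<exists>h. h \<in> I \<and> C
          = K \<inter> {x. a h \<bullet> x = b h})"
      proof (rule facet_of_polyhedron_explicit[OF fin K])
        show "a h \<noteq> 0 \<and> h = {x. a h \<bullet> x \<le> b h}" if "h \<in> I" for h
          using ab[OF that] by auto
        show "K \<subset> affine hull K \<inter> \<Inter>F'" if "F' \<subset> I" for F'
          by (rule min[rule_format, OF that])
      qed
      then show ?thesis by blast
    qed
  qed (use ab in auto)
qed

text \<open>The half-spaces provide a supporting unit normal, and its uniqueness makes the definite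
  description in \<open>facet_normal\<close> meaningful.\<close>

lemma facet_normal_level:
  assumes F: "F facet_of K"
  shows "norm (facet_normal K F) = 1"
    and "x \<in> K \<Longrightarrow> 0 \<le> gap K F x"
    and "F = {x\<in>K. gap K F x = 0}"
proof -
  obtain I :: "(real^'n) set set" and a b where Iab: "K
      = {x. \<forall>h\<in>I. a h \<bullet> x
      \<le> b h}" "\<And>h. h \<in> I \<Longrightarrow> norm (a h :: real^'n) = 1"
    "\<And>C. C facet_of K \<longleftrightarrow> (\<exists>h\<in>I. C
        = K \<inter> {x. a h \<bullet> x = b h})"
    by (rule halfspace_representation, rule that)
  let ?P = "\<lambda>a. norm a = 1 \<and> (\<exists>c. (\<forall>x\<in>K. a \<bullet> x
      \<le> c) \<and> F = {x\<in>K. a \<bullet> x = c})"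
  have "\<exists>!a. ?P a"
  proof (rule ex_ex1I)
    obtain h where h: "h \<in> I" "F = K \<inter> {x. a h \<bullet> x = b h}" using F Iab(3) by blast
    have "\<forall>x\<in>K. a h \<bullet> x \<le> b h" using Iab(1) h(1) by blast
    then show "\<exists>a. ?P a" using h Iab(2)[OF h(1)]
        by (intro exI[of _ "a h"] conjI exI[of _ "b h"]) auto
    show "a1 = a2" if "?P a1" "?P a2" for a1 a2
      using that supporting_normal_unique[OF F] by blast
  qed
  from theI'[OF this] have "?P (facet_normal K F)" unfolding facet_normal_def .
  then obtain c where c: "norm (facet_normal K F)
      = 1" "\<forall>x\<in>K. facet_normal K F \<bullet> x \<le> c"
    "F = {x\<in>K. facet_normal K F \<bullet> x = c}" by blast
  define y where "y = (SOME x. x \<in> F)"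
  have "y \<in> F" unfolding y_def using F by (simp add: facet_of_def some_in_eq)
  then have "facet_normal K F \<bullet> y = c" using c(3) by blast
  then have "facet_level K F = c" by (simp add: facet_level_def y_def)
  note lv = this
  show "norm (facet_normal K F) = 1" "x \<in> K \<Longrightarrow> 0 \<le> gap K F x"
    using c(1,2) by (auto simp: gap_def lv)
  have "{x\<in>K. facet_normal K F \<bullet> x = c} = {x\<in>K. gap K F x = 0}"
    by (auto simp: gap_def lv)
  then show "F = {x\<in>K. gap K F x = 0}" by (rule trans[OF c(3)])
qed

lemma facet_normal_eq:
  assumes F: "F facet_of K" and "norm a = 1" "\<forall>x\<in>K. a \<bullet> x \<le> c" "F
      = {x\<in>K. a \<bullet> x = c}"
  shows "facet_normal K F = a" and "facet_level K F = c"
proof -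
  show eq: "facet_normal K F = a"
  proof (rule supporting_normal_unique[OF F _ _ _ assms(2,3,4)])
    show "F = {x\<in>K. facet_normal K F \<bullet> x = facet_level K F}"
      by (rule trans[OF facet_normal_level(3)[OF F]]) (auto simp: gap_def)
  qed (use facet_normal_level(1,2)[OF F] in \<open>auto simp: gap_def\<close>)
  define y where "y = (SOME x. x \<in> F)"
  have "y \<in> F" unfolding y_def using F by (simp add: facet_of_def some_in_eq)
  then have "a \<bullet> y = c" using assms(4) by blast
  then show "facet_level K F = c" using eq by (simp add: facet_level_def y_def)
qed

lemma K_eq_gaps: "K = {x. \<forall>F. F facet_of K \<longrightarrow> 0 \<le> gap K F x}"
proof -
  obtain I :: "(real^'n) set set" and a b where Iab: "K
      = {x. \<forall>h\<in>I. a h \<bullet> x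
      \<le> b h}" "\<And>h. h \<in> I \<Longrightarrow> norm (a h :: real^'n) = 1"
    "\<And>C. C facet_of K \<longleftrightarrow> (\<exists>h\<in>I. C
        = K \<inter> {x. a h \<bullet> x = b h})"
    by (rule halfspace_representation, rule that)
  have "x \<in> K" if x: "\<And>F. F facet_of K \<Longrightarrow> 0 \<le> gap K F x" for x
  proof -
    have "a h \<bullet> x \<le> b h" if h: "h \<in> I" for h
    proof -
      let ?F = "K \<inter> {x. a h \<bullet> x = b h}"
      have F: "?F facet_of K" using Iab(3) h by blast
      have "\<forall>x\<in>K. a h \<bullet> x \<le> b h" using Iab(1) h by blast
      from facet_normal_eq[OF F Iab(2)[OF h] this]
      have "facet_normal K ?F = a h" "facet_level K ?F = b h" by (simp_all add: Int_def)
      then show ?thesis using x[OF F] by (simp add: gap_def)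
    qed
    then show ?thesis using Iab(1) by blast
  qed
  then show ?thesis using facet_normal_level(2) by auto
qed

text \<open>A facet is a proper face and therefore misses the interior; conversely, finitely many
  strict inequalities define an open subset of \<open>K\<close>.\<close>

lemma interior_eq_gaps: "interior K = {x. \<forall>F. F facet_of K \<longrightarrow> 0 < gap K F x}"
proof (rule antisym)
  have "open (\<Inter>F\<in>{F. F facet_of K}. {x. 0 < gap K F x})"
    using finite_facets by (intro open_INT) (auto simp: gap_def intro!: open_Collect_less continuous_intros)
  also have "(\<Inter>F\<in>{F. F facet_of K}. {x. 0 < gap K F x})
      = {x. \<forall>F. F facet_of K \<longrightarrow> 0 < gap K F x}"
    by auto
  finally show "{x. \<forall>F. F facet_of K \<longrightarrow> 0 < gap K F x} \<subseteq> interior K"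
    by (rule interior_maximal[rotated]) (subst (2) K_eq_gaps, auto intro: less_imp_le)
  show "interior K \<subseteq> {x. \<forall>F. F facet_of K \<longrightarrow> 0 < gap K F x}"
  proof clarify
    fix x F assume x: "x \<in> interior K" and F: "F facet_of K"
    have "x \<notin> F"
      using face_of_disjoint_interior[of F K] F x facet_of_irrefl facet_of_imp_face_of by blast
    moreover have "x \<in> K" using x interior_subset by auto
    ultimately show "0 < gap K F x"
      using facet_normal_level(2)[OF F, of x] facet_normal_level(3)[OF F] by fastforce
  qed
qed

end

section \<open>Boundary layers of a polytope\<close>

text \<open>A cutoff profile that vanishes for \<open>t \<le> 0\<close> and increases to 1. The
  square makes it continuously differentiable at 0, and the rational form gives the elementary
  inverse \<open>ramp_inv\<close>.\<close>

definition ramp :: "real \<Rightarrow> real" where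
  "ramp t = (max 0 t)\<^sup>2 / (1 + (max 0 t)\<^sup>2)"

definition ramp' :: "real \<Rightarrow> real" where
  "ramp' t = 2 * max 0 t / (1 + (max 0 t)\<^sup>2)\<^sup>2"

lemma one_plus_max0_power2_pos: "1 + (max 0 t)\<^sup>2 > (0::real)"
  by (smt (verit) zero_le_power2)

lemma ramp_alt: "ramp t = 1 - 1 / (1 + (max 0 t)\<^sup>2)"
  using one_plus_max0_power2_pos[of t] by (simp add: ramp_def field_simps)

lemma ramp_bounds: "0 \<le> ramp t" "ramp t < 1"
  using one_plus_max0_power2_pos[of t] by (simp_all add: ramp_def)

lemma abs_ramp_le: "\<bar>ramp t\<bar> \<le> 1"
  using ramp_bounds[of t] by simp

lemma ramp_nonpos [simp]: "t \<le> 0 \<Longrightarrow> ramp t = 0" "t \<le> 0 \<Longrightarrow> ramp' t = 0"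
  by (simp_all add: ramp_def ramp'_def)

lemma ramp'_nonneg: "0 \<le> ramp' t"
  by (simp add: ramp'_def)

lemma DERIV_max0_power2: "((\<lambda>t. (max 0 t)\<^sup>2) has_real_derivative 2 * max 0 t) (at t)"
proof -
  consider "t > 0" | "t < 0" | "t = 0" by linarith
  then show ?thesis
  proof cases
    case 1
    have "((\<lambda>t. t\<^sup>2) has_real_derivative 2 * max 0 t) (at t)"
      using 1 by (auto intro!: derivative_eq_intros)
    then show ?thesis
      by (rule has_field_derivative_transform_within_open[of _ _ _ "{0<..}"]) (use 1 in auto)
  next
    case 2
    have "((\<lambda>t. 0) has_real_derivative 2 * max 0 t) (at t)" using 2 by simp
    then show ?thesis
      by (rule has_field_derivative_transform_within_open[of _ _ _ "{..<0}"]) (use 2 in auto)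
  next
    case 3
    have "((\<lambda>h::real. (max 0 h)\<^sup>2 / h) \<longlongrightarrow> 0) (at 0)"
    proof (rule Lim_null_comparison)
      show "\<forall>\<^sub>F h in at 0. norm ((max 0 h)\<^sup>2 / h) \<le> \<bar>h\<bar>"
        by (rule always_eventually) (auto simp: max_def power2_eq_square)
      show "((\<lambda>h. \<bar>h\<bar>) \<longlongrightarrow> (0::real)) (at 0)"
        by (auto intro!: tendsto_eq_intros)
    qed
    then show ?thesis using 3 by (simp add: DERIV_def)
  qed
qed

lemma DERIV_ramp: "(ramp has_real_derivative ramp' t) (at t)"
proof -
  have "((\<lambda>t. (max 0 t)\<^sup>2 / (1 + (max 0 t)\<^sup>2)) has_real_derivative ramp' t) (at t)"
    using DERIV_divide[OF DERIV_max0_power2 DERIV_add[OF DERIV_const DERIV_max0_power2], of 1 t]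
      one_plus_max0_power2_pos[of t]
    by (simp add: ramp'_def power2_eq_square algebra_simps)
  then show ?thesis by (simp add: ramp_def[abs_def])
qed

lemma continuous_on_ramp [continuous_intros]:
  "continuous_on S f \<Longrightarrow> continuous_on S (\<lambda>x. ramp (f x))"
  unfolding ramp_def using one_plus_max0_power2_pos
  by (intro continuous_intros) (auto simp: less_le)

lemma continuous_on_ramp' [continuous_intros]:
  "continuous_on S f \<Longrightarrow> continuous_on S (\<lambda>x. ramp' (f x))"
  unfolding ramp'_def using one_plus_max0_power2_pos
  by (intro continuous_intros) (auto simp: less_le)

lemma ramp_strict_mono: "0 < s \<Longrightarrow> s < t \<Longrightarrow> ramp s < ramp t"
  by (simp add: ramp_alt divide_strict_left_mono power_strict_mono mult_pos_pos add_pos_nonneg)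

lemma ramp_inj: "0 < s \<Longrightarrow> 0 < t \<Longrightarrow> ramp s = ramp t \<Longrightarrow> s = t"
  using ramp_strict_mono by (metis linorder_neqE_linordered_idom less_irrefl)

definition ramp_inv :: "real \<Rightarrow> real" where
  "ramp_inv \<tau> = sqrt (\<tau> / (1 - \<tau>))"

lemma ramp_inv_pos: "0 < \<tau> \<Longrightarrow> \<tau> < 1 \<Longrightarrow> 0 < ramp_inv \<tau>"
  by (simp add: ramp_inv_def)

lemma ramp_ramp_inv: "0 < \<tau> \<Longrightarrow> \<tau> < 1 \<Longrightarrow> ramp
    (ramp_inv \<tau>) = \<tau>"
  by (simp add: ramp_def ramp_inv_def max_def field_simps)

lemma ramp_gt_0: "0 < t \<Longrightarrow> 0 < ramp t"
  using one_plus_max0_power2_pos[of t] by (simp add: ramp_def)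

lemma ramp_inv_ramp: "0 < t \<Longrightarrow> ramp_inv (ramp t) = t"
  using ramp_ramp_inv[of "ramp t"] ramp_inj[of "ramp_inv (ramp t)" t] ramp_inv_pos[of "ramp t"]
    ramp_gt_0[of t] ramp_bounds[of t] by simp

lemma tendsto_ramp_at_top: "(ramp \<longlongrightarrow> 1) at_top"
proof -
  have "((\<lambda>t::real. 1 - 1 / (1 + t\<^sup>2)) \<longlongrightarrow> 1 - 0) at_top"
    by (intro tendsto_intros tendsto_divide_0[OF tendsto_const]
        filterlim_at_top_imp_at_infinity filterlim_tendsto_add_at_top[OF tendsto_const]
        filterlim_pow_at_top filterlim_ident) auto
  then have "((\<lambda>t::real. 1 - 1 / (1 + t\<^sup>2)) \<longlongrightarrow> 1) at_top" by simp
  then show ?thesis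
    by (rule Lim_transform_eventually) (auto intro!: eventually_mono[OF eventually_ge_at_top[of 0]]
        simp: ramp_alt)
qed

text \<open>For a facet, the orthogonal projection onto its hyperplane.\<close>

definition foot :: "(real^'n::finite) set \<Rightarrow> (real^'n) set \<Rightarrow> real^'n
    \<Rightarrow> real^'n" where
  "foot K F y = y + gap K F y *\<^sub>R facet_normal K F"

lemma continuous_on_gap [continuous_intros]:
  "continuous_on S f \<Longrightarrow> continuous_on S (\<lambda>x. gap K F (f x))"
  unfolding gap_def by (intro continuous_intros)

lemma continuous_on_foot [continuous_intros]:
  "continuous_on S f \<Longrightarrow> continuous_on S (\<lambda>x. foot K F (f x))"
  unfolding foot_def by (intro continuous_intros)

lemma borel_measurable_borel_lebesgue: "f \<in> borel_measurable borel \<Longrightarrow> f \<in>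
    borel_measurable lebesgue"
  by (simp add: measurable_completion)

section \<open>Prisms over facets\<close>

context solid_polytope
begin

context
  fixes F assumes F: "F facet_of K"
begin

lemma normal_inner_self: "facet_normal K F \<bullet> facet_normal K F = 1"
  using facet_normal_level(1)[OF F] by (simp add: norm_eq_1)

lemma gap_add_normal: "gap K F (x + t *\<^sub>R facet_normal K F) = gap K F x - t"
  by (simp add: gap_def inner_add_right normal_inner_self)

lemma gap_foot: "gap K F (foot K F y) = 0"
  by (simp add: foot_def gap_add_normal)

lemma convex_facet: "convex F"
  using F facet_of_imp_face_of face_of_imp_convex convex_K by blast

lemma compact_facet: "compact F"
  using F facet_of_imp_face_of face_of_imp_compact convex_K compact_K by blast

lemma facet_subset: "F \<subseteq> K" using F facet_of_imp_subset by blast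

lemma mem_facet_iff: "x \<in> F \<longleftrightarrow> x \<in> K \<and> gap K F x = 0"
  using facet_normal_level(3)[OF F] by blast

text \<open>The prism stands on the outer side of the facet, where the gap is negative.\<close>

lemma mem_facet_prism: "y \<in> facet_prism K F \<longleftrightarrow> - 1
    \<le> gap K F y \<and> gap K F y \<le> 0 \<and> foot K F y \<in> F"
proof
  assume "y \<in> facet_prism K F"
  then obtain x t where xt: "y = x + t *\<^sub>R facet_normal K F" "x \<in> F" "0 \<le> t" "t \<le> 1"
    by (auto simp: facet_prism_def)
  have "gap K F y = - t" using xt mem_facet_iff by (simp add: gap_add_normal)
  then show "- 1 \<le> gap K F y \<and> gap K F y \<le> 0 \<and> foot K F y \<in> F"
    using xt by (simp add: foot_def)
next
  assume "- 1 \<le> gap K F y \<and> gap K F y \<le> 0 \<and> foot K F y \<in> F"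
  then show "y \<in> facet_prism K F"
    unfolding facet_prism_def
    by (auto intro!: exI[of _ "foot K F y"] exI[of _ "- gap K F y"] simp: foot_def)
qed

text \<open>By Pythagoras' theorem. Over the prism the metric projection in
  \<open>facet_integral\<close> thereby becomes an affine map, which can be differentiated.\<close>

lemma closest_point_facet: 
  assumes "foot K F y \<in> F"
  shows "closest_point F y = foot K F y"
proof (rule sym, rule closest_point_unique[OF convex_facet compact_imp_closed[OF compact_facet]
    assms], rule ballI)
  fix z assume z: "z \<in> F"
  let ?a = "facet_normal K F"
  have "?a \<bullet> (foot K F y - z) = 0"
    using z gap_foot[of y] mem_facet_iff[of z] by (simp add: gap_def inner_diff_right)
  then have "orthogonal (y - foot K F y) (foot K F y - z)"
    by (simp add: orthogonal_def foot_def)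
  from norm_add_Pythagorean[OF this]
  have "(norm (y - z))\<^sup>2 = (norm (y - foot K F y))\<^sup>2 + (norm (foot K F y - z))\<^sup>2"
    by simp
  then have "(norm (y - foot K F y))\<^sup>2 \<le> (norm (y - z))\<^sup>2" by simp
  then show "dist y (foot K F y) \<le> dist y z"
    unfolding dist_norm by (rule power2_le_imp_le) simp
qed

lemma compact_facet_prism: "compact (facet_prism K F)"
proof -
  have "facet_prism K F = (\<lambda>(x, t). x + t *\<^sub>R facet_normal K F) ` (F \<times> {0..1})"
    by (auto simp: facet_prism_def image_iff; metis atLeastAtMost_iff)
  moreover have "compact \<dots>"
    by (intro compact_continuous_image compact_Times compact_facet compact_Icc)
      (auto simp: case_prod_unfold intro!: continuous_intros)
  ultimately show ?thesis by simp
qed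

lemma facet_integral_foot:
  "facet_integral K F h = (LINT y:facet_prism K F|lebesgue. h (foot K F y))"
  unfolding facet_integral_def set_lebesgue_integral_def
  by (rule Bochner_Integration.integral_cong) (auto simp: indicator_def mem_facet_prism closest_point_facet)

lemma continuous_on_prism_foot:
  assumes "continuous_on F h"
  shows "continuous_on (facet_prism K F) (\<lambda>y. h (foot K F y))"
  by (rule continuous_on_compose2[OF assms]) (auto intro!: continuous_intros simp: mem_facet_prism)

lemma integrable_prism_foot:
  fixes h :: "real^'n \<Rightarrow> real"
  assumes "continuous_on F h"
  shows "set_integrable lebesgue (facet_prism K F) (\<lambda>y. h (foot K F y))"
proof -
  have "set_integrable lborel (facet_prism K F) (\<lambda>y. h (foot K F y))"
    using borel_integrable_compact[OF compact_facet_prism continuous_on_prism_foot[OF assms]]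
    by (simp add: set_integrable_def)
  then show ?thesis
    by (simp add: set_integrable_def integrable_completion)
qed

text \<open>These are the points above which the ramp of another facet need not tend to 1. They lie
  in finitely many hyperplanes that contain the normal direction of \<open>F\<close>.\<close>

lemma negligible_facet_ridges:
  "negligible {y. foot K F y \<in> F \<and> (\<exists>F'. F' facet_of K \<and> F' \<noteq> F
      \<and> gap K F' (foot K F y) = 0)}"
proof -
  have "negligible {y. foot K F y \<in> F \<and> gap K F' (foot K F y) = 0}"
    if F': "F' facet_of K" and ne: "F' \<noteq> F" for F'
  proof -
    let ?a = "facet_normal K F" and ?a' = "facet_normal K F'"
    \<comment> \<open>\<open>?m\<close> is the part of the other normal tangent to the facet. If it
      is 0, the hyperplanes are parallel: equal normals would give equal facets, opposite normals an
      empty interior.\<close>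
    let ?m = "?a' - (?a' \<bullet> ?a) *\<^sub>R ?a"
    have *: "?m \<bullet> y = facet_level K F' - (?a' \<bullet> ?a) * facet_level K F"
        if "gap K F' (foot K F y) = 0" for y
      using that by (simp add: gap_def foot_def inner_add_right inner_diff_left algebra_simps)
    show ?thesis
    proof (cases "?m = 0")
      case False
      then have "negligible {y. ?m \<bullet> y = facet_level K F' - (?a' \<bullet> ?a) * facet_level K F}"
        by (intro negligible_hyperplane) auto
      then show ?thesis by (rule negligible_subset) (use * in auto)
    next
      case True
      then have eq: "?a' = (?a' \<bullet> ?a) *\<^sub>R ?a" by simp
      have "norm ?a' = \<bar>?a' \<bullet> ?a\<bar> * norm ?a" by (subst eq) simp
      then have "?a' \<bullet> ?a = 1 \<or> ?a' \<bullet> ?a = -1"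
        using facet_normal_level(1)[OF F] facet_normal_level(1)[OF F'] by auto
      then have or: "?a' = ?a \<or> ?a' = - ?a" using eq by (metis scaleR_one scaleR_minus1_left)
      have False if x: "x \<in> F" "gap K F' x = 0" for x
      proof -
        have x0: "gap K F x = 0" "x \<in> K" using x mem_facet_iff by auto
        from or show False
        proof
          assume e: "?a' = ?a"
          then have "facet_level K F' = facet_level K F" using x x0 by (simp add: gap_def)
          then have g: "gap K F' = gap K F" by (simp add: gap_def fun_eq_iff e)
          have "F' = {x\<in>K. gap K F' x = 0}" by (rule facet_normal_level(3)[OF F'])
          also have "\<dots> = {x\<in>K. gap K F x = 0}" by (simp only: g)
          also have "\<dots> = F" by (rule facet_normal_level(3)[OF F, symmetric])
          finally have "F' = F" .
          then show False using ne by simp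
        next
          assume e: "?a' = - ?a"
          then have l: "facet_level K F' = - facet_level K F" using x x0 by (simp add: gap_def)
          obtain p where p: "p \<in> interior K" using interior_ne by blast
          then have "0 < gap K F p" "0 < gap K F' p" using F F' interior_eq_gaps by auto
          then show False using e l by (simp add: gap_def)
        qed
      qed
      then have e: "{y. foot K F y \<in> F \<and> gap K F' (foot K F y) = 0} = {}" by auto
      show ?thesis unfolding e by simp
    qed
  qed
  then have "negligible (\<Union>F'\<in>{F'. F' facet_of K}
      - {F}. {y. foot K F y \<in> F \<and> gap K F' (foot K F y) = 0})"
    using finite_facets by (intro negligible_Union) auto
  then show ?thesis by (rule negligible_subset) auto
qed

lemma negligible_gap_level: "negligible {y. gap K F y = s}"
proof -
  have "negligible {y. facet_normal K F \<bullet> y = facet_level K F - s}"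
    using normal_inner_self by (intro negligible_hyperplane) auto
  then show ?thesis by (rule negligible_subset) (auto simp: gap_def)
qed

end

lemma tendsto_ramp_scaled:
  assumes "x \<longlonglongrightarrow> x0" "0 < x0" and d: "\<And>n. 0 < d n" "d
      \<longlonglongrightarrow> (0::real)"
  shows "(\<lambda>n. ramp (x n / d n)) \<longlonglongrightarrow> 1"
proof -
  have "filterlim d (at_right 0) sequentially"
    using d less_imp_neq[OF d(1), THEN not_sym] by (simp add: filterlim_at)
  then have "filterlim (\<lambda>n. inverse (d n)) at_top sequentially"
    by (rule filterlim_compose[OF filterlim_inverse_at_top_right])
  from filterlim_tendsto_pos_mult_at_top[OF assms(1,2) this]
  have "filterlim (\<lambda>n. x n / d n) at_top sequentially" by (simp add: divide_inverse)
  then show ?thesis by (rule filterlim_compose[OF tendsto_ramp_at_top])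
qed


section \<open>Concentration of the cutoff gradient on a facet\<close>

lemma finite_other_facets: "finite ({F'. F' facet_of K} - {F})"
  using finite_facets by simp

text \<open>
  The substitution \<open>z \<mapsto> z + (g + ramp (g / d)) a\<close>, with \<open>a\<close> the normal of
  the facet and \<open>g\<close> the gap, maps the inner side of the facet onto the slab of height 1 over
  it, and its Jacobian determinant is exactly the weight \<open>ramp' (g / d) / d\<close>.
\<close>

lemma layer_limit:
  fixes h :: "real^'n \<Rightarrow> real"
  assumes F: "F facet_of K" and h: "continuous_on K h"
    and d: "\<And>n. 0 < d n" "d \<longlonglongrightarrow> (0::real)"
  shows "(\<lambda>n. LINT z:K|lebesgue. ramp' (gap K F z / d n) / d n *
            ((\<Prod>F'\<in>{F'. F' facet_of K} - {F}. ramp (gap K F' z / d n)) * h z))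
         \<longlonglongrightarrow> facet_integral K F h"
proof -
  define a where "a = facet_normal K F"
  let ?g = "gap K F"
  let ?I = "{F'. F' facet_of K} - {F}"
  have aa: "a \<bullet> a = 1" using normal_inner_self[OF F] by (simp add: a_def)
  have gadd: "?g (x + t *\<^sub>R a) = ?g x - t" for x t using gap_add_normal[OF F] by (simp add: a_def)
  define S where "S = {z. 0 < ?g z}"
  define Y where "Y = {y. - 1 < ?g y \<and> ?g y < 0}"
  define G where "G \<delta> z = z + (?g z + ramp (?g z / \<delta>)) *\<^sub>R a" for \<delta> z
  \<comment> \<open>The inverse of \<open>G\<close>: the point \<open>G \<delta> z\<close> has gap
    \<open>- ramp (g / \<delta>)\<close>, from which \<open>ramp_inv\<close> recovers the gap of
    \<open>z\<close>.\<close>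
  define Z where "Z \<delta> y = foot K F y - (\<delta> * ramp_inv (- ?g y)) *\<^sub>R a" for \<delta> y
  \<comment> \<open>The indicator of \<open>K\<close> sits in the integrand, so that the
    substitution can take place on the whole open half-space \<open>S\<close>.\<close>
  define \<phi> where "\<phi> \<delta> z = indicator K z
      * ((\<Prod>F'\<in>?I. ramp (gap K F' z / \<delta>)) * h z)" for \<delta> z
  have gG: "?g (G \<delta> z) = - ramp (?g z / \<delta>)" for \<delta> z by (simp add: G_def gadd)
  have gZ: "?g (Z \<delta> y) = \<delta> * ramp_inv (- ?g y)" for \<delta> y
    using gadd[of "foot K F y" "- (\<delta> * ramp_inv (- ?g y))"] gap_foot[OF F, of y] by (simp add: Z_def)
  have ZG: "Z \<delta> (G \<delta> z) = z" if "z \<in> S" "0 < \<delta>" for \<delta> z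
    using that by (simp add: Z_def foot_def gG ramp_inv_ramp S_def a_def[symmetric])
        (simp add: G_def algebra_simps)
  have GZ: "G \<delta> (Z \<delta> y) = y" if "y \<in> Y" "0 < \<delta>" for \<delta> y
    using that by (simp add: G_def gZ ramp_ramp_inv Y_def)
        (simp add: Z_def foot_def a_def[symmetric] algebra_simps)
  have ZS: "Z \<delta> y \<in> S" if "y \<in> Y" "0 < \<delta>" for \<delta> y
    using that ramp_inv_pos[of "- ?g y"] by (simp add: S_def gZ Y_def)
  have GY: "G \<delta> z \<in> Y" if "z \<in> S" "0 < \<delta>" for \<delta> z
    using that ramp_gt_0[of "?g z / \<delta>"] ramp_bounds[of "?g z / \<delta>"]
        by (simp add: Y_def gG S_def)
  have img: "G \<delta> ` S = Y" if "0 < \<delta>" for \<delta>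
  proof
    show "G \<delta> ` S \<subseteq> Y" using GY that by blast
    show "Y \<subseteq> G \<delta> ` S" using GZ ZS that by (metis image_eqI subsetI)
  qed
  have inj: "inj_on (G \<delta>) S" if "0 < \<delta>" for \<delta>
    by (rule inj_on_inverseI[of _ "Z \<delta>"]) (use ZG that in auto)
  have S_meas: "S \<in> sets lebesgue"
  proof -
    have "open S" unfolding S_def by (intro open_Collect_less continuous_intros)
    then show ?thesis by (simp add: borel_open)
  qed
  define w where "w \<delta> z = - ((1 + ramp' (?g z / \<delta>) / \<delta>) *\<^sub>R a)" for \<delta> z
  have der: "(G \<delta> has_derivative (\<lambda>v. v + (a \<bullet> v) *\<^sub>R w \<delta> z))
      (at z within S)" if "0 < \<delta>" for \<delta> z
  proof -
    have dg: "(?g has_derivative (\<lambda>v. - (a \<bullet> v))) (at z within S)"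
      unfolding gap_def a_def by (auto intro!: derivative_eq_intros)
    have "((\<lambda>z. ?g z / \<delta>) has_derivative (\<lambda>v. - (a \<bullet> v) / \<delta>))
        (at z within S)"
      by (rule bounded_linear.has_derivative[OF bounded_linear_divide dg])
    from DERIV_compose_FDERIV[OF DERIV_ramp this]
    have dr: "((\<lambda>z. ramp (?g z / \<delta>)) has_derivative (\<lambda>v.
        - (a \<bullet> v) / \<delta> * ramp' (?g z / \<delta>))) (at z within S)" .
    have "(G \<delta> has_derivative (\<lambda>v. v
        + (- (a \<bullet> v) + - (a \<bullet> v) / \<delta> * ramp' (?g z / \<delta>)) *\<^sub>R a))
        (at z within S)"
      unfolding G_def
      by (intro has_derivative_add has_derivative_ident has_derivative_scaleR_left dg dr)
    then show ?thesis
      by (rule has_derivative_eq_rhs) (auto simp: w_def fun_eq_iff algebra_simps)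
  qed
  \<comment> \<open>The summand \<open>g\<close> in \<open>G\<close> flattens the normal direction:
    \<open>a \<bullet> w = - 1 - ramp' / \<delta>\<close>, so that in
    \<open>1 + a \<bullet> w\<close> only \<open>- ramp' / \<delta>\<close> remains.\<close>
  have det: "\<bar>det (matrix (\<lambda>v. v + (a \<bullet> v) *\<^sub>R w \<delta> z))\<bar>
      = ramp' (?g z / \<delta>) / \<delta>" if "0 < \<delta>" for \<delta> z
    unfolding det_rank_one using that ramp'_nonneg[of "?g z / \<delta>"] by (simp add: w_def aa)
  have cov: "(LINT z:K|lebesgue. ramp' (?g z / \<delta>) / \<delta>
      * ((\<Prod>F'\<in>?I. ramp (gap K F' z / \<delta>)) * h z)) =
      (LINT y:Y|lebesgue. \<phi> \<delta> (Z \<delta> y))" if \<delta>: "0 < \<delta>" for \<delta>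
  proof -
    have "(LINT y:G \<delta> ` S|lebesgue. \<phi> \<delta> (Z \<delta> y)) =
        (LINT z:S|lebesgue. \<bar>det (matrix (\<lambda>v. v
            + (a \<bullet> v) *\<^sub>R w \<delta> z))\<bar> * \<phi> \<delta> (Z \<delta> (G \<delta> z)))"
      by (rule change_of_variables(2)[OF S_meas der[OF \<delta>] inj[OF \<delta>]])
    also have "\<dots> = (LINT z:K|lebesgue. ramp' (?g z / \<delta>) / \<delta>
        * ((\<Prod>F'\<in>?I. ramp (gap K F' z / \<delta>)) * h z))"
      unfolding set_lebesgue_integral_def
    proof (rule Bochner_Integration.integral_cong[OF refl])
      fix z :: "real^'n"
      show "indicator S z *\<^sub>R (\<bar>det
          (matrix (\<lambda>v. v + (a \<bullet> v) *\<^sub>R w \<delta> z))\<bar>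
          * \<phi> \<delta> (Z \<delta> (G \<delta> z))) =
          indicator K z *\<^sub>R (ramp' (?g z / \<delta>) / \<delta>
              * ((\<Prod>F'\<in>?I. ramp (gap K F' z / \<delta>)) * h z))"
      proof (cases "z \<in> S")
        case True then show ?thesis using \<delta> by (simp add: det ZG \<phi>_def)
      next
        case False
        then have "ramp' (?g z / \<delta>) = 0" using \<delta> by (simp add: S_def divide_nonpos_pos)
        then show ?thesis using False by simp
      qed
    qed
    finally show ?thesis by (simp add: img[OF \<delta>])
  qed
  obtain B where B: "\<And>z. z \<in> K \<Longrightarrow> \<bar>h z\<bar> \<le> B" and "0 \<le> B"
  proof -
    have "bounded (h ` K)" using compact_continuous_image[OF h compact_K] compact_imp_bounded by blast
    then obtain B where "\<forall>z\<in>K. norm (h z) \<le> B" by (auto simp: bounded_iff)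
    then show ?thesis using that[of "max B 0"] by fastforce
  qed
  obtain M where M: "\<And>z. z \<in> K \<Longrightarrow> norm z \<le> M"
    using compact_imp_bounded[OF compact_K] by (auto simp: bounded_iff)
  \<comment> \<open>\<open>y\<close> and \<open>Z \<delta> y\<close> differ along the unit normal by
    at most 1 plus the gap of \<open>Z \<delta> y\<close>, which is bounded on \<open>K\<close>. So
    all integrands are supported in one ball.\<close>
  define R where "R = M + (1 + (\<bar>facet_level K F\<bar> + M))"
  have \<phi>_bound: "\<bar>\<phi> \<delta> z\<bar> \<le> B" for \<delta> z
  proof -
    have "\<bar>\<Prod>F'\<in>?I. ramp (gap K F' z / \<delta>)\<bar> \<le> 1"
      unfolding abs_prod by (rule prod_le_1) (auto simp: abs_ramp_le)
    then have "\<bar>\<Prod>F'\<in>?I. ramp (gap K F' z / \<delta>)\<bar> * \<bar>h z\<bar>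
        \<le> 1 * B" if "z \<in> K"
      using B[OF that] by (intro mult_mono) auto
    then show ?thesis using \<open>0 \<le> B\<close> by (auto simp: \<phi>_def indicator_def abs_mult)
  qed
  have R: "norm y \<le> R" if "y \<in> Y" "Z \<delta> y \<in> K" "0 < \<delta>" for y \<delta>
  proof -
    let ?z = "Z \<delta> y"
    have na: "norm a = 1" using aa by (simp add: norm_eq_1)
    have "y = ?z + (?g ?z + - ?g y) *\<^sub>R a"
      unfolding gZ by (simp add: Z_def foot_def a_def[symmetric] algebra_simps)
    then have "norm y \<le> norm ?z + \<bar>?g ?z + - ?g y\<bar>"
      using norm_triangle_ineq[of ?z "(?g ?z + - ?g y) *\<^sub>R a"] na by simp
    moreover have "\<bar>?g ?z\<bar> \<le> \<bar>facet_level K F\<bar> + norm ?z"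
      using Cauchy_Schwarz_ineq2[of a ?z] na by (simp add: gap_def a_def[symmetric])
    moreover have "- 1 < ?g y" "?g y < 0" using that(1) by (auto simp: Y_def)
    ultimately show ?thesis using M[OF that(2)] unfolding R_def by linarith
  qed
  have \<phi>_meas: "\<phi> \<delta> \<in> borel_measurable borel" for \<delta>
  proof -
    have "(\<lambda>z. indicator K z *\<^sub>R ((\<Prod>F'\<in>?I. ramp (gap K F' z / \<delta>))
        * h z)) \<in> borel_measurable borel"
      by (rule borel_measurable_continuous_on_indicator)
        (use closed_K in \<open>auto simp: divide_inverse intro!: continuous_intros h\<close>)
    then show ?thesis by (simp add: \<phi>_def[abs_def])
  qed
  have g_meas [measurable]: "?g \<in> borel_measurable borel"
    by (intro borel_measurable_continuous_onI continuous_intros)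
  have Z_meas: "Z \<delta> \<in> borel_measurable borel" for \<delta>
    unfolding Z_def foot_def ramp_inv_def by measurable
  have Y_meas [measurable]: "Y \<in> sets borel"
    unfolding Y_def by measurable
  \<comment> \<open>Besides the ridges, the levels of the base and the top are excluded, where the
    open slab \<open>Y\<close> and the closed prism disagree.\<close>
  define N where "N = {y. foot K F y \<in> F \<and> (\<exists>F'. F' facet_of K \<and> F' \<noteq> F
      \<and> gap K F' (foot K F y) = 0)}
      \<union> {y. ?g y = 0} \<union> {y. ?g y = - 1}"
  have "negligible N"
    unfolding N_def by (intro negligible_Un negligible_facet_ridges[OF F] negligible_gap_level[OF F])
  have "(\<lambda>n. integral\<^sup>L lebesgue
      (\<lambda>y. indicator Y y *\<^sub>R \<phi> (d n) (Z (d n) y)))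
      \<longlonglongrightarrow> integral\<^sup>L lebesgue
          (\<lambda>y. indicator (facet_prism K F) y *\<^sub>R h (foot K F y))"
  proof (rule integral_dominated_convergence[where w = "\<lambda>y. B * indicator (cball 0 R) y"])
    show "(\<lambda>y. indicator (facet_prism K F) y *\<^sub>R h (foot K F y)) \<in>
        borel_measurable lebesgue"
      using integrable_prism_foot[OF F continuous_on_subset[OF h facet_subset[OF F]]]
      by (simp add: set_integrable_def borel_measurable_integrable)
    show "(\<lambda>y. indicator Y y *\<^sub>R \<phi> (d n) (Z (d n) y)) \<in> borel_measurable
        lebesgue" for n
      by (rule borel_measurable_borel_lebesgue)
        (intro borel_measurable_scaleR borel_measurable_indicator Y_meas
            measurable_compose[OF Z_meas \<phi>_meas])
    show "integrable lebesgue (\<lambda>y. B * indicator (cball 0 R) y)"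
      by (intro integrable_mult_right integrable_real_indicator)
        (use emeasure_bounded_finite[OF bounded_cball] in auto)
    show "AE y in lebesgue. norm (indicator Y y *\<^sub>R \<phi> (d n) (Z (d n) y))
        \<le> B * indicator (cball 0 R) y" for n
    proof (rule AE_I2)
      fix y :: "real^'n"
      show "norm (indicator Y y *\<^sub>R \<phi> (d n) (Z (d n) y)) \<le> B * indicator (cball 0 R) y"
      proof (cases "y \<in> Y \<and> Z (d n) y \<in> K")
        case True
        then have "y \<in> cball 0 R" using R[OF _ _ d(1)] by auto
        then show ?thesis using \<phi>_bound[of "d n" "Z (d n) y"] True by simp
      next
        case False
        then have eq0: "indicator Y y *\<^sub>R \<phi> (d n) (Z (d n) y) = 0" by (auto simp: \<phi>_def)
        show ?thesis unfolding eq0 using \<open>0 \<le> B\<close> by simp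
      qed
    qed
    show "AE y in lebesgue. (\<lambda>n. indicator Y y *\<^sub>R \<phi> (d n) (Z (d n) y))
        \<longlonglongrightarrow> indicator (facet_prism K F) y *\<^sub>R h (foot K F y)"
    proof (rule AE_I')
      show "N \<in> null_sets lebesgue" using \<open>negligible N\<close> negligible_iff_null_sets by blast
      have "(\<lambda>n. indicator Y y *\<^sub>R \<phi> (d n) (Z (d n) y))
          \<longlonglongrightarrow> indicator (facet_prism K F) y *\<^sub>R h (foot K F y)" if y: "y
              \<notin> N" for y
      proof (cases "y \<in> Y")
        case False
        then have "y \<notin> facet_prism K F"
          using y by (auto simp: N_def Y_def mem_facet_prism[OF F])
        then show ?thesis using False by simp
      next
        case True
        have Zlim: "(\<lambda>n. Z (d n) y) \<longlonglongrightarrow> foot K F y"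
        proof -
          have "(\<lambda>n. Z (d n) y) \<longlonglongrightarrow> foot K F y
              - (0 * ramp_inv (- ?g y)) *\<^sub>R a"
            unfolding Z_def by (intro tendsto_intros d)
          then show ?thesis by simp
        qed
        show ?thesis
        \<comment> \<open>\<open>Z \<delta> y\<close> tends to the foot of \<open>y\<close>. A foot
          outside the closed set \<open>K\<close> gives 0 eventually; a foot inside lies on
          \<open>F\<close>, and off the ridges the other gaps stay positive, so their ramps tend to
          1.\<close>
        proof (cases "foot K F y \<in> K")
          case False
          have "\<forall>\<^sub>F n in sequentially. Z (d n) y \<in> - K"
            by (rule topological_tendstoD[OF Zlim]) (use False closed_K in auto)
          then have "\<forall>\<^sub>F n in sequentially. indicator Y y *\<^sub>R \<phi> (d n)
              (Z (d n) y) = 0"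
            by eventually_elim (simp add: \<phi>_def)
          moreover have "y \<notin> facet_prism K F"
            using False by (auto simp: mem_facet_prism[OF F] mem_facet_iff[OF F])
          ultimately show ?thesis by (simp add: tendsto_eventually)
        next
          case K: True
          then have footF: "foot K F y \<in> F" by (simp add: mem_facet_iff[OF F] gap_foot[OF F])
          have prism: "y \<in> facet_prism K F" using True footF by (auto simp: mem_facet_prism[OF F] Y_def)
          have pos: "0 < gap K F' (foot K F y)" if "F' \<in> ?I" for F'
            using that y footF facet_normal_level(2)[of F' "foot K F y"] K by (force simp: N_def less_le)
          have glim: "(\<lambda>n. gap K F' (Z (d n) y))
              \<longlonglongrightarrow> gap K F' (foot K F y)" for F'
            unfolding gap_def by (intro tendsto_intros Zlim)
          have "\<forall>\<^sub>F n in sequentially. \<forall>F'\<in>?I. 0 < gap K F' (Z (d n) y)"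
            using finite_other_facets
                by (intro eventually_ball_finite ballI order_tendstoD(1)[OF glim] pos) auto
          then have evK: "\<forall>\<^sub>F n in sequentially. Z (d n) y \<in> K"
          proof eventually_elim
            case (elim n)
            have "0 \<le> gap K F' (Z (d n) y)" if "F' facet_of K" for F'
            proof (cases "F' = F")
              case True
              then show ?thesis using ZS[OF \<open>y \<in> Y\<close> d(1), of n] by (simp add: S_def)
            next
              case False
              then show ?thesis using elim that by (auto intro: less_imp_le)
            qed
            then show ?case using K_eq_gaps by blast
          qed
          have "(\<lambda>n. (\<Prod>F'\<in>?I. ramp (gap K F' (Z (d n) y) / d n)) * h (Z (d n) y))
              \<longlonglongrightarrow> (\<Prod>F'\<in>?I. 1) * h (foot K F y)"
            by (intro tendsto_mult tendsto_prod tendsto_ramp_scaled[OF glim pos d]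
                continuous_on_tendsto_compose[OF h Zlim K evK])
          then have "(\<lambda>n. indicator Y y *\<^sub>R \<phi> (d n) (Z (d n) y))
              \<longlonglongrightarrow> (\<Prod>F'\<in>?I. 1) * h (foot K F y)"
            by (rule Lim_transform_eventually)
              (use evK True in \<open>auto elim!: eventually_mono simp: \<phi>_def\<close>)
          then show ?thesis using prism by simp
        qed
      qed
      then show "{y \<in> space lebesgue. \<not>
          (\<lambda>n. indicator Y y *\<^sub>R \<phi> (d n) (Z (d n) y))
        \<longlonglongrightarrow> indicator (facet_prism K F) y *\<^sub>R h (foot K F y)}
            \<subseteq> N" by blast
    qed
  qed
  then show ?thesis
    unfolding facet_integral_foot[OF F] cov[OF d(1)] by (simp add: set_lebesgue_integral_def)
qed

end

section \<open>The divergence theorem on curved elements\<close>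

lemma matrix_inv_mult:
  fixes A :: "real^'n::finite^'n"
  assumes "det A \<noteq> 0"
  shows "A ** matrix_inv A = mat 1" and "matrix_inv A ** A = mat 1"
proof -
  have "\<exists>A'. A ** A' = mat 1 \<and> A' ** A = mat 1"
    using assms invertible_det_nz unfolding invertible_def by blast
  from someI_ex[OF this] show "A ** matrix_inv A = mat 1" "matrix_inv A ** A = mat 1"
    unfolding matrix_inv_def by blast+
qed

lemma matrix_inv_vector_mult:
  fixes A :: "real^'n::finite^'n"
  assumes "det A \<noteq> 0"
  shows "A *v (matrix_inv A *v x) = x" and "matrix_inv A *v (A *v x) = x"
  using matrix_inv_mult[OF assms] by (simp_all add: matrix_vector_mul_assoc)

text \<open>This connects the conormal \<open>J^-T a\<close> of a face with the pulled-back
  direction \<open>J^-1 e\<close> of the divergence theorem.\<close>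

lemma inner_matrix_inv_transpose:
  fixes A :: "real^'n::finite^'n"
  assumes "det A \<noteq> 0"
  shows "(matrix_inv (transpose A) *v a) \<bullet> x = a \<bullet> (matrix_inv A *v x)"
proof -
  have "det (transpose A) \<noteq> 0" using assms by (simp add: det_transpose)
  note t = matrix_inv_vector_mult[OF this]
  have "(matrix_inv (transpose A) *v a) \<bullet> x
      = (matrix_inv (transpose A) *v a) \<bullet> (A *v (matrix_inv A *v x))"
    using matrix_inv_vector_mult[OF assms] by simp
  also have "\<dots> = (transpose A *v (matrix_inv (transpose A) *v a)) \<bullet> (matrix_inv A *v x)"
    by (metis dot_lmul_matrix vector_transpose_matrix transpose_transpose transpose_matrix_vector)
  finally show ?thesis unfolding t .
qed

lemma continuous_on_det [continuous_intros]:
  fixes A :: "'a::topological_space \<Rightarrow> real^'n::finite^'n"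
  assumes "continuous_on S A"
  shows "continuous_on S (\<lambda>x. det (A x))"
  unfolding det_def by (intro continuous_intros assms)

text \<open>By Cramer's rule the solution is a quotient of determinants, which are polynomials in
  the entries.\<close>

lemma continuous_on_matrix_inv_mult [continuous_intros]:
  fixes A :: "'a::topological_space \<Rightarrow> real^'n::finite^'n"
  assumes A: "continuous_on S A" and b: "continuous_on S b" and nz: "\<And>x. x \<in> S
      \<Longrightarrow> det (A x) \<noteq> 0"
  shows "continuous_on S (\<lambda>x. matrix_inv (A x) *v b x)"
proof -
  have "matrix_inv (A x) *v b x = (\<chi> k. det (\<chi> i j. if j
      = k then b x $ i else A x $ i $ j) / det (A x))"
    if "x \<in> S" for x
    using cramer[OF nz[OF that], of "matrix_inv (A x) *v b x" "b x"]
        matrix_inv_vector_mult(1)[OF nz[OF that]]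
    by simp
  moreover have "continuous_on S (\<lambda>x. \<chi> k. det (\<chi> i j. if j
      = k then b x $ i else A x $ i $ j) / det (A x))"
  proof (intro continuous_intros A)
    show "continuous_on S (\<lambda>x. if j = k then b x $ i else A x $ i $ j)" for i j k
      by (cases "j = k") (auto intro!: continuous_intros A b)
  qed (use nz in auto)
  ultimately show ?thesis by (subst continuous_on_cong[OF refl]) auto
qed

lemma continuous_on_transpose [continuous_intros]:
  fixes A :: "'a::topological_space \<Rightarrow> real^'n::finite^'m::finite"
  assumes "continuous_on S A"
  shows "continuous_on S (\<lambda>x. transpose (A x))"
  unfolding transpose_def by (intro continuous_intros assms)

section \<open>Integrals of derivatives over the whole space\<close>

lemma set_integrable_continuous_compact:
  fixes f :: "'a::euclidean_space \<Rightarrow> real"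
  assumes "compact S" "continuous_on S f"
  shows "set_integrable lebesgue S f"
  using borel_integrable_compact[OF assms] by (simp add: set_integrable_def integrable_completion)

lemma lborel_integral_translate:
  fixes f :: "'a::euclidean_space \<Rightarrow> real"
  assumes [measurable]: "f \<in> borel_measurable borel"
  shows "integral\<^sup>L lborel (\<lambda>x. f (x + c)) = integral\<^sup>L lborel f"
    and "integrable lborel (\<lambda>x. f (x + c)) = integrable lborel f"
proof -
  have "integral\<^sup>L (distr lborel borel ((+) c)) f = integral\<^sup>L lborel (\<lambda>x. f (c + x))"
    by (intro integral_distr) auto
  then show "integral\<^sup>L lborel (\<lambda>x. f (x + c)) = integral\<^sup>L lborel f"
    by (simp add: lborel_distr_plus add.commute)
  have "integrable (distr lborel borel ((+) c)) f = integrable lborel (\<lambda>x. f (c + x))"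
    by (intro integrable_distr_eq) auto
  then show "integrable lborel (\<lambda>x. f (x + c)) = integrable lborel f"
    by (simp add: lborel_distr_plus add.commute)
qed

text \<open>
  By translation invariance the difference quotients of \<open>f\<close> in the direction \<open>e\<close>
  integrate to 0.
\<close>

lemma integral_directional_derivative_eq_0:
  fixes f :: "'a::euclidean_space \<Rightarrow> real"
  assumes der: "\<And>x. (f has_derivative f' x) (at x)" and cont: "continuous_on UNIV (\<lambda>x. f' x e)"
    and C: "compact C" and f0: "\<And>x. x \<notin> C \<Longrightarrow> f x
        = 0" and f'0: "\<And>x. x \<notin> C \<Longrightarrow> f' x e = 0"
  shows "integral\<^sup>L lebesgue (\<lambda>x. f' x e) = 0"
proof -
  have contf: "continuous_on UNIV f"
    by (intro continuous_at_imp_continuous_on ballI has_derivative_continuous[OF der])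
  have [measurable]: "f \<in> borel_measurable borel" by (intro borel_measurable_continuous_onI contf)
  have [measurable]: "(\<lambda>x. f' x e) \<in> borel_measurable borel"
      by (intro borel_measurable_continuous_onI cont)
  have "integrable lborel (\<lambda>x. indicator C x *\<^sub>R f x)"
    by (intro borel_integrable_compact C continuous_on_subset[OF contf]) auto
  also have "(\<lambda>x. indicator C x *\<^sub>R f x) = f" using f0
      by (auto simp: fun_eq_iff indicator_def)
  finally have int: "integrable lborel f" .
  have "bounded ((\<lambda>x. f' x e) ` C)"
    using compact_continuous_image[OF continuous_on_subset[OF cont] C] compact_imp_bounded by auto
  then obtain B0 where B0: "\<And>x. x \<in> C \<Longrightarrow> \<bar>f' x e\<bar> \<le> B0"
      by (auto simp: bounded_iff)
  define B where "B = max B0 0"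
  have B: "\<bar>f' x e\<bar> \<le> B" "0 \<le> B" for x
    using B0[of x] f'0[of x] by (cases "x \<in> C"; force simp: B_def)+
  obtain M where M: "\<And>x. x \<in> C \<Longrightarrow> norm x \<le> M"
      using compact_imp_bounded[OF C] by (auto simp: bounded_iff)
  have line: "((\<lambda>t. f (x + t *\<^sub>R e)) has_real_derivative f' (x + t *\<^sub>R e) e)
      (at t)" for x t
  proof -
    have "((\<lambda>t. x + t *\<^sub>R e) has_derivative (\<lambda>s. s *\<^sub>R e)) (at t)"
      by (auto intro!: derivative_eq_intros)
    from diff_chain_at[OF this der]
    have "((\<lambda>t. f (x + t *\<^sub>R e)) has_derivative
        (\<lambda>s. f' (x + t *\<^sub>R e) (s *\<^sub>R e))) (at t)"
      by (simp add: o_def)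
    moreover have "f' (x + t *\<^sub>R e) (s *\<^sub>R e) = f' (x + t *\<^sub>R e) e * s" for s
      using linear_scale[OF has_derivative_linear[OF der[of "x + t *\<^sub>R e"]], of s e]
      by (simp add: mult.commute)
    ultimately show ?thesis by (simp add: has_field_derivative_def)
  qed
  define h where "h n = inverse (real (Suc n))" for n
  have h: "0 < h n" "h n \<le> 1" for n by (auto simp: h_def inverse_le_1_iff)
  \<comment> \<open>The mean value theorem bounds these quotients by \<open>B\<close>; with steps of
    length at most 1 they vanish outside a fixed ball. This is what dominated convergence
    needs.\<close>
  define q where "q n x = (f (x + h n *\<^sub>R e) - f x) / h n" for n x
  have q_le: "\<bar>q n x\<bar> \<le> B" for n x
  proof -
    obtain t where "0 < t" "t < h n" "f (x + h n *\<^sub>R e) - f (x + 0 *\<^sub>R e)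
        = (h n - 0) * f' (x + t *\<^sub>R e) e"
      using MVT2[OF h(1)[of n], where f = "\<lambda>t. f (x + t *\<^sub>R e)" and f'
          = "\<lambda>t. f' (x + t *\<^sub>R e) e"] line by blast
    then have "q n x = f' (x + t *\<^sub>R e) e" using h(1)[of n] by (simp add: q_def field_simps)
    then show ?thesis using B by simp
  qed
  have q0: "q n x = 0" if "norm x > M + norm e" for n x
  proof -
    have "x \<notin> C" using M[of x] that norm_ge_zero[of e] by linarith
    moreover have "x + h n *\<^sub>R e \<notin> C"
    proof
      assume "x + h n *\<^sub>R e \<in> C"
      then have "norm (x + h n *\<^sub>R e) \<le> M" by (rule M)
      moreover have "norm x \<le> norm (x + h n *\<^sub>R e) + norm (h n *\<^sub>R e)"
        by (metis add_diff_cancel norm_triangle_ineq4)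
      moreover have "norm (h n *\<^sub>R e) \<le> 1 * norm e"
        using mult_right_mono[OF h(2)[of n], of "norm e"] h(1)[of n] by simp
      ultimately show False using that by simp
    qed
    ultimately show ?thesis by (simp add: q_def f0)
  qed
  have "(\<lambda>n. integral\<^sup>L lborel (q n))
      \<longlonglongrightarrow> integral\<^sup>L lborel (\<lambda>x. f' x e)"
  proof (rule integral_dominated_convergence[where w
      = "\<lambda>x. B * indicator (cball 0 (M + norm e)) x"])
    show "(\<lambda>x. f' x e) \<in> borel_measurable lborel" by simp
    show "q n \<in> borel_measurable lborel" for n unfolding q_def by measurable
    show "integrable lborel (\<lambda>x. B * indicator (cball 0 (M + norm e)) x)"
      by (intro integrable_mult_right integrable_real_indicator)
          (use emeasure_bounded_finite[OF bounded_cball] in auto)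
    show "AE x in lborel. norm (q n x) \<le> B * indicator (cball 0 (M + norm e)) x" for n
      using q_le q0 B(2) by (intro AE_I2) (auto simp: indicator_def not_le)
    show "AE x in lborel. (\<lambda>n. q n x) \<longlonglongrightarrow> f' x e"
    proof (rule AE_I2)
      fix x
      have "((\<lambda>t. (f (x + t *\<^sub>R e) - f x) / t) \<longlongrightarrow> f' x e) (at 0)"
        using line[of x 0] by (simp add: DERIV_def)
      moreover have "filterlim h (at 0) sequentially"
        unfolding filterlim_at using h(1) LIMSEQ_inverse_real_of_nat less_imp_neq[OF h(1), THEN not_sym]
        by (auto simp: h_def[abs_def])
      ultimately show "(\<lambda>n. q n x) \<longlonglongrightarrow> f' x e"
        unfolding q_def by (rule filterlim_compose)
    qed
  qed
  moreover have "integral\<^sup>L lborel (q n) = 0" for n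
  proof -
    have "integral\<^sup>L lborel (q n) = (integral\<^sup>L lborel
        (\<lambda>x. f (x + h n *\<^sub>R e)) - integral\<^sup>L lborel f) / h n"
      unfolding q_def using int lborel_integral_translate(2)[of f "h n *\<^sub>R e"]
      by (simp add: Bochner_Integration.integral_diff)
    then show ?thesis by (simp add: lborel_integral_translate(1))
  qed
  ultimately have "integral\<^sup>L lborel (\<lambda>x. f' x e) = 0" by (simp add: LIMSEQ_const_iff)
  then show ?thesis by (simp add: integral_completion)
qed

section \<open>Charts of curved elements\<close>

locale chart = solid_polytope K for K :: "(real^'n::finite) set" +
  fixes U :: "(real^'n) set" and \<Phi> :: "real^'n \<Rightarrow> real^'n"
  assumes K_subset_U: "K \<subseteq> U" and diffeo: "C2_diffeo_on U \<Phi>"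
begin

abbreviation J :: "real^'n \<Rightarrow> real^'n^'n" where
  "J z \<equiv> jacobian \<Phi> (at z)"

definition \<Psi> :: "real^'n \<Rightarrow> real^'n" where
  "\<Psi> = inv_into U \<Phi>"

lemma open_U: "open U" and inj_\<Phi>: "inj_on \<Phi> U" and det_J: "z \<in> U \<Longrightarrow> det
    (J z) \<noteq> 0"
  using diffeo by (auto simp: C2_diffeo_on_def)

lemma \<Phi>_has_derivative: "z \<in> U \<Longrightarrow>
    (\<Phi> has_derivative (\<lambda>v. J z *v v)) (at z)"
  and continuous_on_J: "continuous_on U J"
proof -
  obtain f' :: "real^'n \<Rightarrow> (real^'n) \<Rightarrow>\<^sub>L (real^'n)" and f''
    where f: "\<And>z. z \<in> U \<Longrightarrow> (\<Phi> has_derivative blinfun_apply (f' z)) (at z)"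
      "\<And>z. z \<in> U \<Longrightarrow> (f' has_derivative blinfun_apply (f'' z)) (at z)"
    using diffeo unfolding C2_diffeo_on_def by blast
  have J: "J z = matrix (blinfun_apply (f' z))" if "z \<in> U" for z
    using frechet_derivative_at[OF f(1)[OF that]] by (simp add: jacobian_def)
  show "(\<Phi> has_derivative (\<lambda>v. J z *v v)) (at z)" if "z \<in> U"
    using f(1)[OF that] jacobian_works differentiable_def by blast
  have "continuous_on U f'"
    by (intro continuous_at_imp_continuous_on ballI has_derivative_continuous[OF f(2)])
  then have "continuous_on U (\<lambda>z. matrix (blinfun_apply (f' z)))"
    unfolding matrix_def by (intro continuous_intros)
  then show "continuous_on U J" by (subst continuous_on_cong[OF refl J]) auto
qed

lemma continuous_on_\<Phi>: "continuous_on U \<Phi>"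
  by (intro continuous_at_imp_continuous_on ballI has_derivative_continuous[OF \<Phi>_has_derivative])

lemma \<Psi>_\<Phi>: "z \<in> U \<Longrightarrow> \<Psi> (\<Phi> z) = z"
  by (simp add: \<Psi>_def inj_\<Phi>)

lemma \<Phi>_\<Psi>: "x \<in> \<Phi> ` U \<Longrightarrow> \<Phi> (\<Psi> x)
    = x" "x \<in> \<Phi> ` U \<Longrightarrow> \<Psi> x \<in> U"
  by (auto simp: \<Psi>_\<Phi>)

lemma open_\<Phi>_image: "open S \<Longrightarrow> S \<subseteq> U \<Longrightarrow> open (\<Phi> ` S)"
  using invariance_of_domain continuous_on_subset[OF continuous_on_\<Phi>]
      inj_on_subset[OF inj_\<Phi>] by blast

lemma compact_\<Phi>_K: "compact (\<Phi> ` K)"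
  using compact_continuous_image continuous_on_subset[OF continuous_on_\<Phi> K_subset_U] compact_K by blast

lemma \<Psi>_has_derivative:
  assumes x: "x \<in> \<Phi> ` U"
  shows "(\<Psi> has_derivative (\<lambda>v. matrix_inv (J (\<Psi> x)) *v v)) (at x)"
proof -
  obtain z where z: "z \<in> U" "x = \<Phi> z" using x by blast
  have "(\<Psi> has_derivative (\<lambda>v. matrix_inv (J z) *v v)) (at (\<Phi> z))"
    by (rule has_derivative_inverse_strong[OF open_U z(1) continuous_on_\<Phi> \<Psi>_\<Phi>
        \<Phi>_has_derivative[OF z(1)]])
      (use matrix_inv_vector_mult[OF det_J[OF z(1)]] in auto)
  then show ?thesis using z \<Psi>_\<Phi> by simp
qed

lemma continuous_on_\<Psi>: "continuous_on (\<Phi> ` U) \<Psi>"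
  by (intro continuous_at_imp_continuous_on ballI has_derivative_continuous[OF \<Psi>_has_derivative])

lemma mem_\<Phi>_K:
  assumes "x \<in> \<Phi> ` U"
  shows "x \<in> \<Phi> ` K \<longleftrightarrow> \<Psi> x \<in> K"
proof -
  obtain z where z: "z \<in> U" "x = \<Phi> z" using assms by blast
  then show ?thesis
    using inj_on_image_mem_iff[OF inj_\<Phi> z(1) K_subset_U] by (simp add: \<Psi>_\<Phi>)
qed

lemma chart_change_of_variables:
  fixes f :: "real^'n \<Rightarrow> real"
  shows "set_integrable lebesgue (\<Phi> ` K) f \<longleftrightarrow>
      set_integrable lebesgue K (\<lambda>z. \<bar>det (J z)\<bar> * f (\<Phi> z))"
    and "(LINT x:\<Phi> ` K|lebesgue. f x) = (LINT z:K|lebesgue. \<bar>det (J z)\<bar> * f (\<Phi> z))"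
proof -
  have K: "K \<in> sets lebesgue" using compact_K by (simp add: borel_compact)
  have d: "(\<Phi> has_derivative (\<lambda>v. J z *v v)) (at z within K)" if "z \<in> K" for z
    using \<Phi>_has_derivative has_derivative_at_withinI that K_subset_U by blast
  have inj: "inj_on \<Phi> K" using inj_on_subset[OF inj_\<Phi> K_subset_U] .
  have m: "matrix (\<lambda>v. J z *v v) = J z" for z by (rule matrix_of_matrix_vector_mul)
  have "set_integrable lebesgue (\<Phi> ` K) f \<longleftrightarrow>
      set_integrable lebesgue K (\<lambda>z. \<bar>det (matrix (\<lambda>v. J z *v v))\<bar>
          * f (\<Phi> z))"
    by (rule change_of_variables(1)[OF K _ inj]) (rule d)
  then show "set_integrable lebesgue (\<Phi> ` K) f \<longleftrightarrow>
      set_integrable lebesgue K (\<lambda>z. \<bar>det (J z)\<bar> * f (\<Phi> z))" unfolding m .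
  have "(LINT x:\<Phi> ` K|lebesgue. f x) =
      (LINT z:K|lebesgue. \<bar>det (matrix (\<lambda>v. J z *v v))\<bar> * f (\<Phi> z))"
    by (rule change_of_variables(2)[OF K _ inj]) (rule d)
  then show "(LINT x:\<Phi> ` K|lebesgue. f x) = (LINT z:K|lebesgue. \<bar>det (J z)\<bar> * f (\<Phi> z))"
    unfolding m .
qed

text \<open>The Piola transform of the constant field \<open>e\<close>, with the absolute value of
  the determinant. Paired with the reference gradient of a function it gives the derivative along
  \<open>e\<close> on the element, times the volume factor.\<close>

definition pullback :: "real^'n \<Rightarrow> real^'n \<Rightarrow> real^'n" where
  "pullback e z = \<bar>det (J z)\<bar> *\<^sub>R (matrix_inv (J z) *v e)"

lemma continuous_on_pullback: "continuous_on U (pullback e)"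
  unfolding pullback_def by (intro continuous_intros continuous_on_J det_J)

text \<open>Carried over to the element, \<open>g\<close> becomes a function with compact support,
  whose derivative along \<open>e\<close> integrates to 0; the change of variables then pulls this
  identity back to \<open>K\<close>.\<close>

lemma integral_compact_support_eq_0:
  assumes der: "\<And>z. (g has_derivative (\<lambda>v. \<gamma> z \<bullet> v)) (at z)" and cont:
      "continuous_on UNIV \<gamma>"
    and g0: "\<And>z. z \<notin> K \<Longrightarrow> g z
        = 0" and \<gamma>0: "\<And>z. z \<notin> K \<Longrightarrow> \<gamma> z = 0"
  shows "(LINT z:K|lebesgue. \<gamma> z \<bullet> pullback e z) = 0"
proof -
  let ?V = "\<Phi> ` U"
  \<comment> \<open>Differentiability and continuity are checked on two open sets that cover the
    space: \<open>?V\<close> and the complement of the compact element.\<close>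
  define f where "f x = (if x \<in> ?V then g (\<Psi> x) else 0)" for x
  define f' where "f' x v = (if x \<in> ?V then \<gamma> (\<Psi> x) \<bullet>
      (matrix_inv (J (\<Psi> x)) *v v) else 0)" for x v
  have openV: "open ?V" using open_\<Phi>_image[OF open_U] by simp
  have openC: "open (- \<Phi> ` K)" using compact_imp_closed[OF compact_\<Phi>_K] by blast
  have zero: "f x = 0" "f' x v = 0" if "x \<notin> \<Phi> ` K" for x v
    using that g0 \<gamma>0 mem_\<Phi>_K by (auto simp: f_def f'_def)
  have f_der: "(f has_derivative f' x) (at x)" for x
  proof (cases "x \<in> ?V")
    case True
    have "((\<lambda>x. g (\<Psi> x)) has_derivative
        (\<lambda>v. \<gamma> (\<Psi> x) \<bullet> (matrix_inv (J (\<Psi> x)) *v v))) (at x)"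
      using diff_chain_at[OF \<Psi>_has_derivative[OF True] der] by (simp add: o_def)
    then have "(f has_derivative (\<lambda>v. \<gamma> (\<Psi> x) \<bullet>
        (matrix_inv (J (\<Psi> x)) *v v))) (at x)"
      by (rule has_derivative_transform_within_open[OF _ openV True]) (simp add: f_def)
    then show ?thesis using True by (simp add: f'_def[abs_def])
  next
    case False
    then have x: "x \<in> - \<Phi> ` K" using K_subset_U by auto
    have "((\<lambda>x. 0) has_derivative (\<lambda>v. 0)) (at x)" by simp
    then have "(f has_derivative (\<lambda>v. 0)) (at x)"
      by (rule has_derivative_transform_within_open[OF _ openC x]) (simp add: zero)
    then show ?thesis using False by (simp add: f'_def[abs_def])
  qed
  have cont_f': "continuous_on UNIV (\<lambda>x. f' x e)"
  proof -
    have "continuous_on ?V (\<lambda>x. \<gamma> (\<Psi> x) \<bullet> (matrix_inv (J (\<Psi> x)) *v e))"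
    proof (rule continuous_on_inner)
      show "continuous_on ?V (\<lambda>x. \<gamma> (\<Psi> x))"
        by (rule continuous_on_compose2[OF cont continuous_on_\<Psi>]) auto
      have "continuous_on ?V (\<lambda>x. J (\<Psi> x))"
        by (rule continuous_on_compose2[OF continuous_on_J continuous_on_\<Psi>])
            (use \<Phi>_\<Psi> in auto)
      then show "continuous_on ?V (\<lambda>x. matrix_inv (J (\<Psi> x)) *v e)"
        by (intro continuous_on_matrix_inv_mult continuous_on_const det_J) (use \<Phi>_\<Psi> in auto)
    qed
    then have "continuous_on ?V (\<lambda>x. f' x e)"
      by (subst continuous_on_cong[OF refl]) (auto simp: f'_def)
    moreover have "continuous_on (- \<Phi> ` K) (\<lambda>x. f' x e)"
      by (subst continuous_on_cong[OF refl, where g = "\<lambda>x. 0"]) (auto simp: zero)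
    ultimately have "continuous_on (?V \<union> - \<Phi> ` K) (\<lambda>x. f' x e)"
      by (rule continuous_on_open_Un[OF openV openC])
    also have "?V \<union> - \<Phi> ` K = UNIV" using K_subset_U by auto
    finally show ?thesis .
  qed
  have "integral\<^sup>L lebesgue (\<lambda>x. f' x e) = 0"
    by (rule integral_directional_derivative_eq_0[OF f_der cont_f' compact_\<Phi>_K zero])
  also have "integral\<^sup>L lebesgue (\<lambda>x. f' x e) = (LINT x:\<Phi> ` K|lebesgue. f' x e)"
    unfolding set_lebesgue_integral_def
    by (rule Bochner_Integration.integral_cong) (auto simp: indicator_def zero)
  also have "\<dots> = (LINT z:K|lebesgue. \<bar>det (J z)\<bar> * f' (\<Phi> z) e)"
    by (rule chart_change_of_variables)
  also have "\<dots> = (LINT z:K|lebesgue. \<gamma> z \<bullet> pullback e z)"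
    unfolding set_lebesgue_integral_def
  proof (rule Bochner_Integration.integral_cong[OF refl])
    fix z
    show "indicator K z *\<^sub>R (\<bar>det (J z)\<bar> * f' (\<Phi> z) e)
        = indicator K z *\<^sub>R (\<gamma> z \<bullet> pullback e z)"
    proof (cases "z \<in> K")
      case True
      then have "z \<in> U" using K_subset_U by auto
      then show ?thesis by (simp add: f'_def pullback_def \<Psi>_\<Phi>)
    qed simp
  qed
  finally show ?thesis by simp
qed

theorem divergence:
  assumes der: "\<And>z. (w has_derivative (\<lambda>v. \<omega> z \<bullet> v)) (at z)" and cont:
      "continuous_on UNIV \<omega>"
  shows "(LINT z:K|lebesgue. \<omega> z \<bullet> pullback e z) =
    (\<Sum>F | F facet_of K. facet_integral K F (\<lambda>z. w z
        * (facet_normal K F \<bullet> pullback e z)))"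
proof -
  let ?I = "{F. F facet_of K}"
  have contw: "continuous_on UNIV w"
    by (intro continuous_at_imp_continuous_on ballI has_derivative_continuous[OF der])
  have contp: "continuous_on K (pullback e)"
    by (rule continuous_on_subset[OF continuous_on_pullback K_subset_U])
  define d where "d n = inverse (real (Suc n))" for n
  have d: "0 < d n" "d \<longlonglongrightarrow> 0" for n
    using LIMSEQ_inverse_real_of_nat by (auto simp: d_def[abs_def])
  define \<psi> where "\<psi> n z = (\<Prod>F\<in>?I. ramp (gap K F z / d n))" for n z
  \<comment> \<open>The gradient of the cutoff is the sum of the vectors
    \<open>- \<rho> n F z\<close> times the normal of \<open>F\<close>; each coefficient is the
    layer weight of one facet.\<close>
  define \<rho> where "\<rho> n F z = ramp' (gap K F z / d n) / d n
      * (\<Prod>F'\<in>?I - {F}. ramp (gap K F' z / d n))" for n F z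
  define \<gamma> where "\<gamma> n z = \<psi> n z *\<^sub>R \<omega> z
      - w z *\<^sub>R (\<Sum>F\<in>?I. \<rho> n F z *\<^sub>R facet_normal K F)" for n z
  have \<psi>_der: "(\<psi> n has_derivative (\<lambda>v.
      - (\<Sum>F\<in>?I. \<rho> n F z *\<^sub>R facet_normal K F) \<bullet> v)) (at z)" for n z
  proof -
    have "((\<lambda>z. ramp (gap K F z / d n)) has_derivative
        (\<lambda>v. - (facet_normal K F \<bullet> v) / d n * ramp' (gap K F z / d n))) (at z)" for F
    proof -
      have "(gap K F has_derivative (\<lambda>v. - (facet_normal K F \<bullet> v))) (at z)"
        unfolding gap_def by (auto intro!: derivative_eq_intros)
      from bounded_linear.has_derivative[OF bounded_linear_divide this]
      show ?thesis by (rule DERIV_compose_FDERIV[OF DERIV_ramp])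
    qed
    then have "((\<lambda>z. \<Prod>F\<in>?I. ramp (gap K F z / d n)) has_derivative
        (\<lambda>v. \<Sum>F\<in>?I. (- (facet_normal K F \<bullet> v) / d n * ramp' (gap K F z / d n)) *
            (\<Prod>F'\<in>?I - {F}. ramp (gap K F' z / d n)))) (at z)"
      by (rule has_derivative_prod)
    then show ?thesis
      unfolding \<psi>_def
      by (rule has_derivative_eq_rhs)
        (auto simp: fun_eq_iff \<rho>_def inner_sum_left sum_negf[symmetric] algebra_simps intro!: sum.cong)
  qed
  have \<gamma>_der: "((\<lambda>z. \<psi> n z
      * w z) has_derivative (\<lambda>v. \<gamma> n z \<bullet> v)) (at z)" for n z
    by (rule has_derivative_eq_rhs[OF has_derivative_mult[OF \<psi>_der der]])
      (simp add: \<gamma>_def fun_eq_iff inner_diff_left)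
  have cont\<psi>: "continuous_on S (\<psi> n)" for S n
    unfolding \<psi>_def divide_inverse by (intro continuous_intros)
  have cont\<rho>: "continuous_on S (\<rho> n F)" for S n F
    unfolding \<rho>_def divide_inverse by (intro continuous_intros)
  have cont\<gamma>: "continuous_on UNIV (\<gamma> n)" for n
    unfolding \<gamma>_def by (intro continuous_intros cont\<psi> cont\<rho> cont contw)
  \<comment> \<open>Outside \<open>K\<close> some gap is negative, and each of the products contains
    a factor \<open>ramp\<close> or \<open>ramp'\<close> of this gap.\<close>
  have \<psi>0: "\<psi> n z = 0" "F \<in> ?I \<Longrightarrow> \<rho> n F z = 0" if "z \<notin> K" for n z F
  proof -
    have "\<not> (\<forall>F. F facet_of K \<longrightarrow> 0 \<le> gap K F z)"
      using \<open>z \<notin> K\<close> K_eq_gaps by blast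
    then obtain F0 where F0: "F0 facet_of K" "gap K F0 z < 0" by (auto simp: not_le)
    have neg: "gap K F0 z / d n \<le> 0" using F0(2) d(1)[of n] by (simp add: divide_nonpos_pos)
    show "\<psi> n z = 0"
      unfolding \<psi>_def by (rule prod_zero) (use finite_facets F0 neg in auto)
    show "\<rho> n F z = 0" if "F \<in> ?I"
    proof (cases "F = F0")
      case True then show ?thesis using neg by (simp add: \<rho>_def)
    next
      case False
      have "(\<Prod>F'\<in>?I - {F}. ramp (gap K F' z / d n)) = 0"
        by (rule prod_zero[OF finite_other_facets], rule bexI[of _ F0]) (use F0 neg False in auto)
      then show ?thesis by (simp add: \<rho>_def)
    qed
  qed
  have zero: "(LINT z:K|lebesgue. \<gamma> n z \<bullet> pullback e z) = 0" for n
    by (rule integral_compact_support_eq_0[OF \<gamma>_der cont\<gamma>]) (auto simp: \<psi>0 \<gamma>_def)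
  define h where "h F z = w z * (facet_normal K F \<bullet> pullback e z)" for F z
  have conth: "continuous_on K (h F)" for F
    unfolding h_def by (intro continuous_intros contp continuous_on_subset[OF contw]) auto
  have split: "(LINT z:K|lebesgue. \<psi> n z * (\<omega> z \<bullet> pullback e z))
      = (\<Sum>F\<in>?I. LINT z:K|lebesgue. \<rho> n F z * h F z)" for n
  proof -
    have i1: "set_integrable lebesgue K (\<lambda>z. \<psi> n z * (\<omega> z \<bullet> pullback e z))"
      by (intro set_integrable_continuous_compact compact_K continuous_intros cont\<psi> contp
          continuous_on_subset[OF cont]) auto
    have i2: "set_integrable lebesgue K (\<lambda>z. \<rho> n F z * h F z)" for F
      by (intro set_integrable_continuous_compact compact_K continuous_intros cont\<rho> conth)
    have "0 = (LINT z:K|lebesgue. \<psi> n z * (\<omega> z \<bullet> pullback e z)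
        - (\<Sum>F\<in>?I. \<rho> n F z * h F z))"
      unfolding zero[of n, symmetric]
      by (intro arg_cong[where f = "set_lebesgue_integral lebesgue K"])
        (auto simp: \<gamma>_def h_def fun_eq_iff inner_diff_left inner_sum_left sum_distrib_left mult_ac)
    also have "\<dots> = (LINT z:K|lebesgue. \<psi> n z * (\<omega> z \<bullet> pullback e z))
        - (\<Sum>F\<in>?I. LINT z:K|lebesgue. \<rho> n F z * h F z)"
    proof (subst set_integral_diff(2)[OF i1])
      show "set_integrable lebesgue K (\<lambda>z. \<Sum>F\<in>?I. \<rho> n F z * h F z)"
        by (intro set_integrable_continuous_compact compact_K continuous_intros cont\<rho> conth)
      have "(LINT z:K|lebesgue. \<Sum>F\<in>?I. \<rho> n F z * h F z)
          = (\<Sum>F\<in>?I. LINT z:K|lebesgue. \<rho> n F z * h F z)"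
        unfolding set_lebesgue_integral_def scaleR_sum_right
        by (rule Bochner_Integration.integral_sum) (use i2 in \<open>simp add: set_integrable_def\<close>)
      then show "(LINT z:K|lebesgue. \<psi> n z * (\<omega> z \<bullet> pullback e z))
          - (LINT z:K|lebesgue. \<Sum>F\<in>?I. \<rho> n F z * h F z) =
          (LINT z:K|lebesgue. \<psi> n z * (\<omega> z \<bullet> pullback e z))
              - (\<Sum>F\<in>?I. LINT z:K|lebesgue. \<rho> n F z * h F z)"
        by simp
    qed
    finally show ?thesis by simp
  qed
  have rhs: "(\<lambda>n. \<Sum>F\<in>?I. LINT z:K|lebesgue. \<rho> n F z * h F z)
      \<longlonglongrightarrow> (\<Sum>F\<in>?I. facet_integral K F (h F))"
    unfolding \<rho>_def mult.assoc by (intro tendsto_sum layer_limit conth d) auto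
  \<comment> \<open>The cutoff tends to 1 on the interior of \<open>K\<close>, and the frontier of a
    convex set is a null set.\<close>
  have lhs: "(\<lambda>n. LINT z:K|lebesgue. \<psi> n z * (\<omega> z \<bullet> pullback e z))
      \<longlonglongrightarrow> (LINT z:K|lebesgue. \<omega> z \<bullet> pullback e z)"
    unfolding set_lebesgue_integral_def
  proof (rule integral_dominated_convergence[where w
      = "\<lambda>z. norm (indicator K z *\<^sub>R (\<omega> z \<bullet> pullback e z))"])
    have i: "set_integrable lebesgue K (\<lambda>z. \<omega> z \<bullet> pullback e z)"
      by (intro set_integrable_continuous_compact compact_K continuous_intros contp
          continuous_on_subset[OF cont]) auto
    then show "(\<lambda>z. indicator K z *\<^sub>R (\<omega> z \<bullet> pullback e z)) \<in>
        borel_measurable lebesgue"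
      "integrable lebesgue (\<lambda>z. norm (indicator K z *\<^sub>R (\<omega> z \<bullet> pullback e z)))"
      by (auto simp: set_integrable_def intro: borel_measurable_integrable integrable_norm)
    have "set_integrable lebesgue K (\<lambda>z. \<psi> n z * (\<omega> z \<bullet> pullback e z))" for n
      by (intro set_integrable_continuous_compact compact_K continuous_intros cont\<psi> contp
          continuous_on_subset[OF cont]) auto
    then show "(\<lambda>z. indicator K z *\<^sub>R (\<psi> n z
        * (\<omega> z \<bullet> pullback e z))) \<in> borel_measurable lebesgue" for n
      by (auto simp: set_integrable_def intro: borel_measurable_integrable)
    have "\<bar>\<psi> n z\<bar> \<le> 1" for n z
      unfolding \<psi>_def abs_prod by (rule prod_le_1) (auto simp: abs_ramp_le)
    then have "\<bar>\<psi> n z\<bar> * \<bar>\<omega> z \<bullet> pullback e z\<bar>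
        \<le> 1 * \<bar>\<omega> z \<bullet> pullback e z\<bar>" for n z
      by (intro mult_right_mono) auto
    then show "AE z in lebesgue. norm (indicator K z *\<^sub>R (\<psi> n z
        * (\<omega> z \<bullet> pullback e z)))
        \<le> norm (indicator K z *\<^sub>R (\<omega> z \<bullet> pullback e z))" for n
      by (intro AE_I2) (auto simp: abs_mult indicator_def)
    show "AE z in lebesgue. (\<lambda>n. indicator K z *\<^sub>R (\<psi> n z
        * (\<omega> z \<bullet> pullback e z)))
        \<longlonglongrightarrow> indicator K z *\<^sub>R (\<omega> z \<bullet> pullback e z)"
    proof (rule AE_I')
      show "frontier K \<in> null_sets lebesgue"
        using negligible_convex_frontier[OF convex_K] negligible_iff_null_sets by blast
      have "(\<lambda>n. indicator K z *\<^sub>R (\<psi> n z * (\<omega> z \<bullet> pullback e z)))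
        \<longlonglongrightarrow> indicator K z *\<^sub>R (\<omega> z \<bullet> pullback e z)"
            if "z \<notin> frontier K" for z
      proof (cases "z \<in> interior K")
        case True
        then have "(\<lambda>n. \<psi> n z) \<longlonglongrightarrow> (\<Prod>F\<in>?I. 1)"
          unfolding \<psi>_def
          by (intro tendsto_prod tendsto_ramp_scaled tendsto_const d) (auto simp: interior_eq_gaps)
        then have "(\<lambda>n. indicator K z *\<^sub>R (\<psi> n z
            * (\<omega> z \<bullet> pullback e z))) \<longlonglongrightarrow>
            indicator K z *\<^sub>R ((\<Prod>F\<in>?I. 1) * (\<omega> z \<bullet> pullback e z))"
          by (intro tendsto_intros)
        then show ?thesis by simp
      next
        case False
        then have "z \<notin> K" using that closed_K by (auto simp: frontier_def)
        then show ?thesis by simp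
      qed
      then show "{z \<in> space lebesgue. \<not>
          (\<lambda>n. indicator K z *\<^sub>R (\<psi> n z * (\<omega> z \<bullet> pullback e z)))
        \<longlonglongrightarrow> indicator K z *\<^sub>R (\<omega> z \<bullet> pullback e z)}
            \<subseteq> frontier K" by blast
    qed
  qed
  show ?thesis
    using LIMSEQ_unique[OF lhs[unfolded split] rhs] by (simp add: h_def[abs_def])
qed

end

section \<open>Fluxes through a common face\<close>

lemma continuous_on_matrix_vector_mult [continuous_intros]:
  fixes A :: "'a::topological_space \<Rightarrow> real^'n::finite^'m::finite"
  assumes "continuous_on S A" "continuous_on S b"
  shows "continuous_on S (\<lambda>x. A x *v b x)"
  unfolding matrix_vector_mult_def by (intro continuous_intros assms)

section \<open>Entering a polytope from a boundary point\<close>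

context solid_polytope
begin

lemma facet_subset_imp_eq:
  assumes "F facet_of K" "F' facet_of K" "F \<subseteq> F'"
  shows "F = F'"
proof (rule ccontr)
  assume ne: "F \<noteq> F'"
  have "F face_of F'"
    using face_of_subset[OF facet_of_imp_face_of[OF assms(1)] assms(3) facet_of_imp_subset[OF assms(2)]] .
  then have "aff_dim F < aff_dim F'"
    using ne by (intro face_of_aff_dim_lt convex_facet[OF assms(2)])
  then show False using assms by (simp add: facet_of_def)
qed

text \<open>A relative interior point of \<open>F\<close> lies on no other facet, since a face that
  contains it contains all of \<open>F\<close>.\<close>

lemma facet_generic_point:
  assumes F: "F facet_of K"
  obtains z where "z \<in> F" "\<And>F'. F' facet_of K \<Longrightarrow> F' \<noteq> F
      \<Longrightarrow> 0 < gap K F' z"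
proof -
  have "rel_interior F \<noteq> {}"
    using F convex_facet[OF F] rel_interior_eq_empty by (auto simp: facet_of_def)
  then obtain z where z: "z \<in> rel_interior F" by blast
  then have zF: "z \<in> F" using rel_interior_subset by blast
  have "0 < gap K F' z" if F': "F' facet_of K" and ne: "F' \<noteq> F" for F'
  proof (rule ccontr)
    assume "\<not> 0 < gap K F' z"
    moreover have zK: "z \<in> K" using zF facet_subset[OF F] by blast
    ultimately have "z \<in> F'"
      using facet_normal_level(2)[OF F' zK] mem_facet_iff[OF F'] by auto
    then have "F \<subseteq> F'"
      using subset_of_face_of[OF facet_of_imp_face_of[OF F'] facet_subset[OF F]] z by blast
    then show False using facet_subset_imp_eq[OF F F'] ne by blast
  qed
  then show ?thesis using that zF by blast
qed

text \<open>The gaps that vanish at \<open>z\<close> grow to first order along the curve, the other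
  ones stay positive by continuity, and there are finitely many.\<close>

lemma eventually_in_interior:
  assumes z: "z \<in> K" and \<gamma>0: "\<gamma> 0
      = z" and der: "(\<gamma> has_derivative (\<lambda>t. t *\<^sub>R u)) (at (0::real))"
    and inward: "\<And>F. F facet_of K \<Longrightarrow> gap K F z
        = 0 \<Longrightarrow> facet_normal K F \<bullet> u < 0"
  shows "\<forall>\<^sub>F t in at_right 0. \<gamma> t \<in> interior K"
proof -
  have "\<forall>\<^sub>F t in at_right 0. 0 < gap K F (\<gamma> t)" if F: "F facet_of K" for F
  proof -
    let ?a = "facet_normal K F"
    have d: "((\<lambda>t. gap K F (\<gamma> t)) has_real_derivative - (?a \<bullet> u)) (at 0)"
      unfolding gap_def has_field_derivative_def
      by (rule has_derivative_eq_rhs, (rule derivative_intros der)+) (auto simp: fun_eq_iff)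
    show ?thesis
    proof (cases "gap K F z = 0")
      case True
      then have "0 < - (?a \<bullet> u)" using inward[OF F] by simp
      from DERIV_pos_inc_right[OF d this] obtain s where "0 < s" "\<And>t. 0 < t \<Longrightarrow> t
          < s \<Longrightarrow> 0 < gap K F (\<gamma> t)"
        using True \<gamma>0 by auto
      then show ?thesis by (auto simp: eventually_at_right_field)
    next
      case False
      then have pos: "0 < gap K F z" using facet_normal_level(2)[OF F z] by simp
      have "((\<lambda>t. gap K F (\<gamma> t)) \<longlongrightarrow> gap K F (\<gamma> 0)) (at 0)"
        using DERIV_isCont[OF d] by (simp add: isCont_def)
      then have "\<forall>\<^sub>F t in at 0. 0 < gap K F (\<gamma> t)"
        using pos \<gamma>0 by (intro order_tendstoD(1)) auto
      then show ?thesis by (auto simp: eventually_at_filter elim: eventually_mono)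
    qed
  qed
  then have "\<forall>\<^sub>F t in at_right 0. \<forall>F\<in>{F. F facet_of K}. 0 < gap K F (\<gamma> t)"
    using finite_facets by (intro eventually_ball_finite) auto
  then show ?thesis by eventually_elim (simp add: interior_eq_gaps)
qed

end

context chart
begin

lemma line_\<Psi>_has_derivative:
  assumes x: "x \<in> \<Phi> ` U"
  shows "((\<lambda>t. \<Psi> (x + t *\<^sub>R w)) has_derivative
      (\<lambda>t. t *\<^sub>R (matrix_inv (J (\<Psi> x)) *v w))) (at 0)"
proof -
  have 1: "((\<lambda>t. x + t *\<^sub>R w) has_derivative (\<lambda>t. t *\<^sub>R w)) (at 0)"
    by (auto intro!: derivative_eq_intros)
  have 2: "(\<Psi> has_derivative (\<lambda>v. matrix_inv (J (\<Psi> x)) *v v)) (at (x + 0 *\<^sub>R w))"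
    using \<Psi>_has_derivative[OF x] by simp
  show ?thesis
    using diff_chain_at[OF 1 2] by (simp add: o_def matrix_vector_mult_scaleR)
qed

text \<open>In reference coordinates the straight line is a curve with initial velocity
  \<open>J^-1 w\<close>.\<close>

lemma eventually_in_element:
  assumes z: "z \<in> K"
    and inward: "\<And>F. F facet_of K \<Longrightarrow> gap K F z
        = 0 \<Longrightarrow> facet_normal K F \<bullet> (matrix_inv (J z) *v w) < 0"
  shows "\<forall>\<^sub>F t in at_right 0. \<Phi> z + t *\<^sub>R w \<in> interior (\<Phi> ` K)"
proof -
  have zU: "z \<in> U" using z K_subset_U by blast
  have x: "\<Phi> z \<in> \<Phi> ` U" using zU by blast
  note der = line_\<Psi>_has_derivative[OF x, of w, unfolded \<Psi>_\<Phi>[OF zU]]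
  have ev1: "\<forall>\<^sub>F t in at_right 0. \<Psi> (\<Phi> z + t *\<^sub>R w) \<in> interior K"
    by (rule eventually_in_interior[OF z _ der inward]) (simp_all add: \<Psi>_\<Phi>[OF zU])
  have "((\<lambda>t. \<Phi> z + t *\<^sub>R w) \<longlongrightarrow> \<Phi> z
      + 0 *\<^sub>R w) (at_right 0)"
    by (intro tendsto_intros)
  then have ev2: "\<forall>\<^sub>F t in at_right 0. \<Phi> z + t *\<^sub>R w \<in> \<Phi> ` U"
    using x open_\<Phi>_image[OF open_U] by (intro topological_tendstoD) auto
  have sub: "\<Phi> ` interior K \<subseteq> interior (\<Phi> ` K)"
    using interior_subset K_subset_U by (intro interior_maximal image_mono open_\<Phi>_image) auto
  from ev1 ev2 show ?thesis
  proof eventually_elim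
    case (elim t)
    then have "\<Phi> z + t *\<^sub>R w \<in> \<Phi> ` interior K" using \<Phi>_\<Psi>(1)
        by (metis image_eqI)
    then show ?case using sub by blast
  qed
qed

end

text \<open>A common face may be the image of different facets of the reference polytope, and its
  two parametrizations need not match pointwise. Disjointness of the interiors excludes that both
  elements lie on the same side.\<close>

locale adjacent_charts =
  A: chart K U \<Phi> + B: chart K U' \<Phi>' for K :: "(real^'n::finite) set" and U \<Phi> U' \<Phi>' +
  fixes F F' :: "(real^'n) set"
  assumes F: "F facet_of K" and F': "F' facet_of K" and common: "\<Phi> ` F = \<Phi>' ` F'"
    and disjoint: "interior (\<Phi> ` K) \<inter> interior (\<Phi>' ` K) = {}"
begin

definition transition :: "real^'n \<Rightarrow> real^'n" where
  "transition z = B.\<Psi> (\<Phi> z)"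

definition transition_deriv :: "real^'n \<Rightarrow> real^'n^'n" where
  "transition_deriv z = matrix_inv (B.J (transition z)) ** A.J z"

text \<open>The factor by which the derivative of \<open>transition\<close> multiplies normal
  components.\<close>

definition normal_ratio :: "real^'n \<Rightarrow> real" where
  "normal_ratio z = facet_normal K F' \<bullet> (transition_deriv z *v facet_normal K F)"

lemma F_U: "z \<in> F \<Longrightarrow> z \<in> U" "z' \<in> F' \<Longrightarrow> z' \<in> U'"
  using A.facet_subset[OF F] A.facet_subset[OF F'] A.K_subset_U B.K_subset_U by auto

lemma transition:
  assumes "z \<in> F"
  shows "transition z \<in> F'" and "\<Phi>' (transition z) = \<Phi> z"
proof -
  obtain z' where z': "z' \<in> F'" "\<Phi> z = \<Phi>' z'" using common assms by (metis imageE image_eqI)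
  then have "transition z = z'" using B.\<Psi>_\<Phi> F_U by (simp add: transition_def)
  then show "transition z \<in> F'" "\<Phi>' (transition z) = \<Phi> z" using z' by auto
qed

lemma transition_has_derivative:
  assumes z: "z \<in> F"
  shows "(transition has_derivative (\<lambda>v. transition_deriv z *v v)) (at z)"
proof -
  have "\<Phi> z \<in> \<Phi>' ` U'" using transition[OF z] F_U by (metis image_eqI)
  from diff_chain_at[OF A.\<Phi>_has_derivative[OF F_U(1)[OF z]] B.\<Psi>_has_derivative[OF this]]
  show ?thesis
    by (simp add: transition_def[abs_def] transition_deriv_def o_def matrix_vector_mul_assoc)
qed

lemma det_transition_deriv:
  assumes z: "z \<in> F"
  shows "det (transition_deriv z) = det (A.J z) / det (B.J (transition z))" "det
      (transition_deriv z) \<noteq> 0"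
proof -
  have J: "det (A.J z) \<noteq> 0" "det (B.J (transition z)) \<noteq> 0"
    using A.det_J B.det_J F_U transition z by auto
  have "det (B.J (transition z)) * det (matrix_inv (B.J (transition z))) = 1"
    unfolding det_mul[symmetric] matrix_inv_mult[OF J(2)] by simp
  then have "det (matrix_inv (B.J (transition z))) = 1 / det (B.J (transition z))"
    using J by (simp add: field_simps)
  then show "det (transition_deriv z) = det (A.J z) / det (B.J (transition z))"
    by (simp add: transition_deriv_def det_mul)
  then show "det (transition_deriv z) \<noteq> 0" using J by simp
qed

text \<open>
  The transition map sends the tangent hyperplane of one facet to that of the other.
\<close>

lemma normal_transition:
  assumes z: "z \<in> F"
  shows "facet_normal K F' \<bullet> (transition_deriv z *v v)
      = normal_ratio z * (facet_normal K F \<bullet> v)"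
proof -
  let ?a = "facet_normal K F" and ?a' = "facet_normal K F'" and ?L = "transition_deriv z"
  define N where "N = transpose ?L *v ?a'"
  have N: "N \<bullet> v = ?a' \<bullet> (?L *v v)" for v
    by (simp add: N_def dot_lmul_matrix)
  have tangent: "N \<bullet> (x - z) = 0" if x: "x \<in> F" for x
  proof -
    define g where "g t = ?a' \<bullet> transition (z + t *\<^sub>R (x - z))" for t
    have 1: "((\<lambda>t. z + t *\<^sub>R (x - z)) has_derivative
        (\<lambda>t. t *\<^sub>R (x - z))) (at 0)"
      by (auto intro!: derivative_eq_intros)
    have 2: "(transition has_derivative (\<lambda>v. ?L *v v)) (at (z + 0 *\<^sub>R (x - z)))"
      using transition_has_derivative[OF z] by simp
    have "(g has_derivative (\<lambda>t. ?a' \<bullet> (?L *v (t *\<^sub>R (x - z))))) (at 0)"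
      unfolding g_def using has_derivative_inner_right[OF diff_chain_at[OF 1 2], of ?a']
          by (simp add: o_def)
    then have d: "(g has_real_derivative N \<bullet> (x - z)) (at 0)"
      unfolding has_field_derivative_def
      by (rule has_derivative_eq_rhs) (simp add: fun_eq_iff N matrix_vector_mult_scaleR)
    \<comment> \<open>The chord lies in the facet only for \<open>t\<close> in [0,1]. As
      \<open>g\<close> is already known to be differentiable at 0, its derivative can be read off
      along the sequence \<open>1 / (n + 1)\<close>.\<close>
    have "g t = facet_level K F'" if "0 \<le> t" "t \<le> 1" for t
    proof -
      have "z + t *\<^sub>R (x - z) = (1 - t) *\<^sub>R z + t *\<^sub>R x" by (simp add: algebra_simps)
      then have "z + t *\<^sub>R (x - z) \<in> F"
        using A.convex_facet[OF F] x z that by (simp add: convex_alt)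
      from transition(1)[OF this] show ?thesis
        unfolding g_def using A.mem_facet_iff[OF F'] by (simp add: gap_def)
    qed
    then have g: "g (inverse (real (Suc n))) = g 0" for n by (simp add: inverse_le_1_iff)
    have "filterlim (\<lambda>n. inverse (real (Suc n))) (at 0) sequentially"
      using LIMSEQ_inverse_real_of_nat by (auto simp: filterlim_at)
    moreover have "((\<lambda>t. (g t - g 0) / t) \<longlongrightarrow> N \<bullet> (x - z)) (at 0)"
      using d by (simp add: DERIV_def)
    ultimately have "(\<lambda>n. (g (inverse (real (Suc n))) - g 0) / inverse (real (Suc n)))
        \<longlonglongrightarrow> N \<bullet> (x - z)"
      by (rule filterlim_compose[rotated])
    then show ?thesis unfolding g by (simp add: LIMSEQ_const_iff)
  qed
  have par: "N = (?a \<bullet> N) *\<^sub>R ?a"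
  proof (rule A.normal_parallel[OF F A.facet_normal_level(1)[OF F] _ z tangent])
    show "F \<subseteq> {x. ?a \<bullet> x = facet_level K F}"
      using A.mem_facet_iff[OF F] by (auto simp: gap_def)
  qed
  have "?a \<bullet> N = normal_ratio z" by (simp add: normal_ratio_def N[symmetric] inner_commute)
  then show ?thesis unfolding N[symmetric] by (subst par) simp
qed

text \<open>The rule for normal components is applied to the preimage of the other normal. The
  explicit reciprocal is kept because it is the determinant of a rank-one factor in
  \<open>facet_integral_opposite\<close>.\<close>

lemma normal_ratio_nonzero:
  assumes z: "z \<in> F"
  shows "normal_ratio z * (facet_normal K F \<bullet>
      (matrix_inv (transition_deriv z) *v facet_normal K F')) = 1"
  unfolding normal_transition[OF z, symmetric] matrix_inv_vector_mult(1)[OF det_transition_deriv(2)[OF z]]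
  using A.normal_inner_self[OF F'] .

lemma normal_pullback:
  assumes z: "z \<in> F"
  shows "facet_normal K F' \<bullet> (matrix_inv (B.J (transition z)) *v w) =
    normal_ratio z * (facet_normal K F \<bullet> (matrix_inv (A.J z) *v w))"
proof -
  have "A.J z *v (matrix_inv (A.J z) *v w) = w"
    using matrix_inv_vector_mult(1)[OF A.det_J[OF F_U(1)[OF z]]] .
  then have "matrix_inv (B.J (transition z)) *v w = transition_deriv z *v (matrix_inv (A.J z) *v w)"
    by (simp add: transition_deriv_def matrix_vector_mul_assoc[symmetric])
  then show ?thesis by (simp add: normal_transition[OF z])
qed

lemma continuous_on_transition: "continuous_on F transition"
  using transition_has_derivative has_derivative_continuous
  by (intro continuous_at_imp_continuous_on) blast

lemma continuous_on_normal_ratio: "continuous_on F normal_ratio"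
proof -
  have "continuous_on F (\<lambda>z. B.J (transition z))"
    by (rule continuous_on_compose2[OF B.continuous_on_J continuous_on_transition])
      (use transition F_U in auto)
  moreover have "continuous_on F A.J"
    using continuous_on_subset[OF A.continuous_on_J] F_U by blast
  ultimately show ?thesis
    unfolding normal_ratio_def transition_deriv_def matrix_vector_mul_assoc[symmetric]
    by (intro continuous_intros continuous_on_matrix_inv_mult)
      (use B.det_J transition F_U in auto)
qed

text \<open>
  Were the ratio positive, a direction pointing from a generic point of the common face into one element
  would also point into the other one.
\<close>

lemma normal_ratio_neg:
  assumes z: "z \<in> F"
  shows "normal_ratio z < 0"
proof (rule ccontr)
  assume "\<not> normal_ratio z < 0"
  obtain z0 where z0: "z0 \<in> F" "\<And>F'. F' facet_of K \<Longrightarrow> F' \<noteq> F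
      \<Longrightarrow> 0 < gap K F' z0"
    using A.facet_generic_point[OF F] by blast
  have nz: "normal_ratio x \<noteq> 0" if "x \<in> F" for x using normal_ratio_nonzero[OF that] by auto
  \<comment> \<open>The ratio has no zeros on the connected facet, so its sign at \<open>z\<close>
    is also its sign at the generic point \<open>z0\<close>.\<close>
  have pos: "0 < normal_ratio z0"
  proof (rule ccontr)
    assume "\<not> 0 < normal_ratio z0"
    moreover have "connected (normal_ratio ` F)"
      by (intro connected_continuous_image continuous_on_normal_ratio convex_connected A.convex_facet[OF F])
    ultimately have "0 \<in> normal_ratio ` F"
      using connectedD_interval[of "normal_ratio ` F" "normal_ratio z0" "normal_ratio z" 0] z z0
        \<open>\<not> normal_ratio z < 0\<close> by auto
    then show False using nz by auto
  qed
  obtain c where c: "c \<in> interior K" using A.interior_ne by blast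
  let ?z' = "transition z0"
  \<comment> \<open>In the coordinates of the second element this direction points at the interior
    point \<open>c\<close>; for the first element only the facet \<open>F\<close> has to be checked
    at \<open>z0\<close>.\<close>
  define w where "w = B.J ?z' *v (c - ?z')"
  have z': "?z' \<in> F'" "\<Phi>' ?z' = \<Phi> z0" using transition z0 by auto
  have z'K: "?z' \<in> K" using z'(1) A.facet_subset[OF F'] by blast
  have inv_w: "matrix_inv (B.J ?z') *v w = c - ?z'"
    unfolding w_def by (rule matrix_inv_vector_mult(2)[OF B.det_J[OF F_U(2)[OF z'(1)]]])
  have inward: "facet_normal K G \<bullet> (c - ?z') < 0" if "G facet_of K" "gap K G ?z' = 0" for G
    using c that A.interior_eq_gaps by (auto simp: gap_def inner_diff_right)
  have evB: "\<forall>\<^sub>F t in at_right 0. \<Phi>' ?z' + t *\<^sub>R w \<in> interior (\<Phi>' ` K)"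
    by (rule B.eventually_in_element[OF z'K]) (simp add: inv_w inward)
  have "\<forall>\<^sub>F t in at_right 0. \<Phi> z0 + t *\<^sub>R w \<in> interior (\<Phi> ` K)"
  proof (rule A.eventually_in_element)
    show "z0 \<in> K" using z0(1) A.facet_subset[OF F] by blast
    fix G assume G: "G facet_of K" "gap K G z0 = 0"
    then have "G = F" using z0(2)[of G] by force
    have "facet_normal K F' \<bullet> (c - ?z') < 0"
      using inward[OF F'] z'(1) A.mem_facet_iff[OF F'] by blast
    then have "normal_ratio z0 * (facet_normal K F \<bullet> (matrix_inv (A.J z0) *v w)) < 0"
      unfolding normal_pullback[OF z0(1), symmetric] inv_w .
    then show "facet_normal K G \<bullet> (matrix_inv (A.J z0) *v w) < 0"
      using pos \<open>G = F\<close> by (simp add: mult_less_0_iff)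
  qed
  with evB have "\<forall>\<^sub>F t in at_right (0::real). False"
    by eventually_elim (use disjoint z'(2) in auto)
  then show False by (simp add: trivial_limit_at_right_real)
qed

text \<open>Facet integrals live on prisms, so \<open>transition\<close> is extended to a map
  \<open>\<Theta>\<close> between the prisms that preserves the height over the facet.\<close>

lemma facet_integral_opposite:
  "facet_integral K F' (\<lambda>z. f (\<Phi>' z) * (facet_normal K F' \<bullet> B.pullback e z)) =
   - facet_integral K F (\<lambda>z. f (\<Phi> z) * (facet_normal K F \<bullet> A.pullback e z))"
proof -
  let ?a = "facet_normal K F" and ?a' = "facet_normal K F'"
  define \<Theta> where "\<Theta> y = transition (foot K F y) - gap K F y *\<^sub>R ?a'" for y
  have foot_F: "foot K F y \<in> F" "- 1 \<le> gap K F y" "gap K F y \<le> 0"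
      if "y \<in> facet_prism K F" for y
    using that A.mem_facet_prism[OF F] by auto
  have gap_\<Theta>: "gap K F' (\<Theta> y) = gap K F y" "foot K F' (\<Theta> y) = transition (foot K F y)"
    if "y \<in> facet_prism K F" for y
  proof -
    have "gap K F' (transition (foot K F y)) = 0"
      using transition(1)[OF foot_F(1)[OF that]] A.mem_facet_iff[OF F'] by blast
    then show "gap K F' (\<Theta> y) = gap K F y"
      using A.gap_add_normal[OF F', of "transition (foot K F y)" "- gap K F y"] by (simp add: \<Theta>_def)
    then show "foot K F' (\<Theta> y) = transition (foot K F y)"
        by (simp add: foot_def[of K F'] \<Theta>_def)
  qed
  have inj: "inj_on \<Theta> (facet_prism K F)"
  proof (rule inj_onI)
    fix x y assume xy: "x \<in> facet_prism K F" "y \<in> facet_prism K F" "\<Theta> x = \<Theta> y"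
    then have g: "gap K F x = gap K F y" using gap_\<Theta>(1) by metis
    have "transition (foot K F x) = transition (foot K F y)" using xy gap_\<Theta>(2) by metis
    then have "\<Phi> (foot K F x) = \<Phi> (foot K F y)" using transition(2) foot_F(1) xy by metis
    then have "foot K F x = foot K F y"
      using A.inj_\<Phi> F_U foot_F(1) xy by (meson inj_onD)
    then show "x = y" using g by (simp add: foot_def)
  qed
  have img: "\<Theta> ` facet_prism K F = facet_prism K F'"
  proof
    show "\<Theta> ` facet_prism K F \<subseteq> facet_prism K F'"
      using gap_\<Theta> foot_F transition(1) by (auto simp: A.mem_facet_prism[OF F'])
    show "facet_prism K F' \<subseteq> \<Theta> ` facet_prism K F"
    proof
      fix y' assume y': "y' \<in> facet_prism K F'"
      then have f': "foot K F' y' \<in> F'" "- 1 \<le> gap K F' y'" "gap K F' y' \<le> 0"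
        using A.mem_facet_prism[OF F'] by auto
      then obtain z where z: "z \<in> F" "\<Phi> z = \<Phi>' (foot K F' y')" using common
          by (metis imageE image_eqI)
      then have tz: "transition z = foot K F' y'"
        using B.\<Psi>_\<Phi>[OF F_U(2)[OF f'(1)]] by (simp add: transition_def)
      define y where "y = z - gap K F' y' *\<^sub>R ?a"
      have g: "gap K F y = gap K F' y'"
        using A.gap_add_normal[OF F, of z "- gap K F' y'"] z(1) A.mem_facet_iff[OF F] by (simp add: y_def)
      then have ft: "foot K F y = z" by (simp add: foot_def y_def)
      have "y \<in> facet_prism K F" using f' g ft z by (simp add: A.mem_facet_prism[OF F])
      moreover have "\<Theta> y = y'" by (simp add: \<Theta>_def ft tz g) (simp add: foot_def)
      ultimately show "y' \<in> \<Theta> ` facet_prism K F" by blast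
    qed
  qed
  \<comment> \<open>The derivative of \<open>\<Theta>\<close> has to send \<open>?a\<close> to
    \<open>?a'\<close>. Writing it as \<open>transition_deriv\<close> after
    \<open>v + (?a \<bullet> v) *\<^sub>R w\<close> makes its determinant a product.\<close>
  define w where "w z = matrix_inv (transition_deriv z) *v ?a' - ?a" for z
  have der: "(\<Theta> has_derivative (\<lambda>v. transition_deriv (foot K F y) *v (v
      + (?a \<bullet> v) *\<^sub>R w (foot K F y)))) (at y within facet_prism K F)"
    if y: "y \<in> facet_prism K F" for y
  proof -
    let ?z = "foot K F y"
    have dg: "(gap K F has_derivative (\<lambda>v. - (?a \<bullet> v))) (at y)"
      unfolding gap_def by (auto intro!: derivative_eq_intros)
    have df: "(foot K F has_derivative (\<lambda>v. v + (- (?a \<bullet> v)) *\<^sub>R ?a)) (at y)"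
      unfolding foot_def by (intro has_derivative_add has_derivative_ident has_derivative_scaleR_left dg)
    have dt: "((\<lambda>y. transition (foot K F y)) has_derivative
        (\<lambda>v. transition_deriv ?z *v (v + (- (?a \<bullet> v)) *\<^sub>R ?a))) (at y)"
      using diff_chain_at[OF df transition_has_derivative[OF foot_F(1)[OF y]]] by (simp add: o_def)
    have "(\<Theta> has_derivative (\<lambda>v. transition_deriv ?z *v (v
        + (- (?a \<bullet> v)) *\<^sub>R ?a) - (- (?a \<bullet> v)) *\<^sub>R ?a')) (at y)"
      unfolding \<Theta>_def by (intro has_derivative_diff has_derivative_scaleR_left dg dt)
    then have "(\<Theta> has_derivative (\<lambda>v. transition_deriv ?z *v (v
        + (?a \<bullet> v) *\<^sub>R w ?z))) (at y)"
    proof (rule has_derivative_eq_rhs)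
      have "transition_deriv ?z *v (matrix_inv (transition_deriv ?z) *v ?a') = ?a'"
        by (rule matrix_inv_vector_mult(1)[OF det_transition_deriv(2)[OF foot_F(1)[OF y]]])
      then show "(\<lambda>v. transition_deriv ?z *v (v + (- (?a \<bullet> v)) *\<^sub>R ?a)
          - (- (?a \<bullet> v)) *\<^sub>R ?a') =
          (\<lambda>v. transition_deriv ?z *v (v + (?a \<bullet> v) *\<^sub>R w ?z))"
        by (simp add: fun_eq_iff w_def matrix_vector_right_distrib matrix_vector_mult_scaleR
            matrix_vector_mult_diff_distrib scaleR_diff_right)
    qed
    then show ?thesis by (rule has_derivative_at_withinI)
  qed
  have det: "\<bar>det (matrix (\<lambda>v. transition_deriv z *v (v
      + (?a \<bullet> v) *\<^sub>R w z)))\<bar> =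
      \<bar>det (A.J z)\<bar> / (\<bar>det (B.J (transition z))\<bar> *
          - normal_ratio z)" if z: "z \<in> F" for z
  proof -
    have lin: "linear (\<lambda>v. v + (?a \<bullet> v) *\<^sub>R w z)"
      by (auto simp: linear_iff inner_add_right algebra_simps)
    have "matrix (\<lambda>v. transition_deriv z *v (v + (?a \<bullet> v) *\<^sub>R w z)) =
        transition_deriv z ** matrix (\<lambda>v. v + (?a \<bullet> v) *\<^sub>R w z)"
      using matrix_compose[OF lin matrix_vector_mul_linear[of "transition_deriv z"]]
      by (simp add: o_def)
    then have "det (matrix (\<lambda>v. transition_deriv z *v (v + (?a \<bullet> v) *\<^sub>R w z))) =
        det (transition_deriv z) * (1 + ?a \<bullet> w z)"
      by (simp add: det_mul det_rank_one)
    moreover have "1 + ?a \<bullet> w z = 1 / normal_ratio z"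
    proof -
      have "1 + ?a \<bullet> w z = ?a \<bullet> (matrix_inv (transition_deriv z) *v ?a')"
        using A.normal_inner_self[OF F] by (simp add: w_def inner_diff_right)
      then show ?thesis using normal_ratio_nonzero[OF z] normal_ratio_neg[OF z] by (simp add: field_simps)
    qed
    ultimately show ?thesis
      using det_transition_deriv(1)[OF z] normal_ratio_neg[OF z] by (simp add: abs_mult abs_divide)
  qed
  define h where "h z = f (\<Phi> z) * (?a \<bullet> A.pullback e z)" for z
  define h' where "h' z = f (\<Phi>' z) * (?a' \<bullet> B.pullback e z)" for z
  \<comment> \<open>The Jacobian is divided by the absolute value \<open>- normal_ratio z\<close>,
    while the flux is multiplied by the signed ratio; the factor \<open>- 1\<close> that remains is
    the reversal of orientation.\<close>
  have h': "\<bar>det (A.J z)\<bar> / (\<bar>det (B.J (transition z))\<bar> * - normal_ratio z)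
      * h' (transition z) = - h z"
    if z: "z \<in> F" for z
    using B.det_J[OF F_U(2)[OF transition(1)[OF z]]] normal_ratio_neg[OF z]
    by (simp add: h'_def h_def A.pullback_def B.pullback_def normal_pullback[OF z]
        transition(2)[OF z] field_simps)
  have prism: "facet_prism K F \<in> sets lebesgue"
    using A.compact_facet_prism[OF F] by (simp add: borel_compact)
  have "facet_integral K F' h' = (LINT y:\<Theta> ` facet_prism K F|lebesgue. h' (foot K F' y))"
    by (simp add: A.facet_integral_foot[OF F'] img)
  also have "\<dots> = (LINT y:facet_prism K F|lebesgue.
      \<bar>det (matrix (\<lambda>v. transition_deriv (foot K F y) *v (v
          + (?a \<bullet> v) *\<^sub>R w (foot K F y))))\<bar> * h' (foot K F' (\<Theta> y)))"
    by (rule change_of_variables(2)[OF prism _ inj]) (rule der)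
  also have "\<dots> = (LINT y:facet_prism K F|lebesgue. - h (foot K F y))"
    unfolding set_lebesgue_integral_def
  proof (rule Bochner_Integration.integral_cong[OF refl])
    fix y :: "real^'n"
    show "indicator (facet_prism K F) y *\<^sub>R
        (\<bar>det (matrix (\<lambda>v. transition_deriv (foot K F y) *v (v
            + (?a \<bullet> v) *\<^sub>R w (foot K F y))))\<bar> * h' (foot K F' (\<Theta> y))) =
      indicator (facet_prism K F) y *\<^sub>R (- h (foot K F y))"
    proof (cases "y \<in> facet_prism K F")
      case True
      then show ?thesis using det[OF foot_F(1)[OF True]] h'[OF foot_F(1)[OF True]]
          gap_\<Theta>(2)[OF True] by simp
    qed simp
  qed
  also have "\<dots> = - facet_integral K F h"
    unfolding A.facet_integral_foot[OF F] set_lebesgue_integral_def by simp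
  finally show ?thesis by (simp add: h_def[abs_def] h'_def[abs_def])
qed

end

section \<open>Element integrals and the mass matrix\<close>

definition C1_function :: "(real^'n::finite \<Rightarrow> real) \<Rightarrow>
    (real^'n \<Rightarrow> real^'n) \<Rightarrow> bool" where
  "C1_function p \<gamma> \<longleftrightarrow>
      (\<forall>z. (p has_derivative (\<lambda>v. \<gamma> z \<bullet> v)) (at z))
      \<and> continuous_on UNIV \<gamma>"

lemma C1_continuous: "C1_function p \<gamma> \<Longrightarrow> continuous_on S p"
  unfolding C1_function_def
  by (intro continuous_at_imp_continuous_on ballI has_derivative_continuous) blast

lemma C1_const: "C1_function (\<lambda>z. c) (\<lambda>z. 0)"
  by (simp add: C1_function_def)

lemma C1_component: "C1_function (\<lambda>z. z $ i) (\<lambda>z. axis i 1)"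
  unfolding C1_function_def
  by (auto intro!: has_derivative_eq_rhs[OF bounded_linear_imp_has_derivative[OF bounded_linear_vec_nth]]
      simp: fun_eq_iff inner_axis')

lemma C1_mult:
  assumes p: "C1_function p \<gamma>" and q: "C1_function q \<delta>"
  shows "C1_function (\<lambda>z. p z * q z) (\<lambda>z. p z *\<^sub>R \<delta> z
      + q z *\<^sub>R \<gamma> z)"
  unfolding C1_function_def
proof (intro conjI allI)
  have d: "(p has_derivative (\<lambda>v. \<gamma> z \<bullet> v)) (at z)"
      "(q has_derivative (\<lambda>v. \<delta> z \<bullet> v)) (at z)" for z
    using p q by (auto simp: C1_function_def)
  show "((\<lambda>z. p z * q z) has_derivative
      (\<lambda>v. (p z *\<^sub>R \<delta> z + q z *\<^sub>R \<gamma> z) \<bullet> v)) (at z)" for z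
    by (rule has_derivative_eq_rhs[OF has_derivative_mult[OF d]]) (simp add: fun_eq_iff inner_add_left)
  show "continuous_on UNIV (\<lambda>z. p z *\<^sub>R \<delta> z + q z *\<^sub>R \<gamma> z)"
    using p q by (intro continuous_intros C1_continuous[OF p] C1_continuous[OF q])
        (auto simp: C1_function_def)
qed

lemma C1_sum:
  assumes "\<And>i. i \<in> I \<Longrightarrow> C1_function (p i) (\<gamma> i)"
  shows "C1_function (\<lambda>z. \<Sum>i\<in>I. c i
      * p i z) (\<lambda>z. \<Sum>i\<in>I. c i *\<^sub>R \<gamma> i z)"
  unfolding C1_function_def
proof (intro conjI allI)
  show "((\<lambda>z. \<Sum>i\<in>I. c i * p i z) has_derivative
      (\<lambda>v. (\<Sum>i\<in>I. c i *\<^sub>R \<gamma> i z) \<bullet> v)) (at z)" for z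
    unfolding inner_sum_left inner_scaleR_left
    by (intro has_derivative_sum has_derivative_mult_right)
        (use assms in \<open>auto simp: C1_function_def\<close>)
  show "continuous_on UNIV (\<lambda>z. \<Sum>i\<in>I. c i *\<^sub>R \<gamma> i z)"
    by (intro continuous_intros) (use assms in \<open>auto simp: C1_function_def\<close>)
qed

lemma C1_power_component: "\<exists>\<gamma>. C1_function (\<lambda>z. (z $ i) ^ k) \<gamma>"
proof (induction k)
  case 0
  then show ?case using C1_const[of 1] by auto
next
  case (Suc k)
  then show ?case using C1_mult[OF C1_component] by fastforce
qed

lemma C1_prod:
  assumes "finite I" "\<And>i. i \<in> I \<Longrightarrow> \<exists>\<gamma>. C1_function (p i) \<gamma>"
  shows "\<exists>\<gamma>. C1_function (\<lambda>z. \<Prod>i\<in>I. p i z) \<gamma>"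
  using assms
proof (induction I rule: finite_induct)
  case empty
  then show ?case using C1_const[of 1] by auto
next
  case (insert i I)
  obtain \<gamma> where g: "C1_function (p i) \<gamma>" using insert.prems by blast
  obtain \<delta> where "C1_function (\<lambda>z. \<Prod>i\<in>I. p i z) \<delta>"
      using insert.IH insert.prems by blast
  from C1_mult[OF g this] show ?case using insert by auto
qed

lemma C1_poly_degree_le:
  assumes "poly_degree_le r p"
  shows "\<exists>\<gamma>. C1_function p \<gamma>"
proof -
  obtain c where c: "p = (\<lambda>x. \<Sum>\<alpha> | (\<Sum>i\<in>UNIV. \<alpha> i)
      \<le> r. c \<alpha> * (\<Prod>i\<in>UNIV. (x $ i) ^ \<alpha> i))"
    using assms by (auto simp: poly_degree_le_def)
  have "\<exists>\<gamma>. C1_function (\<lambda>x. \<Prod>i\<in>UNIV. (x $ i) ^ \<alpha> i)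
      \<gamma>" for \<alpha> :: "'a \<Rightarrow> nat"
    by (intro C1_prod C1_power_component) auto
  then obtain \<gamma> where "\<forall>\<alpha> :: 'a \<Rightarrow> nat. C1_function
      (\<lambda>x. \<Prod>i\<in>UNIV. (x $ i) ^ \<alpha> i) (\<gamma> \<alpha>)"
    using choice[of "\<lambda>\<alpha> \<gamma>. C1_function
        (\<lambda>x. \<Prod>i\<in>UNIV. (x $ i) ^ \<alpha> i) \<gamma>"] by blast
  then have "C1_function p (\<lambda>z. \<Sum>\<alpha> | (\<Sum>i\<in>UNIV. \<alpha> i)
      \<le> r. c \<alpha> *\<^sub>R \<gamma> \<alpha> z)"
    unfolding c by (intro C1_sum) blast
  then show ?thesis by blast
qed

section \<open>Set integrals: null sets and linear combinations\<close>

lemma set_integral_spike: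
  fixes f g :: "'a::euclidean_space \<Rightarrow> real"
  assumes f: "set_integrable lebesgue S f" and N: "negligible N" and eq: "\<And>x. x \<in> S
      - N \<Longrightarrow> g x = f x"
  shows "set_integrable lebesgue S g" and "(LINT x:S|lebesgue. g x) = (LINT x:S|lebesgue. f x)"
proof -
  show g: "set_integrable lebesgue S g" by (rule absolutely_integrable_spike[OF f N eq])
  show "(LINT x:S|lebesgue. g x) = (LINT x:S|lebesgue. f x)"
    unfolding set_lebesgue_integral_eq_integral(2)[OF f] set_lebesgue_integral_eq_integral(2)[OF g]
    by (rule integral_spike[OF N, symmetric]) (use eq in auto)
qed

lemma set_integral_spike_subset:
  fixes f :: "'a::euclidean_space \<Rightarrow> real"
  assumes f: "set_integrable lebesgue S f" and "S \<subseteq> T" and N: "negligible (T - S)"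
  shows "set_integrable lebesgue T f" and "(LINT x:T|lebesgue. f x) = (LINT x:S|lebesgue. f x)"
proof -
  have n: "negligible {x \<in> S - T. f x \<noteq> 0}" "negligible {x \<in> T - S. f x \<noteq> 0}"
    using \<open>S \<subseteq> T\<close>
        by (auto intro: negligible_subset[OF N] simp: Diff_eq_empty_iff[THEN iffD2])
  show T: "set_integrable lebesgue T f" by (rule absolutely_integrable_spike_set[OF f n])
  show "(LINT x:T|lebesgue. f x) = (LINT x:S|lebesgue. f x)"
    unfolding set_lebesgue_integral_eq_integral(2)[OF f] set_lebesgue_integral_eq_integral(2)[OF T]
    by (rule integral_spike_set[OF n, symmetric])
qed

lemma set_integral_lincomb:
  fixes f :: "'i \<Rightarrow> 'a \<Rightarrow> real"
  assumes "\<And>i. i \<in> I \<Longrightarrow> set_integrable M S (f i)"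
  shows "(LINT x:S|M. \<Sum>i\<in>I. c i * f i x) = (\<Sum>i\<in>I. c i * (LINT x:S|M. f i x))"
proof -
  have "(LINT x:S|M. \<Sum>i\<in>I. c i * f i x) = (\<Sum>i\<in>I. LINT x:S|M. c i * f i x)"
    unfolding set_lebesgue_integral_def scaleR_sum_right
  proof (rule Bochner_Integration.integral_sum)
    fix i assume "i \<in> I"
    then show "integrable M (\<lambda>x. indicator S x *\<^sub>R (c i * f i x))"
      using set_integrable_mult_right[of "c i" M S "f i"] assms by (simp only: set_integrable_def)
  qed
  then show ?thesis by simp
qed

context solid_polytope
begin

lemma facet_integral_cong:
  assumes F: "F facet_of K" and "\<And>z. z \<in> F \<Longrightarrow> f z = g z"
  shows "facet_integral K F f = facet_integral K F g"
  unfolding facet_integral_foot[OF F] set_lebesgue_integral_def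
  by (rule Bochner_Integration.integral_cong) (auto simp: indicator_def mem_facet_prism[OF F] assms(2))

lemma facet_integral_lincomb:
  assumes F: "F facet_of K" and "\<And>i. i \<in> I \<Longrightarrow> continuous_on F (f i)"
  shows "facet_integral K F (\<lambda>z. \<Sum>i\<in>I. c i * f i z)
      = (\<Sum>i\<in>I. c i * facet_integral K F (f i))"
  unfolding facet_integral_foot[OF F]
  by (rule set_integral_lincomb) (use integrable_prism_foot[OF F] assms(2) in blast)

end

section \<open>Volume forms on the elements\<close>

locale dg_problem =
  fixes X :: "('n::finite, 'N::finite) transport"
  assumes mesh: "valid_mesh X" and basis: "valid_basis X"
    and opacities: "valid_opacities X" and quadrature: "valid_quadrature X"
begin

abbreviation K where "K \<equiv> dg_ref X"

abbreviation pb where "pb \<kappa> \<equiv> chart.pullback (dg_map X \<kappa>)"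

definition chart_dom :: "(real^'n) set \<Rightarrow> (real^'n) set" where
  "chart_dom \<kappa> = (SOME U. K \<subseteq> U \<and> C2_diffeo_on U (dg_map X \<kappa>))"

lemma chart_elem:
  assumes "\<kappa> \<in> dg_elems X"
  shows "chart K (chart_dom \<kappa>) (dg_map X \<kappa>)"
proof -
  have "\<exists>U. K \<subseteq> U \<and> C2_diffeo_on U (dg_map X \<kappa>)" using mesh assms
      by (auto simp: valid_mesh_def)
  from someI_ex[OF this] show ?thesis
    using mesh by (simp add: chart_def chart_axioms_def solid_polytope_def chart_dom_def valid_mesh_def)
qed

lemma elem_image: "\<kappa> \<in> dg_elems X \<Longrightarrow> dg_map X \<kappa> ` K = \<kappa>"
  using mesh by (simp add: valid_mesh_def)

lemma finite_elems: "finite (dg_elems X)"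
  using mesh by (simp add: valid_mesh_def)

sublocale solid_polytope K
  using mesh by unfold_locales (simp_all add: valid_mesh_def)

text \<open>The representing function is C^1 on the whole space and not only on \<open>K\<close>, as
  the divergence theorem requires; polynomials provide it.\<close>

definition ref_rep :: "(real^'n) set \<Rightarrow> 'n piecewise \<Rightarrow>
    (real^'n \<Rightarrow> real) \<Rightarrow> (real^'n \<Rightarrow> real^'n) \<Rightarrow> bool" where
  "ref_rep \<kappa> u p \<gamma> \<longleftrightarrow> C1_function p \<gamma>
      \<and> (\<forall>z\<in>K. u \<kappa> (dg_map X \<kappa> z) = p z)"

lemma ref_rep_basis:
  assumes "\<kappa> \<in> dg_elems X"
  obtains p \<gamma> where "\<And>i. ref_rep \<kappa> (dg_basis X i) (p i) (\<gamma> i)"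
proof -
  have "\<exists>p \<gamma>. ref_rep \<kappa> (dg_basis X i) p \<gamma>" for i
  proof -
    have "dg_basis X i \<in> dg_space X" using basis by (simp add: valid_basis_def)
    then obtain p where "poly_degree_le (dg_deg X) p" "\<forall>z\<in>K. dg_basis X i \<kappa>
        (dg_map X \<kappa> z) = p z"
      using assms by (auto simp: dg_space_def)
    then show ?thesis using C1_poly_degree_le[of "dg_deg X" p]
        by (auto simp: ref_rep_def intro!: exI[of _ p])
  qed
  then show ?thesis using that by metis
qed

lemma ref_rep_dg_fun:
  assumes "\<And>i. ref_rep \<kappa> (dg_basis X i) (p i) (\<gamma> i)"
  shows "ref_rep \<kappa> (dg_fun X c) (\<lambda>z. \<Sum>i\<in>UNIV. c $ i
      * p i z) (\<lambda>z. \<Sum>i\<in>UNIV. c $ i *\<^sub>R \<gamma> i z)"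
  unfolding ref_rep_def
proof (intro conjI ballI)
  show "C1_function (\<lambda>z. \<Sum>i\<in>UNIV. c $ i
      * p i z) (\<lambda>z. \<Sum>i\<in>UNIV. c $ i *\<^sub>R \<gamma> i z)"
    by (rule C1_sum) (use assms in \<open>auto simp: ref_rep_def\<close>)
qed (use assms in \<open>auto simp: ref_rep_def dg_fun_def\<close>)

definition vol_form :: "real^'n \<Rightarrow> (real^'n) set \<Rightarrow> 'n piecewise \<Rightarrow>
    'n piecewise \<Rightarrow> real" where
  "vol_form e \<kappa> u v = (LINT x:\<kappa>|lebesgue. frechet_derivative (u \<kappa>) (at x) e
      * v \<kappa> x)"

lemma vol_form_ref:
  assumes \<kappa>: "\<kappa> \<in> dg_elems X" and u: "ref_rep \<kappa> u p \<gamma>" and v: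
      "ref_rep \<kappa> v q \<delta>"
  shows "vol_form e \<kappa> u v = (LINT z:K|lebesgue. (\<gamma> z \<bullet> pb \<kappa> e z) * q z)"
proof -
  interpret C: chart K "chart_dom \<kappa>" "dg_map X \<kappa>" by (rule chart_elem[OF \<kappa>])
  let ?\<Phi> = "dg_map X \<kappa>"
  have p: "C1_function p \<gamma>" "\<And>z. z \<in> K \<Longrightarrow> u \<kappa> (?\<Phi> z)
      = p z" using u by (auto simp: ref_rep_def)
  have q: "C1_function q \<delta>" "\<And>z. z \<in> K \<Longrightarrow> v \<kappa> (?\<Phi> z)
      = q z" using v by (auto simp: ref_rep_def)
  \<comment> \<open>\<open>u \<kappa>\<close> is controlled on the element only, so its derivative
    is computed at images of interior points; the frontier of \<open>K\<close> is a null
    set.\<close>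
  have frechet: "frechet_derivative (u \<kappa>) (at (?\<Phi> z)) e
      = \<gamma> z \<bullet> (matrix_inv (C.J z) *v e)"
    if z: "z \<in> interior K" for z
  proof -
    have zU: "z \<in> chart_dom \<kappa>" using z interior_subset C.K_subset_U by blast
    let ?O = "?\<Phi> ` interior K"
    have O: "open ?O" using interior_subset C.K_subset_U by (intro C.open_\<Phi>_image) auto
    have d: "(C.\<Psi> has_derivative (\<lambda>v. matrix_inv (C.J z) *v v)) (at (?\<Phi> z))"
      using C.\<Psi>_has_derivative[of "?\<Phi> z"] zU C.\<Psi>_\<Phi>[OF zU] by simp
    have dp: "(p has_derivative (\<lambda>v. \<gamma> z \<bullet> v)) (at (C.\<Psi> (?\<Phi> z)))"
      using p(1) C.\<Psi>_\<Phi>[OF zU] by (simp add: C1_function_def)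
    have "((\<lambda>x. p (C.\<Psi> x)) has_derivative
        (\<lambda>v. \<gamma> z \<bullet> (matrix_inv (C.J z) *v v))) (at (?\<Phi> z))"
      using diff_chain_at[OF d dp] by (simp add: o_def)
    then have "(u \<kappa> has_derivative (\<lambda>v. \<gamma> z \<bullet>
        (matrix_inv (C.J z) *v v))) (at (?\<Phi> z))"
    proof (rule has_derivative_transform_within_open[OF _ O])
      show "?\<Phi> z \<in> ?O" using z by blast
      show "p (C.\<Psi> x) = u \<kappa> x" if x: "x \<in> ?O" for x
      proof -
        obtain y where y: "y \<in> interior K" "x = ?\<Phi> y" using x by blast
        then have "y \<in> K" "y \<in> chart_dom \<kappa>" using interior_subset C.K_subset_U by blast+
        then show ?thesis using y p(2) C.\<Psi>_\<Phi> by simp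
      qed
    qed
    from frechet_derivative_at[OF this] show ?thesis by metis
  qed
  have cont: "continuous_on K (\<lambda>z. (\<gamma> z \<bullet> pb \<kappa> e z) * q z)"
    using p(1) by (intro continuous_intros continuous_on_subset[OF C.continuous_on_pullback
        C.K_subset_U] C1_continuous[OF q(1)])
      (auto simp: C1_function_def intro: continuous_on_subset)
  have "vol_form e \<kappa> u v = (LINT x:?\<Phi> ` K|lebesgue. frechet_derivative (u \<kappa>)
      (at x) e * v \<kappa> x)"
    by (simp add: vol_form_def elem_image[OF \<kappa>])
  also have "\<dots> = (LINT z:K|lebesgue. \<bar>det (C.J z)\<bar>
      * (frechet_derivative (u \<kappa>) (at (?\<Phi> z)) e * v \<kappa> (?\<Phi> z)))"
    by (rule C.chart_change_of_variables(2))
  also have "\<dots> = (LINT z:K|lebesgue. (\<gamma> z \<bullet> pb \<kappa> e z) * q z)"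
  proof (rule set_integral_spike(2)[OF set_integrable_continuous_compact[OF compact_K cont]])
    show "negligible (frontier K)" by (rule negligible_convex_frontier[OF convex_K])
    fix z assume z: "z \<in> K - frontier K"
    then have "z \<in> interior K" using closed_K by (auto simp: frontier_def)
    then show "\<bar>det (C.J z)\<bar> * (frechet_derivative (u \<kappa>) (at (?\<Phi> z)) e
        * v \<kappa> (?\<Phi> z)) = (\<gamma> z \<bullet> pb \<kappa> e z) * q z"
      using frechet q(2) z by (simp add: C.pullback_def)
  qed
  finally show ?thesis .
qed

lemma continuous_on_pb:
  assumes "\<kappa> \<in> dg_elems X"
  shows "continuous_on K (pb \<kappa> e)"
  using chart.continuous_on_pullback[OF chart_elem[OF assms]] chart.K_subset_U[OF chart_elem[OF assms]]
  by (rule continuous_on_subset)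

lemma vol_integrand_continuous:
  assumes "\<kappa> \<in> dg_elems X" "C1_function p \<gamma>" "C1_function q \<delta>"
  shows "continuous_on K (\<lambda>z. (\<gamma> z \<bullet> pb \<kappa> e z) * q z)"
  using assms(2) by (intro continuous_intros continuous_on_pb[OF assms(1)] C1_continuous[OF assms(3)])
    (auto simp: C1_function_def intro: continuous_on_subset)

text \<open>\<open>form_matrix\<close> records values on basis functions only. Linearity of the
  forms, which rests on integrability, turns products of a matrix with a coefficient vector into
  forms of \<open>dg_fun\<close>.\<close>

lemma vol_form_left:
  assumes \<kappa>: "\<kappa> \<in> dg_elems X"
  shows "vol_form e \<kappa> (dg_fun X c) (dg_basis X j)
      = (\<Sum>i\<in>UNIV. c $ i * vol_form e \<kappa> (dg_basis X i) (dg_basis X j))"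
proof -
  obtain p \<gamma> where rep: "\<And>i. ref_rep \<kappa> (dg_basis X i) (p i) (\<gamma> i)"
      using ref_rep_basis[OF \<kappa>] by blast
  have C1: "C1_function (p i) (\<gamma> i)" for i using rep by (simp add: ref_rep_def)
  have "vol_form e \<kappa> (dg_fun X c) (dg_basis X j) =
      (LINT z:K|lebesgue. ((\<Sum>i\<in>UNIV. c $ i *\<^sub>R \<gamma> i z) \<bullet> pb \<kappa> e
          z) * p j z)"
    by (rule vol_form_ref[OF \<kappa> ref_rep_dg_fun[OF rep] rep])
  also have "\<dots> = (LINT z:K|lebesgue. \<Sum>i\<in>UNIV. c $ i
      * ((\<gamma> i z \<bullet> pb \<kappa> e z) * p j z))"
    by (simp add: inner_sum_left sum_distrib_right mult.assoc)
  also have "\<dots> = (\<Sum>i\<in>UNIV. c $ i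
      * (LINT z:K|lebesgue. (\<gamma> i z \<bullet> pb \<kappa> e z) * p j z))"
    by (rule set_integral_lincomb)
      (intro set_integrable_continuous_compact compact_K vol_integrand_continuous[OF \<kappa> C1 C1])
  finally show ?thesis by (simp add: vol_form_ref[OF \<kappa> rep rep])
qed

lemma vol_form_right:
  assumes \<kappa>: "\<kappa> \<in> dg_elems X"
  shows "vol_form e \<kappa> (dg_basis X j) (dg_fun X c)
      = (\<Sum>i\<in>UNIV. c $ i * vol_form e \<kappa> (dg_basis X j) (dg_basis X i))"
proof -
  obtain p \<gamma> where rep: "\<And>i. ref_rep \<kappa> (dg_basis X i) (p i) (\<gamma> i)"
      using ref_rep_basis[OF \<kappa>] by blast
  have C1: "C1_function (p i) (\<gamma> i)" for i using rep by (simp add: ref_rep_def)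
  have "vol_form e \<kappa> (dg_basis X j) (dg_fun X c) =
      (LINT z:K|lebesgue. (\<gamma> j z \<bullet> pb \<kappa> e z) * (\<Sum>i\<in>UNIV. c $ i * p i z))"
    by (rule vol_form_ref[OF \<kappa> rep ref_rep_dg_fun[OF rep]])
  also have "\<dots> = (LINT z:K|lebesgue. \<Sum>i\<in>UNIV. c $ i
      * ((\<gamma> j z \<bullet> pb \<kappa> e z) * p i z))"
    by (simp add: sum_distrib_left sum_distrib_right mult_ac)
  also have "\<dots> = (\<Sum>i\<in>UNIV. c $ i
      * (LINT z:K|lebesgue. (\<gamma> j z \<bullet> pb \<kappa> e z) * p i z))"
    by (rule set_integral_lincomb)
      (intro set_integrable_continuous_compact compact_K vol_integrand_continuous[OF \<kappa> C1 C1])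
  finally show ?thesis by (simp add: vol_form_ref[OF \<kappa> rep rep])
qed

text \<open>Linearity in the direction is read off on the reference element, because at boundary
  points the Frechet derivative may be an arbitrary choice.\<close>

lemma vol_form_direction:
  assumes \<kappa>: "\<kappa> \<in> dg_elems X"
  shows "(\<Sum>k\<in>UNIV. e $ k * vol_form (axis k 1) \<kappa> (dg_basis X i) (dg_basis X j))
      = vol_form e \<kappa> (dg_basis X i) (dg_basis X j)"
proof -
  interpret C: chart K "chart_dom \<kappa>" "dg_map X \<kappa>" by (rule chart_elem[OF \<kappa>])
  obtain p \<gamma> where rep: "\<And>i. ref_rep \<kappa> (dg_basis X i) (p i) (\<gamma> i)"
      using ref_rep_basis[OF \<kappa>] by blast
  have C1: "C1_function (p i) (\<gamma> i)" for i using rep by (simp add: ref_rep_def)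
  have "(\<Sum>k\<in>UNIV. e $ k *\<^sub>R axis k 1) = e"
      by (simp add: vec_eq_iff axis_def if_distrib cong: if_cong)
  then have "matrix_inv (C.J z) *v e = (\<Sum>k\<in>UNIV. e $ k *\<^sub>R
      (matrix_inv (C.J z) *v axis k 1))" for z
    using linear_sum[OF matrix_vector_mul_linear[of "matrix_inv (C.J z)"], of "\<lambda>k. e $ k
        *\<^sub>R axis k 1" UNIV]
    by (simp add: matrix_vector_mult_scaleR)
  then have pb: "pb \<kappa> e z = (\<Sum>k\<in>UNIV. e $ k *\<^sub>R pb \<kappa> (axis k 1) z)" for z
    by (simp add: C.pullback_def scaleR_sum_right mult.commute)
  have "vol_form e \<kappa> (dg_basis X i) (dg_basis X j) =
      (LINT z:K|lebesgue. \<Sum>k\<in>UNIV. e $ k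
          * ((\<gamma> i z \<bullet> pb \<kappa> (axis k 1) z) * p j z))"
    unfolding vol_form_ref[OF \<kappa> rep rep]
        by (subst pb) (simp add: inner_sum_right sum_distrib_right mult.assoc)
  also have "\<dots> = (\<Sum>k\<in>UNIV. e $ k
      * (LINT z:K|lebesgue. (\<gamma> i z \<bullet> pb \<kappa> (axis k 1) z) * p j z))"
    by (rule set_integral_lincomb)
      (intro set_integrable_continuous_compact compact_K vol_integrand_continuous[OF \<kappa> C1 C1])
  finally show ?thesis by (simp add: vol_form_ref[OF \<kappa> rep rep])
qed

text \<open>The divergence theorem is applied to the product of the two reference functions.\<close>

lemma vol_form_by_parts:
  assumes \<kappa>: "\<kappa> \<in> dg_elems X" and u: "ref_rep \<kappa> u p \<gamma>" and v:
      "ref_rep \<kappa> v q \<delta>"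
  shows "vol_form e \<kappa> u v + vol_form e \<kappa> v u = (\<Sum>F | F facet_of K. facet_integral K F
    (\<lambda>z. (u \<kappa> (dg_map X \<kappa> z) * v \<kappa> (dg_map X \<kappa> z))
        * (facet_normal K F \<bullet> pb \<kappa> e z)))"
proof -
  have p: "C1_function p \<gamma>" "\<And>z. z \<in> K \<Longrightarrow> u \<kappa>
      (dg_map X \<kappa> z) = p z" using u by (auto simp: ref_rep_def)
  have q: "C1_function q \<delta>" "\<And>z. z \<in> K \<Longrightarrow> v \<kappa>
      (dg_map X \<kappa> z) = q z" using v by (auto simp: ref_rep_def)
  note m = C1_mult[OF p(1) q(1), unfolded C1_function_def]
  have "vol_form e \<kappa> u v + vol_form e \<kappa> v u =
      (LINT z:K|lebesgue. (p z *\<^sub>R \<delta> z + q z *\<^sub>R \<gamma> z) \<bullet> pb \<kappa> e z)"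
    unfolding vol_form_ref[OF \<kappa> u v] vol_form_ref[OF \<kappa> v u]
    using set_integral_add(2)[OF set_integrable_continuous_compact[OF compact_K
        vol_integrand_continuous[OF \<kappa> p(1) q(1), of e]]
      set_integrable_continuous_compact[OF compact_K vol_integrand_continuous[OF \<kappa> q(1) p(1), of e]]]
    by (simp add: inner_add_left add.commute mult.commute)
  also have "\<dots> = (\<Sum>F | F facet_of K. facet_integral K F (\<lambda>z. (p z * q z)
      * (facet_normal K F \<bullet> pb \<kappa> e z)))"
    by (rule chart.divergence[OF chart_elem[OF \<kappa>]]) (use m in auto)
  also have "\<dots> = (\<Sum>F | F facet_of K. facet_integral K F
      (\<lambda>z. (u \<kappa> (dg_map X \<kappa> z) * v \<kappa> (dg_map X \<kappa> z))
          * (facet_normal K F \<bullet> pb \<kappa> e z)))"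
  proof (rule sum.cong[OF refl])
    fix F assume "F \<in> {F. F facet_of K}"
    then have F: "F facet_of K" by simp
    then show "facet_integral K F (\<lambda>z. (p z * q z)
        * (facet_normal K F \<bullet> pb \<kappa> e z)) = facet_integral K F
      (\<lambda>z. (u \<kappa> (dg_map X \<kappa> z) * v \<kappa> (dg_map X \<kappa> z))
          * (facet_normal K F \<bullet> pb \<kappa> e z))"
      using facet_subset[OF F] p(2) q(2) by (intro facet_integral_cong[OF F]) auto
  qed
  finally show ?thesis .
qed

section \<open>Integrability on closed elements and the mass matrix\<close>

lemma negligible_elem_minus_interior: 
  assumes \<kappa>: "\<kappa> \<in> dg_elems X"
  shows "negligible (\<kappa> - interior \<kappa>)"
proof -
  interpret C: chart K "chart_dom \<kappa>" "dg_map X \<kappa>" by (rule chart_elem[OF \<kappa>])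
  let ?\<Phi> = "dg_map X \<kappa>"
  have "?\<Phi> differentiable_on frontier K"
    unfolding differentiable_on_def
  proof
    fix z assume "z \<in> frontier K"
    then have "z \<in> chart_dom \<kappa>" using closed_K C.K_subset_U by (auto simp: frontier_def)
    then show "?\<Phi> differentiable at z within frontier K"
      using C.\<Phi>_has_derivative differentiable_def differentiable_at_withinI by blast
  qed
  then have "negligible (?\<Phi> ` frontier K)"
    by (intro negligible_differentiable_image_negligible negligible_convex_frontier convex_K) auto
  moreover have "open (?\<Phi> ` interior K)" using interior_subset C.K_subset_U
      by (intro C.open_\<Phi>_image) auto
  then have "?\<Phi> ` interior K \<subseteq> interior \<kappa>"
    using elem_image[OF \<kappa>] interior_subset by (intro interior_maximal) blast+
  have "\<kappa> - interior \<kappa> \<subseteq> ?\<Phi> ` frontier K"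
  proof
    fix x assume x: "x \<in> \<kappa> - interior \<kappa>"
    then obtain z where z: "z \<in> K" "x = ?\<Phi> z" using elem_image[OF \<kappa>] by blast
    then have "z \<notin> interior K"
        using x \<open>?\<Phi> ` interior K \<subseteq> interior \<kappa>\<close> by blast
    then show "x \<in> ?\<Phi> ` frontier K" using z closed_K by (auto simp: frontier_def)
  qed
  ultimately show ?thesis by (rule negligible_subset)
qed

lemma continuous_on_basis_elem:
  assumes \<kappa>: "\<kappa> \<in> dg_elems X"
  shows "continuous_on \<kappa> (dg_basis X i \<kappa>)"
proof -
  interpret C: chart K "chart_dom \<kappa>" "dg_map X \<kappa>" by (rule chart_elem[OF \<kappa>])
  obtain p \<gamma> where rep: "\<And>i. ref_rep \<kappa> (dg_basis X i) (p i) (\<gamma> i)"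
      using ref_rep_basis[OF \<kappa>] by blast
  have sub: "\<kappa> \<subseteq> dg_map X \<kappa> ` chart_dom \<kappa>"
      using elem_image[OF \<kappa>] C.K_subset_U by blast
  have "continuous_on \<kappa> (\<lambda>x. p i (C.\<Psi> x))"
    by (rule continuous_on_compose2[OF C1_continuous continuous_on_subset[OF C.continuous_on_\<Psi> sub]])
      (use rep in \<open>auto simp: ref_rep_def\<close>)
  moreover have "dg_basis X i \<kappa> x = p i (C.\<Psi> x)" if "x \<in> \<kappa>" for x
  proof -
    obtain z where z: "z \<in> K" "x = dg_map X \<kappa> z"
        using elem_image[OF \<kappa>] \<open>x \<in> \<kappa>\<close> by blast
    then show ?thesis using rep C.\<Psi>_\<Phi> C.K_subset_U by (auto simp: ref_rep_def)
  qed
  ultimately show ?thesis by (subst continuous_on_cong[OF refl]) auto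
qed

lemma compact_elem: "\<kappa> \<in> dg_elems X \<Longrightarrow> compact \<kappa>"
  using chart.compact_\<Phi>_K[OF chart_elem] elem_image by metis

text \<open>\<open>sig_t\<close> is integrable over the open domain, which contains the element up
  to a null set; the basis functions form a bounded measurable factor.\<close>

lemma mass_integrand_integrable:
  assumes \<kappa>: "\<kappa> \<in> dg_elems X"
  shows "set_integrable lebesgue \<kappa> (\<lambda>x. sig_t X x * dg_basis X i \<kappa> x
      * dg_basis X j \<kappa> x)"
proof -
  have dom: "interior \<kappa> \<subseteq> dg_dom X" using mesh \<kappa> by (auto simp: valid_mesh_def)
  have "set_integrable lebesgue (dg_dom X) (sig_t X)"
    using opacities by (simp add: valid_opacities_def)
  then have "set_integrable lebesgue (interior \<kappa>) (sig_t X)"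
    by (rule set_integrable_subset[OF _ _ dom]) simp
  then have s: "set_integrable lebesgue \<kappa> (sig_t X)"
    by (rule set_integral_spike_subset(1)[OF _ interior_subset negligible_elem_minus_interior[OF \<kappa>]])
  have cont: "continuous_on \<kappa> (\<lambda>x. dg_basis X i \<kappa> x * dg_basis X j \<kappa> x)"
    by (intro continuous_intros continuous_on_basis_elem[OF \<kappa>])
  have meas: "\<kappa> \<in> sets lebesgue" using compact_elem[OF \<kappa>] by (simp add: borel_compact)
  have "set_integrable lebesgue \<kappa> (\<lambda>x. (dg_basis X i \<kappa> x
      * dg_basis X j \<kappa> x) * sig_t X x)"
  proof (rule absolutely_integrable_bounded_measurable_product[OF bilinear_times _ meas _ s])
    show "(\<lambda>x. dg_basis X i \<kappa> x
        * dg_basis X j \<kappa> x) \<in> borel_measurable (lebesgue_on \<kappa>)"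
      by (rule continuous_imp_measurable_on_sets_lebesgue[OF cont meas])
    show "bounded ((\<lambda>x. dg_basis X i \<kappa> x * dg_basis X j \<kappa> x) ` \<kappa>)"
      using compact_continuous_image[OF cont compact_elem[OF \<kappa>]] compact_imp_bounded by blast
  qed
  then show ?thesis by (simp add: mult_ac)
qed

lemma dg_fun_0: "dg_fun X 0 = (\<lambda>\<kappa> x. 0)"
  by (simp add: dg_fun_def)

lemma dg_fun_eq_0_iff: "dg_fun X c = (\<lambda>\<kappa> x. 0) \<longleftrightarrow> c = 0"
proof -
  have "poly_degree_le (dg_deg X) (\<lambda>z. 0)"
    unfolding poly_degree_le_def by (rule exI[of _ "\<lambda>_. 0"]) simp
  then have "(\<lambda>\<kappa> x. 0) \<in> dg_space X"
    unfolding dg_space_def by blast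
  then have "\<exists>!c. (\<lambda>\<kappa> x. 0) = dg_fun X c" using basis by (simp add: valid_basis_def)
  then show ?thesis using dg_fun_0 by metis
qed

lemma dg_fun_outside:
  assumes "\<kappa> \<notin> dg_elems X \<or> x \<notin> \<kappa>"
  shows "dg_fun X c \<kappa> x = 0"
proof -
  have "dg_basis X i \<kappa> x = 0" for i
  proof -
    have "dg_basis X i \<in> dg_space X" using basis by (simp add: valid_basis_def)
    then show ?thesis using assms by (cases "\<kappa> \<in> dg_elems X") (auto simp: dg_space_def)
  qed
  then show ?thesis by (simp add: dg_fun_def)
qed

text \<open>With a positive weight, a vanishing integral makes the function 0 almost everywhere
  inside the element. The interior points where it is not 0 form an open null set, which is empty.
  The boundary values follow because \<open>K\<close> is the closure of its interior.\<close>

lemma dg_fun_eq_0: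
  assumes zero: "\<And>\<kappa>. \<kappa> \<in> dg_elems X \<Longrightarrow>
      (LINT x:\<kappa>|lebesgue. sig_t X x * dg_fun X c \<kappa> x * dg_fun X c \<kappa> x) = 0"
    and int: "\<And>\<kappa>. \<kappa> \<in> dg_elems X \<Longrightarrow> set_integrable lebesgue
        \<kappa> (\<lambda>x. sig_t X x * dg_fun X c \<kappa> x * dg_fun X c \<kappa> x)"
  shows "c = 0"
proof -
  have "dg_fun X c \<kappa> x = 0" for \<kappa> x
  proof (cases "\<kappa> \<in> dg_elems X \<and> x \<in> \<kappa>")
    case False
    then show ?thesis using dg_fun_outside by blast
  next
    case True
    then have \<kappa>: "\<kappa> \<in> dg_elems X" and x: "x \<in> \<kappa>" by auto
    interpret C: chart K "chart_dom \<kappa>" "dg_map X \<kappa>" by (rule chart_elem[OF \<kappa>])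
    let ?u = "dg_fun X c \<kappa>" and ?\<Phi> = "dg_map X \<kappa>"
    have dom: "interior \<kappa> \<subseteq> dg_dom X" using mesh \<kappa> by (auto simp: valid_mesh_def)
    have pos: "0 < sig_t X y" if "y \<in> interior \<kappa>" for y
      using that dom opacities by (auto simp: valid_opacities_def)
    have contu: "continuous_on \<kappa> ?u"
      unfolding dg_fun_def by (intro continuous_intros continuous_on_basis_elem[OF \<kappa>])
    have inti: "set_integrable lebesgue (interior \<kappa>) (\<lambda>x. sig_t X x * ?u x * ?u x)"
      by (rule set_integrable_subset[OF int[OF \<kappa>]]) (auto simp: interior_subset)
    have "(LINT x:interior \<kappa>|lebesgue. sig_t X x * ?u x * ?u x) = 0"
      using set_integral_spike_subset(2)[OF inti interior_subset
          negligible_elem_minus_interior[OF \<kappa>]] zero[OF \<kappa>] by simp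
    moreover have "AE y in lebesgue. 0 \<le> indicator (interior \<kappa>) y *\<^sub>R (sig_t X y
        * ?u y * ?u y)"
      using pos by (intro AE_I2) (auto simp: indicator_def mult.assoc less_imp_le)
    ultimately have "AE y in lebesgue. indicator (interior \<kappa>) y *\<^sub>R (sig_t X y * ?u y
        * ?u y) = 0"
      unfolding set_lebesgue_integral_def
      using integral_nonneg_eq_0_iff_AE[OF inti[unfolded set_integrable_def]] by blast
    then have "AE y in lebesgue. y \<notin> interior \<kappa> \<inter> ?u -` (- {0})"
      by eventually_elim (use pos in \<open>fastforce simp: indicator_def\<close>)
    then have neg: "negligible (interior \<kappa> \<inter> ?u -` (- {0}))"
      unfolding negligible_iff_null_sets
    proof (subst AE_iff_null_sets)
      have "open (interior \<kappa> \<inter> ?u -` (- {0}))"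
        by (rule continuous_open_preimage[OF continuous_on_subset[OF contu interior_subset]]) auto
      then show "interior \<kappa> \<inter> ?u -` (- {0}) \<in> sets lebesgue" by (simp add: borel_open)
    qed
    have "open (interior \<kappa> \<inter> ?u -` (- {0}))"
      by (rule continuous_open_preimage[OF continuous_on_subset[OF contu interior_subset]]) auto
    then have "interior \<kappa> \<inter> ?u -` (- {0}) = {}" using neg open_not_negligible by blast
    then have zero_int: "?u y = 0" if "y \<in> interior \<kappa>" for y using that by blast
    obtain p \<gamma> where rep: "\<And>i. ref_rep \<kappa> (dg_basis X i) (p i) (\<gamma> i)"
        using ref_rep_basis[OF \<kappa>] by blast
    define q where "q = (\<lambda>z. \<Sum>i\<in>UNIV. c $ i * p i z)"
    have q: "continuous_on UNIV q" "\<And>z. z \<in> K \<Longrightarrow> ?u (?\<Phi> z) = q z"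
      using ref_rep_dg_fun[OF rep, of c] C1_continuous by (auto simp: ref_rep_def q_def)
    have "open (?\<Phi> ` interior K)" using interior_subset C.K_subset_U
        by (intro C.open_\<Phi>_image) auto
    then have sub: "?\<Phi> ` interior K \<subseteq> interior \<kappa>"
      using elem_image[OF \<kappa>] interior_subset by (intro interior_maximal) blast+
    have "q z = 0" if "z \<in> interior K" for z
      using q(2)[of z] zero_int[of "?\<Phi> z"] sub that interior_subset by force
    then have "closure (interior K) \<subseteq> {z. q z = 0}"
      using q(1) by (intro closure_minimal closed_Collect_eq continuous_on_const) auto
    then have "q z = 0" if "z \<in> K" for z
      using that convex_closure_interior[OF convex_K interior_ne] closed_K by auto
    then show ?thesis using x elem_image[OF \<kappa>] q(2) by (metis imageE)
  qed
  then show ?thesis using dg_fun_eq_0_iff by blast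
qed

text \<open>\<open>Mt\<close> is the Gram matrix of the basis for the inner product weighted by
  \<open>sig_t\<close>. If \<open>Mt X *v c = 0\<close>, then the nonnegative element contributions
  to \<open>c \<bullet> (Mt X *v c)\<close> all vanish.\<close>

lemma det_Mt: "det (Mt X) \<noteq> 0"
proof -
  have "c = 0" if c: "Mt X *v c = 0" for c
  proof -
    let ?b = "dg_basis X"
    let ?m = "\<lambda>\<kappa> i j. LINT x:\<kappa>|lebesgue. sig_t X x * ?b i \<kappa> x
        * ?b j \<kappa> x"
    have expand: "sig_t X x * dg_fun X c \<kappa> x * dg_fun X c \<kappa> x =
        (\<Sum>i\<in>UNIV. c $ i * (\<Sum>j\<in>UNIV. c $ j
            * (sig_t X x * ?b j \<kappa> x * ?b i \<kappa> x)))" for \<kappa> x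
      by (simp add: dg_fun_def sum_distrib_left sum_distrib_right mult_ac)
    have int2: "set_integrable lebesgue \<kappa> (\<lambda>x. \<Sum>j\<in>UNIV. c $ j
        * (sig_t X x * ?b j \<kappa> x * ?b i \<kappa> x))"
      if "\<kappa> \<in> dg_elems X" for \<kappa> i
      by (intro absolutely_integrable_sum set_integrable_mult_right mass_integrand_integrable[OF that]) auto
    have int: "set_integrable lebesgue \<kappa> (\<lambda>x. sig_t X x * dg_fun X c \<kappa> x
        * dg_fun X c \<kappa> x)"
      if "\<kappa> \<in> dg_elems X" for \<kappa>
      unfolding expand by (intro absolutely_integrable_sum set_integrable_mult_right int2[OF that]) auto
    have val: "(LINT x:\<kappa>|lebesgue. sig_t X x * dg_fun X c \<kappa> x * dg_fun X c \<kappa> x) =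
        (\<Sum>i\<in>UNIV. c $ i * (\<Sum>j\<in>UNIV. c $ j * ?m \<kappa> j i))"
            if "\<kappa> \<in> dg_elems X" for \<kappa>
      unfolding expand
      by (simp add: set_integral_lincomb int2[OF that] mass_integrand_integrable[OF that])
    have "(\<Sum>\<kappa>\<in>dg_elems X. LINT x:\<kappa>|lebesgue. sig_t X x
        * dg_fun X c \<kappa> x * dg_fun X c \<kappa> x) =
        (\<Sum>i\<in>UNIV. c $ i * (\<Sum>j\<in>UNIV. c $ j
            * (\<Sum>\<kappa>\<in>dg_elems X. ?m \<kappa> j i)))"
      by (simp add: val sum_distrib_left sum.swap[of _ _ "dg_elems X"] cong: sum.cong)
    also have "\<dots> = c \<bullet> (Mt X *v c)"
      by (simp add: inner_vec_def matrix_vector_mult_def mass_matrix_def form_matrix_def mult.commute)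
    finally have sum0: "(\<Sum>\<kappa>\<in>dg_elems X. LINT x:\<kappa>|lebesgue. sig_t X x
        * dg_fun X c \<kappa> x * dg_fun X c \<kappa> x) = 0"
      by (simp add: c)
    have nonneg: "0 \<le> (LINT x:\<kappa>|lebesgue. sig_t X x * dg_fun X c \<kappa> x
        * dg_fun X c \<kappa> x)"
      if \<kappa>: "\<kappa> \<in> dg_elems X" for \<kappa>
    proof -
      have inti: "set_integrable lebesgue (interior \<kappa>) (\<lambda>x. sig_t X x
          * dg_fun X c \<kappa> x * dg_fun X c \<kappa> x)"
        by (rule set_integrable_subset[OF int[OF \<kappa>]]) (auto simp: interior_subset)
      have "interior \<kappa> \<subseteq> dg_dom X" using mesh \<kappa> by (auto simp: valid_mesh_def)
      then have "0 < sig_t X y" if "y \<in> interior \<kappa>" for y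
        using that opacities by (auto simp: valid_opacities_def)
      then have "0 \<le> (LINT x:interior \<kappa>|lebesgue. sig_t X x * dg_fun X c \<kappa> x
          * dg_fun X c \<kappa> x)"
        unfolding set_lebesgue_integral_def
        by (intro Bochner_Integration.integral_nonneg) (auto simp: indicator_def mult.assoc less_imp_le)
      then show ?thesis
        using set_integral_spike_subset(2)[OF inti interior_subset
            negligible_elem_minus_interior[OF \<kappa>]] by simp
    qed
    have zero: "(LINT x:\<kappa>|lebesgue. sig_t X x * dg_fun X c \<kappa> x
        * dg_fun X c \<kappa> x) = 0" if "\<kappa> \<in> dg_elems X" for \<kappa>
      using sum0 sum_nonneg_eq_0_iff[OF finite_elems nonneg] that by simp
    show ?thesis by (rule dg_fun_eq_0[OF zero int])
  qed
  then have "inj ((*v) (Mt X))"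
    using linear_injective_0[OF matrix_vector_mul_linear] by blast
  then have "invertible (Mt X)"
    using matrix_left_invertible_injective invertible_left_inverse by blast
  then show ?thesis using invertible_det_nz by blast
qed

end

section \<open>Face integrals and integration by parts\<close>

text \<open>Products with a transpose shall keep their form and not be rewritten to products with a
  row vector, because the facts about \<open>P^T\<close> are phrased in them.\<close>

declare transpose_matrix_vector [simp del]

lemma transpose_mult: "(transpose A *v c) $ j = (\<Sum>i\<in>UNIV. c $ i * A $ i $ j)"
  for A :: "real^'n::finite^'m::finite"
  by (simp add: matrix_vector_mult_def transpose_def mult.commute)

context dg_problem
begin

section \<open>Faces and their adjacent elements\<close>

lemma ref_facet_image:
  assumes \<kappa>: "\<kappa> \<in> dg_elems X" and F: "F facet_of K"
  shows "ref_facet X \<kappa> (dg_map X \<kappa> ` F) = F"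
proof -
  interpret C: chart K "chart_dom \<kappa>" "dg_map X \<kappa>" by (rule chart_elem[OF \<kappa>])
  have "F \<subseteq> chart_dom \<kappa>" using facet_subset[OF F] C.K_subset_U by blast
  then have "dg_map X \<kappa> z \<in> dg_map X \<kappa> ` F \<longleftrightarrow> z \<in> F"
      if "z \<in> K" for z
    using inj_on_image_mem_iff[OF C.inj_\<Phi>] that C.K_subset_U by blast
  then show ?thesis using facet_subset[OF F] by (auto simp: ref_facet_def)
qed

lemma elem_face:
  assumes \<kappa>: "\<kappa> \<in> dg_elems X" and \<Gamma>: "\<Gamma> \<in> elem_faces X \<kappa>"
  shows "ref_facet X \<kappa> \<Gamma> facet_of K" and "dg_map X \<kappa> ` ref_facet X \<kappa>
      \<Gamma> = \<Gamma>" and "\<Gamma> \<subseteq> \<kappa>"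
proof -
  obtain F where F: "F facet_of K" "\<Gamma> = dg_map X \<kappa> ` F" using \<Gamma>
      by (auto simp: elem_faces_def)
  then show "ref_facet X \<kappa> \<Gamma> facet_of K" "dg_map X \<kappa> ` ref_facet X \<kappa>
      \<Gamma> = \<Gamma>"
    using ref_facet_image[OF \<kappa> F(1)] by auto
  show "\<Gamma> \<subseteq> \<kappa>" using F facet_subset[OF F(1)] elem_image[OF \<kappa>] by blast
qed

lemma finite_faces: "finite (faces X)"
proof -
  have "elem_faces X \<kappa> = (\<lambda>F. dg_map X \<kappa> ` F) ` {F. F facet_of K}" for \<kappa>
    by (auto simp: elem_faces_def)
  then show ?thesis using finite_elems finite_facets by (simp add: faces_def)
qed

lemma side:
  assumes "\<Gamma> \<in> faces X"
  shows "dg_side X \<Gamma> \<in> dg_elems X" and "\<Gamma> \<in> elem_faces X (dg_side X \<Gamma>)"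
      and "dg_side X \<Gamma> \<in> adjacent X \<Gamma>"
proof -
  show "dg_side X \<Gamma> \<in> adjacent X \<Gamma>" using mesh assms by (auto simp: valid_mesh_def)
  then show "dg_side X \<Gamma> \<in> dg_elems X" "\<Gamma> \<in> elem_faces X (dg_side X \<Gamma>)"
      by (auto simp: adjacent_def)
qed

lemma card_adjacent:
  assumes "\<Gamma> \<in> faces X"
  shows "card (adjacent X \<Gamma>) = (if boundary_face X \<Gamma> then 1 else 2)"
proof -
  have "\<forall>\<Gamma>\<in>faces X. dg_side X \<Gamma> \<in> adjacent X \<Gamma> \<and>
      card (adjacent X \<Gamma>) = (if boundary_face X \<Gamma> then 1 else 2)"
    using mesh unfolding valid_mesh_def by (elim conjE)
  from bspec[OF this assms] show ?thesis by (rule conjunct2)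
qed

lemma adjacent_boundary:
  assumes \<Gamma>: "\<Gamma> \<in> faces X" and bd: "boundary_face X \<Gamma>"
  shows "adjacent X \<Gamma> = {dg_side X \<Gamma>}"
proof -
  have "card (adjacent X \<Gamma>) = 1" using card_adjacent[OF \<Gamma>] bd by simp
  then obtain a where "adjacent X \<Gamma> = {a}" by (auto simp: card_1_singleton_iff)
  then show ?thesis using side(3)[OF \<Gamma>] by auto
qed

lemma adjacent_interior:
  assumes \<Gamma>: "\<Gamma> \<in> faces X" and bd: "\<not> boundary_face X \<Gamma>"
  shows "adjacent X \<Gamma> = {dg_side X \<Gamma>, other_side X \<Gamma>}" and "other_side X
      \<Gamma> \<noteq> dg_side X \<Gamma>"
    and "other_side X \<Gamma> \<in> dg_elems X" and "\<Gamma> \<in> elem_faces X (other_side X \<Gamma>)"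
proof -
  have "card (adjacent X \<Gamma>) = 2" using card_adjacent[OF \<Gamma>] bd by simp
  then obtain a b where ab: "adjacent X \<Gamma> = {a, b}" "a \<noteq> b" by (auto simp: card_2_iff)
  then have "dg_side X \<Gamma> = a \<or> dg_side X \<Gamma> = b" using side(3)[OF \<Gamma>] by simp
  then obtain c where c: "adjacent X \<Gamma> = {dg_side X \<Gamma>, c}" "c \<noteq> dg_side X \<Gamma>"
    using ab by (metis insert_commute)
  have "other_side X \<Gamma> = c"
    unfolding other_side_def by (rule the_equality) (use c in auto)
  then show "adjacent X \<Gamma> = {dg_side X \<Gamma>, other_side X \<Gamma>}" "other_side X
      \<Gamma> \<noteq> dg_side X \<Gamma>"
    using c by auto
  then have "other_side X \<Gamma> \<in> adjacent X \<Gamma>" by simp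
  then show "other_side X \<Gamma> \<in> dg_elems X" "\<Gamma> \<in> elem_faces X (other_side X \<Gamma>)"
    by (auto simp: adjacent_def)
qed

section \<open>Face integrals in reference coordinates\<close>

definition side_facet :: "(real^'n) set \<Rightarrow> (real^'n) set" where
  "side_facet \<Gamma> = ref_facet X (dg_side X \<Gamma>) \<Gamma>"

definition side_map :: "(real^'n) set \<Rightarrow> real^'n \<Rightarrow> real^'n" where
  "side_map \<Gamma> = dg_map X (dg_side X \<Gamma>)"

text \<open>Continuity is required in the parametrization from \<open>dg_side\<close>, the one that
  defines \<open>face_integral\<close>; there it yields integrability.\<close>

definition face_continuous :: "(real^'n) set \<Rightarrow> (real^'n \<Rightarrow> real)
    \<Rightarrow> bool" where
  "face_continuous \<Gamma> f \<longleftrightarrow> continuous_on (side_facet \<Gamma>)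
      (\<lambda>z. f (side_map \<Gamma> z))"

lemma face_continuous_intros:
  "face_continuous \<Gamma> f \<Longrightarrow> face_continuous \<Gamma> g \<Longrightarrow>
      face_continuous \<Gamma> (\<lambda>x. f x * g x)"
  "face_continuous \<Gamma> f \<Longrightarrow> face_continuous \<Gamma> g \<Longrightarrow>
      face_continuous \<Gamma> (\<lambda>x. f x + g x)"
  "face_continuous \<Gamma> f \<Longrightarrow> face_continuous \<Gamma> g \<Longrightarrow>
      face_continuous \<Gamma> (\<lambda>x. f x - g x)"
  "face_continuous \<Gamma> f \<Longrightarrow> face_continuous \<Gamma> (\<lambda>x. \<bar>f x\<bar>)"
  "face_continuous \<Gamma> f \<Longrightarrow> face_continuous \<Gamma> (\<lambda>x. f x / 2)"
  "(\<And>i. i \<in> I \<Longrightarrow> face_continuous \<Gamma> (h i)) \<Longrightarrow>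
      face_continuous \<Gamma> (\<lambda>x. \<Sum>i\<in>I. c i * h i x)"
  unfolding face_continuous_def by (auto intro!: continuous_intros)

context
  fixes \<Gamma> assumes \<Gamma>: "\<Gamma> \<in> faces X"
begin

lemma side_facet: "side_facet \<Gamma> facet_of K" and side_map_image: "side_map \<Gamma> `
    side_facet \<Gamma> = \<Gamma>"
  unfolding side_facet_def side_map_def using elem_face side \<Gamma> by auto

lemma side_facet_mem: "z \<in> side_facet \<Gamma> \<Longrightarrow> z \<in> chart_dom
    (dg_side X \<Gamma>)" "z \<in> side_facet \<Gamma> \<Longrightarrow> z \<in> K"
  using facet_subset[OF side_facet] chart.K_subset_U[OF chart_elem[OF side(1)[OF \<Gamma>]]] by auto

lemma face_normal_side_map:
  assumes z: "z \<in> side_facet \<Gamma>"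
  shows "face_normal X \<Gamma> (side_map \<Gamma> z) =
    conormal X (dg_side X \<Gamma>) \<Gamma> z /\<^sub>R norm (conormal X (dg_side X \<Gamma>) \<Gamma> z)"
proof -
  have "inj_on (side_map \<Gamma>) K"
    using chart.inj_\<Phi>[OF chart_elem[OF side(1)[OF \<Gamma>]]]
        chart.K_subset_U[OF chart_elem[OF side(1)[OF \<Gamma>]]]
    by (simp add: side_map_def inj_on_subset)
  then have "inv_into K (side_map \<Gamma>) (side_map \<Gamma> z) = z"
    using side_facet_mem(2)[OF z] by (rule inv_into_f_f)
  then show ?thesis by (simp add: face_normal_def Let_def side_map_def)
qed

lemma conormal_inner:
  assumes z: "z \<in> side_facet \<Gamma>"
  shows "\<bar>det (jacobian (side_map \<Gamma>) (at z))\<bar>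
      * (conormal X (dg_side X \<Gamma>) \<Gamma> z \<bullet> e) =
    facet_normal K (side_facet \<Gamma>) \<bullet> pb (dg_side X \<Gamma>) e z"
proof -
  interpret C: chart K "chart_dom (dg_side X \<Gamma>)" "dg_map X (dg_side X \<Gamma>)"
    by (rule chart_elem[OF side(1)[OF \<Gamma>]])
  show ?thesis
    using inner_matrix_inv_transpose[OF C.det_J[OF side_facet_mem(1)[OF z]]]
    by (simp add: C.pullback_def conormal_def side_map_def side_facet_def)
qed

lemma conormal_nonzero:
  assumes z: "z \<in> side_facet \<Gamma>"
  shows "conormal X (dg_side X \<Gamma>) \<Gamma> z \<noteq> 0"
proof
  interpret C: chart K "chart_dom (dg_side X \<Gamma>)" "dg_map X (dg_side X \<Gamma>)"
    by (rule chart_elem[OF side(1)[OF \<Gamma>]])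
  let ?a = "facet_normal K (side_facet \<Gamma>)"
  assume "conormal X (dg_side X \<Gamma>) \<Gamma> z = 0"
  \<comment> \<open>The tested direction is the one whose pullback is a nonzero multiple of
    \<open>?a\<close>.\<close>
  then have "?a \<bullet> pb (dg_side X \<Gamma>) (C.J z *v ?a) z = 0"
    unfolding conormal_inner[OF z, symmetric] by simp
  then show False
    using normal_inner_self[OF side_facet] C.det_J[OF side_facet_mem(1)[OF z]]
      matrix_inv_vector_mult(2)[OF C.det_J[OF side_facet_mem(1)[OF z]]]
    by (simp add: C.pullback_def)
qed

lemma continuous_on_side_jacobian: "continuous_on (side_facet \<Gamma>)
    (\<lambda>z. jacobian (side_map \<Gamma>) (at z))"
  using chart.continuous_on_J[OF chart_elem[OF side(1)[OF \<Gamma>]]] side_facet_mem(1)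
  unfolding side_map_def by (rule continuous_on_subset[OF _ subsetI])

lemma continuous_on_conormal: "continuous_on (side_facet \<Gamma>)
    (conormal X (dg_side X \<Gamma>) \<Gamma>)"
proof -
  have "det (transpose (jacobian (side_map \<Gamma>) (at z))) \<noteq> 0"
      if "z \<in> side_facet \<Gamma>" for z
    using chart.det_J[OF chart_elem[OF side(1)[OF \<Gamma>]] side_facet_mem(1)[OF that]]
    by (simp add: det_transpose side_map_def)
  then show ?thesis
    unfolding conormal_def side_map_def[symmetric]
    by (intro continuous_intros continuous_on_side_jacobian)
qed

lemma face_integral_eq:
  "face_integral X \<Gamma> f = facet_integral K (side_facet \<Gamma>)
     (\<lambda>z. f (side_map \<Gamma> z) * (\<bar>det (jacobian (side_map \<Gamma>) (at z))\<bar>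
         * norm (conormal X (dg_side X \<Gamma>) \<Gamma> z)))"
  by (simp add: face_integral_def Let_def side_facet_def side_map_def)

lemma face_integral_cong:
  assumes "\<And>x. x \<in> \<Gamma> \<Longrightarrow> f x = g x"
  shows "face_integral X \<Gamma> f = face_integral X \<Gamma> g"
  unfolding face_integral_eq
  by (rule facet_integral_cong[OF side_facet]) (use assms side_map_image in auto)

lemma face_integral_0:
  assumes "\<And>x. x \<in> \<Gamma> \<Longrightarrow> f x = 0"
  shows "face_integral X \<Gamma> f = 0"
proof -
  have "face_integral X \<Gamma> f = face_integral X \<Gamma> (\<lambda>x. 0)"
      by (rule face_integral_cong) (rule assms)
  then show ?thesis by (simp add: face_integral_eq facet_integral_foot[OF side_facet])
qed

lemma face_integral_lincomb:
  assumes "\<And>i. i \<in> I \<Longrightarrow> face_continuous \<Gamma> (f i)"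
  shows "face_integral X \<Gamma> (\<lambda>x. \<Sum>i\<in>I. c i * f i x)
      = (\<Sum>i\<in>I. c i * face_integral X \<Gamma> (f i))"
  unfolding face_integral_eq sum_distrib_right mult.assoc
proof (rule facet_integral_lincomb[OF side_facet])
  fix i assume "i \<in> I"
  then show "continuous_on (side_facet \<Gamma>) (\<lambda>z. f i (side_map \<Gamma> z) *
      (\<bar>det (jacobian (side_map \<Gamma>) (at z))\<bar>
          * norm (conormal X (dg_side X \<Gamma>) \<Gamma> z)))"
    using assms unfolding face_continuous_def
    by (intro continuous_intros continuous_on_conormal continuous_on_side_jacobian)
qed

text \<open>The norm of the conormal in the surface element cancels the normalization of the face
  normal. What remains is the flux on the reference facet that occurs in the divergence
  theorem.\<close>

lemma face_integral_normal:
  "face_integral X \<Gamma> (\<lambda>x. (e \<bullet> face_normal X \<Gamma> x) * h x)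
      = facet_integral K (side_facet \<Gamma>)
     (\<lambda>z. h (side_map \<Gamma> z) * (facet_normal K (side_facet \<Gamma>) \<bullet> pb
         (dg_side X \<Gamma>) e z))"
  unfolding face_integral_eq
proof (rule facet_integral_cong[OF side_facet])
  fix z assume z: "z \<in> side_facet \<Gamma>"
  let ?\<nu> = "conormal X (dg_side X \<Gamma>) \<Gamma> z"
  have "norm ?\<nu> \<noteq> 0" using conormal_nonzero[OF z] by simp
  then have "?\<nu> \<bullet> e = (e \<bullet> face_normal X \<Gamma> (side_map \<Gamma> z)) * norm ?\<nu>"
    by (simp add: face_normal_side_map[OF z] inner_commute)
  then have "(e \<bullet> face_normal X \<Gamma> (side_map \<Gamma> z)) * h (side_map \<Gamma> z) *
      (\<bar>det (jacobian (side_map \<Gamma>) (at z))\<bar> * norm ?\<nu>) =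
      h (side_map \<Gamma> z) * (\<bar>det (jacobian (side_map \<Gamma>) (at z))\<bar>
          * (?\<nu> \<bullet> e))"
    by simp
  then show "(e \<bullet> face_normal X \<Gamma> (side_map \<Gamma> z)) * h (side_map \<Gamma> z) *
      (\<bar>det (jacobian (side_map \<Gamma>) (at z))\<bar> * norm ?\<nu>) =
      h (side_map \<Gamma> z) * (facet_normal K (side_facet \<Gamma>) \<bullet> pb
          (dg_side X \<Gamma>) e z)"
    by (simp add: conormal_inner[OF z])
qed

lemma face_continuous_normal: "face_continuous \<Gamma> (\<lambda>x. e \<bullet> face_normal X \<Gamma> x)"
proof -
  let ?\<nu> = "conormal X (dg_side X \<Gamma>) \<Gamma>"
  have "continuous_on (side_facet \<Gamma>) (\<lambda>z. e \<bullet> (?\<nu> z /\<^sub>R norm (?\<nu> z)))"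
    using conormal_nonzero by (intro continuous_intros continuous_on_conormal) auto
  then show ?thesis
    unfolding face_continuous_def
    by (subst continuous_on_cong[OF refl]) (auto simp: face_normal_side_map)
qed

lemma face_continuous_trace:
  assumes \<kappa>: "\<kappa> \<in> dg_elems X" and "\<Gamma> \<in> elem_faces X \<kappa>"
  shows "face_continuous \<Gamma> (dg_basis X i \<kappa>)"
  unfolding face_continuous_def
proof (rule continuous_on_compose2[OF continuous_on_basis_elem[OF \<kappa>]])
  show "continuous_on (side_facet \<Gamma>) (side_map \<Gamma>)"
    using chart.continuous_on_\<Phi>[OF chart_elem[OF side(1)[OF \<Gamma>]]] side_facet_mem(1)
    unfolding side_map_def by (rule continuous_on_subset[OF _ subsetI])
  show "side_map \<Gamma> ` side_facet \<Gamma> \<subseteq> \<kappa>"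
      using elem_face(3)[OF assms] side_map_image by simp
qed

end

section \<open>Bilinear forms in jumps and averages\<close>

definition trace_op :: "('n piecewise \<Rightarrow> (real^'n) set \<Rightarrow> real^'n
    \<Rightarrow> real) \<Rightarrow> bool" where
  "trace_op T \<longleftrightarrow> (\<forall>c \<Gamma> x. T (dg_fun X c) \<Gamma> x
      = (\<Sum>i\<in>UNIV. c $ i * T (dg_basis X i) \<Gamma> x)) \<and>
     (\<forall>\<Gamma>\<in>faces X. \<forall>i. face_continuous \<Gamma> (T (dg_basis X i) \<Gamma>))"

lemma trace_op_jump: "trace_op (jump X)"
  unfolding trace_op_def
proof (intro conjI allI ballI)
  show "jump X (dg_fun X c) \<Gamma> x = (\<Sum>i\<in>UNIV. c $ i
      * jump X (dg_basis X i) \<Gamma> x)" for c \<Gamma> x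
    by (simp add: jump_def dg_fun_def sum_subtractf right_diff_distrib)
  fix \<Gamma> i assume \<Gamma>: "\<Gamma> \<in> faces X"
  show "face_continuous \<Gamma> (jump X (dg_basis X i) \<Gamma>)"
    unfolding jump_def
    using side[OF \<Gamma>] adjacent_interior[OF \<Gamma>]
    by (cases "boundary_face X \<Gamma>") (auto intro!: face_continuous_intros
        face_continuous_trace[OF \<Gamma>])
qed

lemma trace_op_avg: "trace_op (avg X)"
  unfolding trace_op_def
proof (intro conjI allI ballI)
  show "avg X (dg_fun X c) \<Gamma> x = (\<Sum>i\<in>UNIV. c $ i * avg X (dg_basis X i) \<Gamma> x)"
      for c \<Gamma> x
    by (simp add: avg_def dg_fun_def sum.distrib[symmetric] sum_divide_distrib distrib_left)
  fix \<Gamma> i assume \<Gamma>: "\<Gamma> \<in> faces X"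
  show "face_continuous \<Gamma> (avg X (dg_basis X i) \<Gamma>)"
    unfolding avg_def
    using side[OF \<Gamma>] adjacent_interior[OF \<Gamma>]
    by (cases "boundary_face X \<Gamma>") (auto intro!: face_continuous_intros
        face_continuous_trace[OF \<Gamma>])
qed

definition face_form ::
  "((real^'n) set \<Rightarrow> real^'n \<Rightarrow> real) \<Rightarrow>
      ((real^'n) set \<Rightarrow> real^'n \<Rightarrow> real) \<Rightarrow>
      ((real^'n) set \<Rightarrow> real^'n \<Rightarrow> real) \<Rightarrow> real" where
  "face_form \<omega> s t = (\<Sum>\<Gamma>\<in>faces X. face_integral X \<Gamma>
      (\<lambda>x. \<omega> \<Gamma> x * s \<Gamma> x * t \<Gamma> x))"

text \<open>Linearity is proved for abstract trace operators, so that the pairings of jumps and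
  averages in both face matrices are covered at once.\<close>

lemma face_form_left:
  assumes \<omega>: "\<And>\<Gamma>. \<Gamma> \<in> faces X \<Longrightarrow> face_continuous
      \<Gamma> (\<omega> \<Gamma>)" and T: "trace_op T" and T': "trace_op T'"
  shows "face_form \<omega> (T (dg_fun X c)) (T' (dg_basis X j)) =
    (\<Sum>i\<in>UNIV. c $ i * face_form \<omega> (T (dg_basis X i)) (T' (dg_basis X j)))"
proof -
  have "face_integral X \<Gamma> (\<lambda>x. \<omega> \<Gamma> x * T (dg_fun X c) \<Gamma> x
      * T' (dg_basis X j) \<Gamma> x) =
      (\<Sum>i\<in>UNIV. c $ i * face_integral X \<Gamma> (\<lambda>x. \<omega> \<Gamma> x
          * T (dg_basis X i) \<Gamma> x * T' (dg_basis X j) \<Gamma> x))"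
    if \<Gamma>: "\<Gamma> \<in> faces X" for \<Gamma>
  proof -
    have "(\<lambda>x. \<omega> \<Gamma> x * T (dg_fun X c) \<Gamma> x * T' (dg_basis X j) \<Gamma> x) =
        (\<lambda>x. \<Sum>i\<in>UNIV. c $ i * (\<omega> \<Gamma> x * T (dg_basis X i) \<Gamma> x
            * T' (dg_basis X j) \<Gamma> x))"
      using T by (simp add: trace_op_def sum_distrib_left sum_distrib_right mult_ac)
    then show ?thesis
      using T T' \<Gamma> by (simp add: face_integral_lincomb[OF \<Gamma>] face_continuous_intros
          \<omega> trace_op_def)
  qed
  then show ?thesis
    by (simp add: face_form_def sum_distrib_left sum.swap[of _ _ "faces X"] cong: sum.cong)
qed

lemma face_form_commute: "face_form \<omega> s t = face_form \<omega> t s"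
  by (simp add: face_form_def mult_ac)

lemma face_form_right:
  assumes \<omega>: "\<And>\<Gamma>. \<Gamma> \<in> faces X \<Longrightarrow> face_continuous
      \<Gamma> (\<omega> \<Gamma>)" and T: "trace_op T" and T': "trace_op T'"
  shows "face_form \<omega> (T (dg_basis X j)) (T' (dg_fun X c)) =
    (\<Sum>i\<in>UNIV. c $ i * face_form \<omega> (T (dg_basis X j)) (T' (dg_basis X i)))"
  using face_form_left[OF \<omega> T' T, of c j] by (simp add: face_form_commute)

lemma face_form_0:
  assumes "\<And>\<Gamma> x. \<Gamma> \<in> faces X \<Longrightarrow> x \<in> \<Gamma>
      \<Longrightarrow> s \<Gamma> x = 0 \<or> t \<Gamma> x = 0"
  shows "face_form \<omega> s t = 0"
  unfolding face_form_def by (rule sum.neutral) (use assms in \<open>auto intro!: face_integral_0\<close>)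

definition n_wt :: "nat \<Rightarrow> (real^'n) set \<Rightarrow> real^'n \<Rightarrow> real" where
  "n_wt d \<Gamma> x = sdir X d \<bullet> face_normal X \<Gamma> x"

definition abs_wt :: "nat \<Rightarrow> (real^'n) set \<Rightarrow> real^'n \<Rightarrow> real" where
  "abs_wt d \<Gamma> x = \<bar>sdir X d \<bullet> face_normal X \<Gamma> x\<bar>"

lemma face_continuous_wt:
  assumes "\<Gamma> \<in> faces X"
  shows "face_continuous \<Gamma> (n_wt d \<Gamma>)" "face_continuous \<Gamma> (abs_wt d \<Gamma>)"
  unfolding n_wt_def abs_wt_def
  by (intro face_continuous_intros face_continuous_normal[OF assms])+

lemma F_mat_entry:
  "F_mat X d $ i $ j = - face_form (n_wt d) (jump X (dg_basis X j)) (avg X (dg_basis X i))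
    + 1/2 * face_form (abs_wt d) (jump X (dg_basis X j)) (jump X (dg_basis X i))"
  by (simp add: F_mat_def form_matrix_def face_form_def n_wt_def abs_wt_def)

lemma Ft_mat_entry:
  "Ft_mat X d $ i $ j = face_form (n_wt d) (avg X (dg_basis X j)) (jump X (dg_basis X i))
    + 1/2 * face_form (abs_wt d) (jump X (dg_basis X j)) (jump X (dg_basis X i))"
  by (simp add: Ft_mat_def form_matrix_def face_form_def n_wt_def abs_wt_def)

lemma F_mat_mult:
  "(F_mat X d *v c) $ i = - face_form (n_wt d) (jump X (dg_fun X c)) (avg X (dg_basis X i))
    + 1/2 * face_form (abs_wt d) (jump X (dg_fun X c)) (jump X (dg_basis X i))"
proof -
  have "(F_mat X d *v c) $ i = (\<Sum>j\<in>UNIV. c $ j * F_mat X d $ i $ j)"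
    by (simp add: matrix_vector_mult_def mult.commute)
  also have "\<dots> = - (\<Sum>j\<in>UNIV. c $ j
      * face_form (n_wt d) (jump X (dg_basis X j)) (avg X (dg_basis X i)))
    + 1/2 * (\<Sum>j\<in>UNIV. c $ j * face_form (abs_wt d) (jump X (dg_basis X j))
        (jump X (dg_basis X i)))"
    by (simp add: F_mat_entry sum.distrib sum_negf sum_divide_distrib distrib_left
        right_diff_distrib sum_subtractf)
  also have "\<dots> = - face_form (n_wt d) (jump X (dg_fun X c)) (avg X (dg_basis X i))
    + 1/2 * face_form (abs_wt d) (jump X (dg_fun X c)) (jump X (dg_basis X i))"
    by (simp only: face_form_left[OF face_continuous_wt(1) trace_op_jump trace_op_avg]
        face_form_left[OF face_continuous_wt(2) trace_op_jump trace_op_jump])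
  finally show ?thesis .
qed

text \<open>Transposition puts \<open>dg_fun X c\<close> into the place of the test function, where
  the range of \<open>P\<close> enters through \<open>P^T\<close>.\<close>

lemma F_mat_transpose_mult:
  "(transpose (F_mat X d) *v c) $ j = - face_form (n_wt d) (jump X (dg_basis X j)) (avg X (dg_fun X c))
    + 1/2 * face_form (abs_wt d) (jump X (dg_basis X j)) (jump X (dg_fun X c))"
proof -
  have "(transpose (F_mat X d) *v c) $ j =
      - (\<Sum>i\<in>UNIV. c $ i * face_form (n_wt d) (jump X (dg_basis X j)) (avg X (dg_basis X i)))
    + 1/2 * (\<Sum>i\<in>UNIV. c $ i * face_form (abs_wt d) (jump X (dg_basis X j))
        (jump X (dg_basis X i)))"
    by (simp add: transpose_mult F_mat_entry sum.distrib sum_negf sum_divide_distrib distrib_left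
        right_diff_distrib sum_subtractf)
  also have "\<dots> = - face_form (n_wt d) (jump X (dg_basis X j)) (avg X (dg_fun X c))
    + 1/2 * face_form (abs_wt d) (jump X (dg_basis X j)) (jump X (dg_fun X c))"
    by (simp only: face_form_right[OF face_continuous_wt(1) trace_op_jump trace_op_avg]
        face_form_right[OF face_continuous_wt(2) trace_op_jump trace_op_jump])
  finally show ?thesis .
qed

lemma Ft_mat_transpose_mult:
  "(transpose (Ft_mat X d) *v c) $ j = face_form (n_wt d) (avg X (dg_basis X j)) (jump X (dg_fun X c))
    + 1/2 * face_form (abs_wt d) (jump X (dg_basis X j)) (jump X (dg_fun X c))"
proof -
  have "(transpose (Ft_mat X d) *v c) $ j =
      (\<Sum>i\<in>UNIV. c $ i * face_form (n_wt d) (avg X (dg_basis X j)) (jump X (dg_basis X i)))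
    + 1/2 * (\<Sum>i\<in>UNIV. c $ i * face_form (abs_wt d) (jump X (dg_basis X j))
        (jump X (dg_basis X i)))"
    by (simp add: transpose_mult Ft_mat_entry sum.distrib sum_divide_distrib distrib_left)
  also have "\<dots> = face_form (n_wt d) (avg X (dg_basis X j)) (jump X (dg_fun X c))
    + 1/2 * face_form (abs_wt d) (jump X (dg_basis X j)) (jump X (dg_fun X c))"
    by (simp only: face_form_right[OF face_continuous_wt(1) trace_op_avg trace_op_jump]
        face_form_right[OF face_continuous_wt(2) trace_op_jump trace_op_jump])
  finally show ?thesis .
qed

section \<open>Traces of continuous functions with zero boundary values\<close>

context
  fixes c :: "real^'N"
  assumes c: "dg_fun X c \<in> continuous_zero_bdry X"
begin

lemma continuous_traces:
  obtains g where "\<And>\<kappa> x. \<kappa> \<in> dg_elems X \<Longrightarrow> x \<in> \<kappa>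
      \<Longrightarrow> dg_fun X c \<kappa> x = g x"
    "\<And>x. x \<in> frontier (dg_dom X) \<Longrightarrow> g x = 0"
  using c by (auto simp: continuous_zero_bdry_def)

lemma jump_continuous:
  assumes \<Gamma>: "\<Gamma> \<in> faces X" and x: "x \<in> \<Gamma>"
  shows "jump X (dg_fun X c) \<Gamma> x = 0"
proof -
  obtain g where g: "\<And>\<kappa> x. \<kappa> \<in> dg_elems X \<Longrightarrow> x \<in> \<kappa>
      \<Longrightarrow> dg_fun X c \<kappa> x = g x"
    "\<And>x. x \<in> frontier (dg_dom X) \<Longrightarrow> g x = 0" using continuous_traces by blast
  have s: "dg_fun X c (dg_side X \<Gamma>) x = g x"
    using g(1)[OF side(1)[OF \<Gamma>]] elem_face(3)[OF side(1,2)[OF \<Gamma>]] x by blast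
  show ?thesis
  proof (cases "boundary_face X \<Gamma>")
    case True
    then have "x \<in> frontier (dg_dom X)" using x by (auto simp: boundary_face_def)
    then show ?thesis using True s g(2) by (simp add: jump_def)
  next
    case False
    have "dg_fun X c (other_side X \<Gamma>) x = g x"
      using g(1)[OF adjacent_interior(3)[OF \<Gamma> False]]
          elem_face(3)[OF adjacent_interior(3,4)[OF \<Gamma> False]] x
      by blast
    then show ?thesis using False s by (simp add: jump_def)
  qed
qed

lemma F_mat_continuous: "F_mat X d *v c = 0"
  by (simp add: vec_eq_iff F_mat_mult face_form_0 jump_continuous)

text \<open>Every term of the form contains the jump of the test function. This removes the
  \<open>Ft1\<close> term of \<open>D0\<close> under \<open>P^T\<close>.\<close>

lemma Ft_mat_continuous: "transpose (Ft_mat X d) *v c = 0"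
  by (simp add: vec_eq_iff Ft_mat_transpose_mult face_form_0 jump_continuous)

text \<open>The average of a continuous test function survives; this remainder is what integration
  by parts cancels.\<close>

lemma F_mat_transpose_continuous:
  "(transpose (F_mat X d) *v c) $ j = - face_form (n_wt d) (jump X (dg_basis X j)) (avg X (dg_fun X c))"
  by (simp add: F_mat_transpose_mult face_form_0[of "jump X (dg_basis X j)" "jump X (dg_fun X c)"]
      jump_continuous)

end

lemma weighted_directions: "(\<Sum>d=1..q_num X. q_wt X d *\<^sub>R sdir X d) = 0"
proof -
  have "(\<Sum>d=1..q_num X. q_wt X d *\<^sub>R q_dir X d) = 0"
    using quadrature by (simp add: valid_quadrature_def)
  then have "(\<Sum>d=1..q_num X. q_wt X d *\<^sub>R q_dir X d) $ k = 0" for k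
    by (simp del: One_nat_def)
  then show ?thesis by (simp add: vec_eq_iff sdir_def del: One_nat_def)
qed

lemma face_continuous_trace_dg_fun:
  assumes "trace_op T" "\<Gamma> \<in> faces X"
  shows "face_continuous \<Gamma> (T (dg_fun X c) \<Gamma>)"
proof -
  have "T (dg_fun X c) \<Gamma> = (\<lambda>x. \<Sum>i\<in>UNIV. c $ i * T (dg_basis X i) \<Gamma> x)"
    using assms by (auto simp: trace_op_def)
  then show ?thesis using assms by (auto intro!: face_continuous_intros simp: trace_op_def)
qed

text \<open>For one direction the average term survives, but it is linear in the direction and so
  vanishes in the quadrature sum, the first moment being 0.\<close>

lemma F0_transpose_continuous:
  assumes c: "dg_fun X c \<in> continuous_zero_bdry X"
  shows "transpose (F0 X) *v c = 0"
proof -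
  let ?J = "\<lambda>j. jump X (dg_basis X j)" and ?A = "avg X (dg_fun X c)"
  have fi: "(\<Sum>d=1..q_num X. q_wt X d * face_integral X \<Gamma> (\<lambda>x. n_wt d \<Gamma> x
      * ?J j \<Gamma> x * ?A \<Gamma> x)) = 0"
    if \<Gamma>: "\<Gamma> \<in> faces X" for \<Gamma> j
  proof -
    have "(\<Sum>d=1..q_num X. q_wt X d * face_integral X \<Gamma> (\<lambda>x. n_wt d \<Gamma> x
        * ?J j \<Gamma> x * ?A \<Gamma> x)) =
        face_integral X \<Gamma> (\<lambda>x. \<Sum>d=1..q_num X. q_wt X d
            * (n_wt d \<Gamma> x * ?J j \<Gamma> x * ?A \<Gamma> x))"
    proof (rule face_integral_lincomb[OF \<Gamma>, symmetric])
      have "face_continuous \<Gamma> (?J j \<Gamma>)" using trace_op_jump \<Gamma>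
          by (simp add: trace_op_def)
      then show "face_continuous \<Gamma> (\<lambda>x. n_wt d \<Gamma> x * ?J j \<Gamma> x
          * ?A \<Gamma> x)" for d
        by (intro face_continuous_intros(1) face_continuous_wt(1)[OF \<Gamma>]
            face_continuous_trace_dg_fun[OF trace_op_avg \<Gamma>])
    qed
    also have "\<dots> = 0"
    proof (rule face_integral_0[OF \<Gamma>])
      fix x
      have "(\<Sum>d=1..q_num X. q_wt X d * n_wt d \<Gamma> x)
          = (\<Sum>d=1..q_num X. q_wt X d *\<^sub>R sdir X d) \<bullet> face_normal X \<Gamma> x"
        by (simp add: n_wt_def inner_sum_left)
      also have "\<dots> = 0" unfolding weighted_directions by simp
      finally have "(\<Sum>d=1..q_num X. q_wt X d * n_wt d \<Gamma> x) = 0" .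
      then show "(\<Sum>d=1..q_num X. q_wt X d * (n_wt d \<Gamma> x * ?J j \<Gamma> x * ?A \<Gamma> x)) = 0"
        by (simp add: mult.assoc[symmetric] sum_distrib_right[symmetric])
    qed
    finally show ?thesis .
  qed
  have ff: "(\<Sum>d=1..q_num X. q_wt X d * face_form (n_wt d) (?J j) ?A) = 0" for j
    unfolding face_form_def sum_distrib_left
    by (subst sum.swap) (simp add: fi del: One_nat_def)
  have "(transpose (F0 X) *v c) $ j = 0" for j
  proof -
    have "(transpose (F0 X) *v c) $ j =
        (\<Sum>i\<in>UNIV. c $ i * (1 / (4 * pi) * (\<Sum>d=1..q_num X. q_wt X d * F_mat X d $ i $ j)))"
      by (simp add: transpose_mult F0_def del: One_nat_def)
    also have "\<dots> = (\<Sum>i\<in>UNIV. \<Sum>d=1..q_num X. 1 / (4 * pi)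
        * (q_wt X d * (c $ i * F_mat X d $ i $ j)))"
      by (simp only: sum_distrib_left mult_ac)
    also have "\<dots> = (\<Sum>d=1..q_num X. \<Sum>i\<in>UNIV. 1 / (4 * pi)
        * (q_wt X d * (c $ i * F_mat X d $ i $ j)))"
      by (rule sum.swap)
    also have "\<dots> = 1 / (4 * pi) * (\<Sum>d=1..q_num X. q_wt X d * (transpose (F_mat X d) *v c) $ j)"
      by (simp only: transpose_mult sum_distrib_left mult_ac)
    also have "\<dots> = 0"
      using ff[of j] by (simp add: F_mat_transpose_continuous[OF c] sum_negf del: One_nat_def)
    finally show ?thesis .
  qed
  then show ?thesis by (simp add: vec_eq_iff)
qed

section \<open>Integration by parts for the transport matrices\<close>

lemma dir_G_entry:
  "dir_G X d $ i $ j = (\<Sum>\<kappa>\<in>dg_elems X. vol_form (sdir X d) \<kappa> (dg_basis X j)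
      (dg_basis X i))"
proof -
  have "dir_G X d $ i $ j =
      (\<Sum>k\<in>UNIV. sdir X d $ k * (\<Sum>\<kappa>\<in>dg_elems X. vol_form (axis k 1) \<kappa>
          (dg_basis X j) (dg_basis X i)))"
    by (simp add: dir_G_def G_mat_def form_matrix_def vol_form_def)
  also have "\<dots> = (\<Sum>\<kappa>\<in>dg_elems X. \<Sum>k\<in>UNIV. sdir X d $ k
      * vol_form (axis k 1) \<kappa> (dg_basis X j) (dg_basis X i))"
    unfolding sum_distrib_left by (rule sum.swap)
  finally show ?thesis by (simp add: vol_form_direction)
qed

lemma dir_G_mult:
  "(dir_G X d *v c) $ j = (\<Sum>\<kappa>\<in>dg_elems X. vol_form (sdir X d) \<kappa> (dg_fun X c)
      (dg_basis X j))"
proof -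
  have "(dir_G X d *v c) $ j = (\<Sum>i\<in>UNIV. c $ i
      * (\<Sum>\<kappa>\<in>dg_elems X. vol_form (sdir X d) \<kappa> (dg_basis X i) (dg_basis X j)))"
    by (simp add: matrix_vector_mult_def dir_G_entry mult.commute)
  also have "\<dots> = (\<Sum>\<kappa>\<in>dg_elems X. \<Sum>i\<in>UNIV. c $ i
      * vol_form (sdir X d) \<kappa> (dg_basis X i) (dg_basis X j))"
    unfolding sum_distrib_left by (rule sum.swap)
  finally show ?thesis by (simp add: vol_form_left)
qed

lemma dir_G_transpose_mult:
  "(transpose (dir_G X d) *v c) $ j = (\<Sum>\<kappa>\<in>dg_elems X. vol_form (sdir X d) \<kappa>
      (dg_basis X j) (dg_fun X c))"
proof -
  have "(transpose (dir_G X d) *v c) $ j = (\<Sum>i\<in>UNIV. c $ i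
      * (\<Sum>\<kappa>\<in>dg_elems X. vol_form (sdir X d) \<kappa> (dg_basis X j) (dg_basis X i)))"
    by (simp add: transpose_mult dir_G_entry)
  also have "\<dots> = (\<Sum>\<kappa>\<in>dg_elems X. \<Sum>i\<in>UNIV. c $ i
      * vol_form (sdir X d) \<kappa> (dg_basis X j) (dg_basis X i))"
    unfolding sum_distrib_left by (rule sum.swap)
  finally show ?thesis by (simp add: vol_form_right)
qed

text \<open>The flux is taken with the outward normal of \<open>\<kappa>\<close>, not with the fixed
  normal of the face.\<close>

definition face_flux :: "real^'n \<Rightarrow> (real^'n \<Rightarrow> real) \<Rightarrow> (real^'n)
    set \<Rightarrow> (real^'n) set \<Rightarrow> real" where
  "face_flux e f \<kappa> \<Gamma> = facet_integral K (ref_facet X \<kappa> \<Gamma>)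
     (\<lambda>z. f (dg_map X \<kappa> z) * (facet_normal K (ref_facet X \<kappa> \<Gamma>)
         \<bullet> pb \<kappa> e z))"

lemma face_flux_cong:
  assumes "\<kappa> \<in> dg_elems X" "\<Gamma> \<in> elem_faces X \<kappa>" "\<And>x. x \<in>
      \<Gamma> \<Longrightarrow> f x = g x"
  shows "face_flux e f \<kappa> \<Gamma> = face_flux e g \<kappa> \<Gamma>"
  unfolding face_flux_def
proof (rule facet_integral_cong[OF elem_face(1)[OF assms(1,2)]])
  fix z assume "z \<in> ref_facet X \<kappa> \<Gamma>"
  then have "dg_map X \<kappa> z \<in> \<Gamma>" using elem_face(2)[OF assms(1,2)] by blast
  then show "f (dg_map X \<kappa> z) * (facet_normal K (ref_facet X \<kappa> \<Gamma>) \<bullet> pb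
      \<kappa> e z) =
      g (dg_map X \<kappa> z) * (facet_normal K (ref_facet X \<kappa> \<Gamma>) \<bullet> pb \<kappa> e z)"
    using assms(3) by simp
qed

text \<open>Pairs of an element and a facet of \<open>K\<close> are regrouped by the face that they
  parametrize.\<close>

lemma sum_element_faces:
  "(\<Sum>\<kappa>\<in>dg_elems X. \<Sum>F | F facet_of K. h \<kappa> F)
      = (\<Sum>\<Gamma>\<in>faces X. \<Sum>\<kappa>\<in>adjacent X \<Gamma>. h \<kappa>
      (ref_facet X \<kappa> \<Gamma>))"
proof -
  have "(\<Sum>F | F facet_of K. h \<kappa> F)
      = (\<Sum>\<Gamma> | \<Gamma> \<in> faces X
      \<and> \<Gamma> \<in> elem_faces X \<kappa>. h \<kappa> (ref_facet X \<kappa> \<Gamma>))"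
    if \<kappa>: "\<kappa> \<in> dg_elems X" for \<kappa>
    by (rule sum.reindex_bij_witness[of _ "ref_facet X \<kappa>" "\<lambda>F. dg_map X \<kappa> ` F"])
      (use \<kappa> elem_face[OF \<kappa>] ref_facet_image[OF \<kappa>] in \<open>auto simp:
          faces_def elem_faces_def\<close>)
  then have "(\<Sum>\<kappa>\<in>dg_elems X. \<Sum>F | F facet_of K. h \<kappa> F) =
      (\<Sum>\<kappa>\<in>dg_elems X. \<Sum>\<Gamma> | \<Gamma> \<in> faces X
          \<and> \<Gamma> \<in> elem_faces X \<kappa>. h \<kappa> (ref_facet X \<kappa> \<Gamma>))"
    by simp
  also have "\<dots> = (\<Sum>\<Gamma>\<in>faces X. \<Sum>\<kappa> | \<kappa> \<in> dg_elems X
      \<and> \<Gamma> \<in> elem_faces X \<kappa>. h \<kappa> (ref_facet X \<kappa> \<Gamma>))"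
    by (rule sum.swap_restrict[OF finite_elems finite_faces])
  finally show ?thesis by (simp add: adjacent_def)
qed

lemma face_flux_opposite:
  assumes \<Gamma>: "\<Gamma> \<in> faces X" and bd: "\<not> boundary_face X \<Gamma>"
  shows "face_flux e f (other_side X \<Gamma>) \<Gamma> = - face_flux e f (dg_side X \<Gamma>) \<Gamma>"
proof -
  let ?s = "dg_side X \<Gamma>" and ?o = "other_side X \<Gamma>"
  note s = side(1,2)[OF \<Gamma>] and o = adjacent_interior(2,3,4)[OF \<Gamma> bd]
  have "interior ?s \<inter> interior ?o = {}"
    using mesh s(1) o(1,2) unfolding valid_mesh_def by metis
  then have "adjacent_charts K (chart_dom ?s) (dg_map X ?s) (chart_dom ?o) (dg_map X ?o)
      (ref_facet X ?s \<Gamma>) (ref_facet X ?o \<Gamma>)"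
    using chart_elem[OF s(1)] chart_elem[OF o(2)] elem_face(1,2)[OF s] elem_face(1,2)[OF o(2,3)]
      elem_image[OF s(1)] elem_image[OF o(2)]
    by (simp add: adjacent_charts_def adjacent_charts_axioms_def)
  from adjacent_charts.facet_integral_opposite[OF this] show ?thesis
    unfolding face_flux_def .
qed

text \<open>The product rule leaves the outward fluxes of \<open>u v\<close> through all faces.
  Since \<open>v\<close> is continuous, the two fluxes through an interior face combine to the jump
  of \<open>u\<close> times the average of \<open>v\<close>, and this is exactly what the transpose
  of \<open>F_mat\<close> subtracts.\<close>

lemma integration_by_parts:
  assumes c: "dg_fun X c \<in> continuous_zero_bdry X"
  shows "transpose (dir_G X d + F_mat X d) *v c = - (dir_G X d *v c)"
proof -
  let ?v = "dg_fun X c" and ?e = "sdir X d"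
  obtain g where g: "\<And>\<kappa> x. \<kappa> \<in> dg_elems X \<Longrightarrow> x \<in> \<kappa>
      \<Longrightarrow> ?v \<kappa> x = g x"
    "\<And>x. x \<in> frontier (dg_dom X) \<Longrightarrow> g x = 0" using continuous_traces[OF c] by blast
  have main: "(\<Sum>\<kappa>\<in>dg_elems X. vol_form ?e \<kappa> (dg_basis X j) ?v
      + vol_form ?e \<kappa> ?v (dg_basis X j)) =
      face_form (n_wt d) (jump X (dg_basis X j)) (avg X ?v)" for j
  proof -
    let ?u = "dg_basis X j"
    let ?f = "\<lambda>\<kappa> x. ?u \<kappa> x * ?v \<kappa> x"
    have "vol_form ?e \<kappa> ?u ?v + vol_form ?e \<kappa> ?v ?u
        = (\<Sum>F | F facet_of K. facet_integral K F
        (\<lambda>z. ?f \<kappa> (dg_map X \<kappa> z)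
            * (facet_normal K F \<bullet> pb \<kappa> ?e z)))" if \<kappa>: "\<kappa> \<in> dg_elems
            X" for \<kappa>
    proof -
      obtain p \<gamma> where rep: "\<And>i. ref_rep \<kappa> (dg_basis X i) (p i) (\<gamma> i)"
          using ref_rep_basis[OF \<kappa>] by blast
      show ?thesis by (rule vol_form_by_parts[OF \<kappa> rep ref_rep_dg_fun[OF rep]])
    qed
    then have "(\<Sum>\<kappa>\<in>dg_elems X. vol_form ?e \<kappa> ?u ?v + vol_form ?e \<kappa> ?v ?u) =
        (\<Sum>\<kappa>\<in>dg_elems X. \<Sum>F | F facet_of K. facet_integral K F
          (\<lambda>z. ?f \<kappa> (dg_map X \<kappa> z) * (facet_normal K F \<bullet> pb \<kappa> ?e z)))"
      by simp
    also have "\<dots> = (\<Sum>\<Gamma>\<in>faces X. \<Sum>\<kappa>\<in>adjacent X \<Gamma>.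
        face_flux ?e (?f \<kappa>) \<kappa> \<Gamma>)"
      unfolding sum_element_faces face_flux_def ..
    also have "\<dots> = (\<Sum>\<Gamma>\<in>faces X. face_integral X \<Gamma>
        (\<lambda>x. n_wt d \<Gamma> x * jump X ?u \<Gamma> x * avg X ?v \<Gamma> x))"
    proof (rule sum.cong[OF refl])
      fix \<Gamma> assume \<Gamma>: "\<Gamma> \<in> faces X"
      let ?s = "dg_side X \<Gamma>" and ?o = "other_side X \<Gamma>"
      note s = side(1,2)[OF \<Gamma>]
      have vs: "?v ?s x = g x" if "x \<in> \<Gamma>" for x
          using g(1)[OF s(1)] elem_face(3)[OF s] that by blast
      have rhs: "face_integral X \<Gamma> (\<lambda>x. n_wt d \<Gamma> x * jump X ?u \<Gamma> x
          * avg X ?v \<Gamma> x) =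
          face_flux ?e (\<lambda>x. jump X ?u \<Gamma> x * avg X ?v \<Gamma> x) ?s \<Gamma>"
        unfolding n_wt_def mult.assoc face_integral_normal[OF \<Gamma>]
        by (simp add: face_flux_def side_map_def side_facet_def mult.assoc)
      show "(\<Sum>\<kappa>\<in>adjacent X \<Gamma>. face_flux ?e (?f \<kappa>) \<kappa> \<Gamma>) =
          face_integral X \<Gamma> (\<lambda>x. n_wt d \<Gamma> x * jump X ?u \<Gamma> x
              * avg X ?v \<Gamma> x)"
      proof (cases "boundary_face X \<Gamma>")
        case True
        have "jump X ?u \<Gamma> x * avg X ?v \<Gamma> x = ?f ?s x" for x
          using True by (simp add: jump_def avg_def)
        then show ?thesis unfolding rhs by (simp add: adjacent_boundary[OF \<Gamma> True])
      next
        case False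
        note o = adjacent_interior(3,4)[OF \<Gamma> False]
        have vo: "?v ?o x = g x" if "x \<in> \<Gamma>" for x
            using g(1)[OF o(1)] elem_face(3)[OF o] that by blast
        have ct: "face_continuous \<Gamma> (?f \<kappa>)"
            if "\<kappa> \<in> dg_elems X" "\<Gamma> \<in> elem_faces X \<kappa>" for \<kappa>
          unfolding dg_fun_def by (intro face_continuous_intros face_continuous_trace[OF \<Gamma>] that)
        have cW: "continuous_on (side_facet \<Gamma>)
            (\<lambda>z. facet_normal K (side_facet \<Gamma>) \<bullet> pb ?s ?e z)"
          by (intro continuous_intros continuous_on_subset[OF continuous_on_pb[OF s(1)]]
              facet_subset side_facet[OF \<Gamma>])
        \<comment> \<open>Continuity enters here: both traces of \<open>?v\<close> equal
          \<open>g\<close>, so the jump times the average is the difference of the two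
          products.\<close>
        have "face_flux ?e (\<lambda>x. jump X ?u \<Gamma> x * avg X ?v \<Gamma> x) ?s \<Gamma>
            = face_flux ?e (\<lambda>x. ?f ?s x - ?f ?o x) ?s \<Gamma>"
          by (rule face_flux_cong[OF s]) (use False in \<open>simp add: jump_def avg_def vs vo
              algebra_simps\<close>)
        also have "\<dots> = face_flux ?e (?f ?s) ?s \<Gamma> - face_flux ?e (?f ?o) ?s \<Gamma>"
        proof -
          have i: "set_integrable lebesgue (facet_prism K (side_facet \<Gamma>))
              (\<lambda>y. ?f \<kappa> (dg_map X ?s (foot K (side_facet \<Gamma>) y)) *
              (facet_normal K (side_facet \<Gamma>) \<bullet> pb ?s ?e (foot K (side_facet \<Gamma>) y)))"
            if "\<kappa> \<in> dg_elems X" "\<Gamma> \<in> elem_faces X \<kappa>" for \<kappa>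
            by (rule integrable_prism_foot[OF side_facet[OF \<Gamma>]
                continuous_on_mult[OF ct[OF that, unfolded face_continuous_def side_map_def] cW]])
          show ?thesis
            unfolding face_flux_def side_facet_def[symmetric]
                facet_integral_foot[OF side_facet[OF \<Gamma>]]
            using set_integral_diff(2)[OF i[OF s] i[OF o]] by (simp add: left_diff_distrib)
        qed
        also have "\<dots> = face_flux ?e (?f ?s) ?s \<Gamma> + face_flux ?e (?f ?o) ?o \<Gamma>"
          by (simp add: face_flux_opposite[OF \<Gamma> False])
        also have "\<dots> = (\<Sum>\<kappa>\<in>adjacent X \<Gamma>. face_flux ?e (?f \<kappa>)
            \<kappa> \<Gamma>)"
          using adjacent_interior(1,2)[OF \<Gamma> False] by simp
        finally show ?thesis unfolding rhs by simp
      qed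
    qed
    finally show ?thesis by (simp add: face_form_def)
  qed
  have "(transpose (dir_G X d + F_mat X d) *v c) $ j = - (dir_G X d *v c) $ j" for j
  proof -
    have "(transpose (dir_G X d + F_mat X d) *v c) $ j =
        (transpose (dir_G X d) *v c) $ j + (transpose (F_mat X d) *v c) $ j"
      by (simp add: transpose_mult distrib_left sum.distrib)
    then show ?thesis
      using main[of j] by (simp add: dir_G_transpose_mult dir_G_mult
          F_mat_transpose_continuous[OF c] sum.distrib)
  qed
  then show ?thesis by (simp add: vec_eq_iff)
qed

end

section \<open>Asymptotics of the preconditioned sweep\<close>

lemma matrix_vector_mult_sum: "A *v (\<Sum>i\<in>I. f i) = (\<Sum>i\<in>I. A *v f i)"
  for A :: "real^'n::finite^'m::finite"
  by (rule linear_sum[OF matrix_vector_mul_linear])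

lemma sum_matrix_vector_mult: "(\<Sum>i\<in>I. A i) *v x = (\<Sum>i\<in>I. A i *v x)"
  for A :: "'i \<Rightarrow> real^'n::finite^'m::finite"
  by (induction I rule: infinite_finite_induct) (simp_all add: matrix_vector_mult_add_rdistrib)

lemma inner_transpose_mult: "y \<bullet> (transpose A *v x) = (A *v y) \<bullet> x"
  for A :: "real^'n::finite^'n"
  by (metis dot_lmul_matrix inner_commute transpose_matrix_vector)

text \<open>Identities under \<open>P^T\<close> are tested against the vectors
  \<open>P *v y\<close>, which in the application represent the continuous functions.\<close>

lemma transpose_mult_eqI:
  fixes P :: "real^'n::finite^'n"
  assumes "\<And>y. (P *v y) \<bullet> a = (P *v y) \<bullet> b"
  shows "transpose P *v a = transpose P *v b"
  by (rule vector_eq_ldot[THEN iffD1]) (simp add: inner_transpose_mult assms)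

lemma norm_matrix_vector_le: "norm (A *v x) \<le> opnorm A * norm x"
  for A :: "real^'n::finite^'n"
  by (rule onorm[OF matrix_vector_mul_bounded_linear])

lemma opnorm_nonneg: "0 \<le> opnorm A" for A :: "real^'n::finite^'n"
  by (rule onorm_pos_le[OF matrix_vector_mul_bounded_linear])

text \<open>A norm below 1 gives invertibility; the margin 1/2 also gives the bound 2, uniform in
  \<epsilon>.\<close>

lemma resolvent:
  fixes A :: "real^'n::finite^'n"
  assumes "0 < \<epsilon>" "\<epsilon> * opnorm A \<le> 1/2"
  defines "R \<equiv> matrix_inv (mat 1 + \<epsilon> *\<^sub>R A)"
  shows "R *v y = y - \<epsilon> *\<^sub>R (A *v (R *v y))" and "norm (R *v y) \<le> 2 * norm y"
proof -
  let ?B = "mat 1 + \<epsilon> *\<^sub>R A"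
  have B: "?B *v x = x + \<epsilon> *\<^sub>R (A *v x)" for x
    by (simp add: matrix_vector_mult_add_rdistrib scaleR_matrix_vector_assoc)
  have small: "norm (\<epsilon> *\<^sub>R (A *v x)) \<le> 1/2 * norm x" for x
  proof -
    have "norm (\<epsilon> *\<^sub>R (A *v x)) \<le> \<epsilon> * (opnorm A * norm x)"
      using norm_matrix_vector_le[of A x] assms(1) by simp
    also have "\<dots> \<le> 1/2 * norm x"
      using mult_right_mono[OF assms(2), of "norm x"] by (simp add: mult.assoc)
    finally show ?thesis .
  qed
  have "x = 0" if "?B *v x = 0" for x
  proof -
    have "x = - (\<epsilon> *\<^sub>R (A *v x))" using that by (simp add: B add_eq_0_iff2)
    then have "norm x = norm (\<epsilon> *\<^sub>R (A *v x))" by (metis norm_minus_cancel)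
    then have "norm x \<le> 1/2 * norm x" using small[of x] by linarith
    then show ?thesis by simp
  qed
  then have "inj ((*v) ?B)" using linear_injective_0[OF matrix_vector_mul_linear] by blast
  then have "det ?B \<noteq> 0"
    using matrix_left_invertible_injective invertible_left_inverse invertible_det_nz by blast
  from matrix_inv_vector_mult(1)[OF this, of y]
  have "R *v y + \<epsilon> *\<^sub>R (A *v (R *v y)) = y" by (simp add: B R_def)
  then show eq: "R *v y = y - \<epsilon> *\<^sub>R (A *v (R *v y))" by (simp add: algebra_simps)
  have "norm (R *v y) \<le> norm y + norm (\<epsilon> *\<^sub>R (A *v (R *v y)))"
    using norm_triangle_ineq4[of y "\<epsilon> *\<^sub>R (A *v (R *v y))"] eq by simp
  then show "norm (R *v y) \<le> 2 * norm y" using small[of "R *v y"] by linarith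
qed

text \<open>The fixed-point identity is inserted into itself twice. The remainder is exact and keeps
  the resolvent, so that no infinite series occurs.\<close>

lemma resolvent_expansion:
  fixes A :: "real^'n::finite^'n"
  assumes "0 < \<epsilon>" "\<epsilon> * opnorm A \<le> 1/2"
  defines "R \<equiv> matrix_inv (mat 1 + \<epsilon> *\<^sub>R A)"
  shows "R *v y = y - \<epsilon> *\<^sub>R (A *v y) + \<epsilon>\<^sup>2 *\<^sub>R (A *v (A *v y))
      - \<epsilon>^3 *\<^sub>R (A *v (A *v (A *v (R *v y))))"
proof -
  have r: "R *v y = y - \<epsilon> *\<^sub>R (A *v (R *v y))" unfolding R_def
      by (rule resolvent(1)[OF assms(1,2)])
  have 1: "A *v (R *v y) = A *v y - \<epsilon> *\<^sub>R (A *v (A *v (R *v y)))"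
    by (subst r) (simp add: matrix_vector_mult_diff_distrib matrix_vector_mult_scaleR)
  have 2: "A *v (A *v (R *v y)) = A *v (A *v y) - \<epsilon> *\<^sub>R (A *v (A *v (A *v (R *v y))))"
    by (subst 1) (simp add: matrix_vector_mult_diff_distrib matrix_vector_mult_scaleR)
  show ?thesis
    by (subst r, subst 1, subst 2) (simp add: scaleR_diff_right power2_eq_square power3_eq_cube)
qed

text \<open>The regroupings by powers of \<epsilon>: for one direction, for \<open>I - S\<close>,
  and for the product with \<open>(1 / \<epsilon>) EP + Kq\<close>. They are stated for arbitrary
  vectors to keep the matrix products opaque.\<close>

lemma scaled_vector_identities:
  fixes x a b c e f u v y z :: "'a::real_vector"
  shows "(x - \<epsilon>\<^sup>2 *\<^sub>R b)
      - \<epsilon> *\<^sub>R (a - \<epsilon>\<^sup>2 *\<^sub>R c)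
      + \<epsilon>\<^sup>2 *\<^sub>R (e - \<epsilon>\<^sup>2 *\<^sub>R f) - \<epsilon>^3 *\<^sub>R u =
      (x - \<epsilon>\<^sup>2 *\<^sub>R b) - \<epsilon> *\<^sub>R a + \<epsilon>\<^sup>2 *\<^sub>R e
          + \<epsilon>^3 *\<^sub>R (c - \<epsilon> *\<^sub>R f - u)"
    and "x - (x - \<epsilon> *\<^sub>R a + \<epsilon>\<^sup>2 *\<^sub>R (b - c)
        + \<epsilon>^3 *\<^sub>R u) = \<epsilon> *\<^sub>R (a + \<epsilon> *\<^sub>R (c - b)
        - \<epsilon>\<^sup>2 *\<^sub>R u)"
    and "\<epsilon> \<noteq> 0 \<Longrightarrow> (1 / \<epsilon>) *\<^sub>R (a
        + \<epsilon> *\<^sub>R b - \<epsilon>\<^sup>2 *\<^sub>R c)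
        + (u + \<epsilon> *\<^sub>R v - \<epsilon>\<^sup>2 *\<^sub>R y) - x =
      (1 / \<epsilon>) *\<^sub>R a + (b + u) - x + \<epsilon> *\<^sub>R (v - c - \<epsilon> *\<^sub>R y)"
  by (simp_all add: scaleR_diff_right scaleR_add_right power2_eq_square power3_eq_cube algebra_simps)

text \<open>With \<open>A1\<close> and \<open>A2\<close> the averages of \<open>A d\<close> and of
  its square, \<open>M (I - S)\<close> equals
  \<open>\<epsilon> M A1 + \<epsilon>\<^sup>2 M (B - A2)\<close> up to third order.
  \<open>order1\<close> removes the only negative power of \<epsilon>, and \<open>order0\<close>
  makes the terms of order 0 add up to the identity.\<close>

lemma two_scale_expansion:
  fixes A :: "nat \<Rightarrow> real^'n::finite^'n" and M B EP Kq :: "real^'n^'n" and q :: "nat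
      \<Rightarrow> real" and D :: "nat set"
  defines "S \<equiv> \<lambda>\<epsilon>. \<Sum>d\<in>D. q d *\<^sub>R
      (matrix_inv (mat 1 + \<epsilon> *\<^sub>R A d) **
      ((1 / (4 * pi)) *\<^sub>R (mat 1 - \<epsilon>\<^sup>2 *\<^sub>R B)))"
  assumes fin: "finite D" and total: "(\<Sum>d\<in>D. q d) = 4 * pi"
    and order1: "\<And>x. EP *v (M *v (\<Sum>d\<in>D. (q d / (4 * pi)) *\<^sub>R (A d *v x))) = 0"
    and order0: "\<And>x. EP *v (M *v (B *v x
        - (\<Sum>d\<in>D. (q d / (4 * pi)) *\<^sub>R (A d *v (A d *v x))))) +
        Kq *v (M *v (\<Sum>d\<in>D. (q d / (4 * pi)) *\<^sub>R (A d *v x))) = x"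
  shows "\<exists>C. \<forall>\<^sub>F \<epsilon> in at_right 0.
    opnorm ((1 / \<epsilon>) *\<^sub>R (((1 / \<epsilon>) *\<^sub>R EP + Kq) ** M ** (mat 1
        - S \<epsilon>)) - mat 1) \<le> C * \<epsilon>"
proof -
  define w where "w d = q d / (4 * pi)" for d
  have w1: "(\<Sum>d\<in>D. w d) = 1" using total by (simp add: w_def sum_divide_distrib[symmetric])
  define R where "R \<epsilon> d = matrix_inv (mat 1 + \<epsilon> *\<^sub>R A d)" for \<epsilon> d
  define Y where "Y \<epsilon> x = x - \<epsilon>\<^sup>2 *\<^sub>R (B *v x)" for \<epsilon> x
  \<comment> \<open>The exact coefficient of \<open>\<epsilon>^3\<close> for one direction, which
    itself still depends on \<epsilon>: the first two terms stem from the factor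
    \<open>I - \<epsilon>\<^sup>2 B\<close>, the third is the remainder of the resolvent.\<close>
  define t where "t \<epsilon> d x = A d *v (B *v x) - \<epsilon> *\<^sub>R (A d *v (A d *v (B *v x)))
      - A d *v (A d *v (A d *v (R \<epsilon> d *v Y \<epsilon> x)))" for \<epsilon> d x
  define T where "T \<epsilon> x = (\<Sum>d\<in>D. w d *\<^sub>R t \<epsilon> d x)" for \<epsilon> x
  define A1 where "A1 x = (\<Sum>d\<in>D. w d *\<^sub>R (A d *v x))" for x
  define A2 where "A2 x = (\<Sum>d\<in>D. w d *\<^sub>R (A d *v (A d *v x)))" for x
  \<comment> \<open>The summand 1 keeps \<open>k\<close> positive, since \<open>1 / (2 * k)\<close>
    becomes a threshold for \<epsilon>.\<close>
  define k where "k = 1 + (\<Sum>d\<in>D. opnorm (A d))"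
  have k: "0 < k" "\<And>d. d \<in> D \<Longrightarrow> opnorm (A d) \<le> k"
  proof -
    have "0 \<le> (\<Sum>d\<in>D. opnorm (A d))" by (intro sum_nonneg opnorm_nonneg)
    then show "0 < k" by (simp add: k_def)
    show "opnorm (A d) \<le> k" if "d \<in> D" for d
    proof -
      have "opnorm (A d) \<le> (\<Sum>d\<in>D. opnorm (A d))"
        by (rule member_le_sum[OF that]) (use fin opnorm_nonneg in auto)
      then show ?thesis by (simp add: k_def)
    qed
  qed
  have k0: "0 \<le> k" using k(1) by simp
  define b where "b = opnorm B"
  have b: "0 \<le> b" by (simp add: b_def opnorm_nonneg)
  have Akx: "norm (A d *v x) \<le> k * norm x" if "d \<in> D" for d x
    by (rule order_trans[OF norm_matrix_vector_le mult_right_mono[OF k(2)[OF that] norm_ge_zero]])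
  have Bx: "norm (B *v x) \<le> b * norm x" for x unfolding b_def by (rule norm_matrix_vector_le)
  \<comment> \<open>A termwise bound of \<open>T\<close> for \<open>\<epsilon> \<le> 1\<close>: the
    factor 2 bounds the resolvent, and \<open>1 + b\<close> bounds the operator in
    \<open>Y\<close>.\<close>
  define CT where "CT = (\<Sum>d\<in>D. \<bar>w d\<bar>)
      * (k * b + k * (k * b) + k * (k * (k * (2 * (1 + b)))))"
  have key: "opnorm ((1 / \<epsilon>) *\<^sub>R
      (((1 / \<epsilon>) *\<^sub>R EP + Kq) ** M ** (mat 1 - S \<epsilon>)) - mat 1) \<le>
      (opnorm EP * (opnorm M * CT) + opnorm Kq
          * (opnorm M * (b + (\<Sum>d\<in>D. \<bar>w d\<bar>) * (k * k))) + opnorm Kq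
          * (opnorm M * CT)) * \<epsilon>"
    if \<epsilon>: "0 < \<epsilon>" "\<epsilon> \<le> 1" "\<epsilon> * k \<le> 1/2" for \<epsilon>
  proof -
    have small: "\<epsilon> * opnorm (A d) \<le> 1/2" if "d \<in> D" for d
      using mult_left_mono[OF k(2)[OF that] less_imp_le[OF \<epsilon>(1)]] \<epsilon>(3) by linarith
    have e2: "\<epsilon>\<^sup>2 \<le> 1" using \<epsilon> by (simp add: power_le_one)
    have S: "S \<epsilon> *v x = (\<Sum>d\<in>D. w d *\<^sub>R (R \<epsilon> d *v Y \<epsilon> x))" for x
      unfolding S_def sum_matrix_vector_mult
      by (rule sum.cong[OF refl])
        (simp add: R_def Y_def w_def matrix_vector_mul_assoc[symmetric]
            scaleR_matrix_vector_assoc[symmetric]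
          matrix_vector_mult_scaleR matrix_vector_mult_diff_rdistrib)
    have expand: "S \<epsilon> *v x = x - \<epsilon> *\<^sub>R A1 x
        + \<epsilon>\<^sup>2 *\<^sub>R (A2 x - B *v x) + \<epsilon>^3 *\<^sub>R T \<epsilon> x" for x
    proof -
      have "R \<epsilon> d *v Y \<epsilon> x = (x - \<epsilon>\<^sup>2 *\<^sub>R (B *v x))
          - \<epsilon> *\<^sub>R (A d *v x) + \<epsilon>\<^sup>2 *\<^sub>R (A d *v (A d *v x))
          + \<epsilon>^3 *\<^sub>R t \<epsilon> d x"
        if "d \<in> D" for d
      proof -
        have A: "A d *v Y \<epsilon> x = A d *v x - \<epsilon>\<^sup>2 *\<^sub>R (A d *v (B *v x))"
          by (simp only: Y_def matrix_vector_mult_diff_distrib matrix_vector_mult_scaleR)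
        have AA: "A d *v (A d *v Y \<epsilon> x)
            = A d *v (A d *v x) - \<epsilon>\<^sup>2 *\<^sub>R (A d *v (A d *v (B *v x)))"
          by (simp only: A matrix_vector_mult_diff_distrib matrix_vector_mult_scaleR)
        have "R \<epsilon> d *v Y \<epsilon> x
            = Y \<epsilon> x - \<epsilon> *\<^sub>R (A d *v Y \<epsilon> x)
            + \<epsilon>\<^sup>2 *\<^sub>R (A d *v (A d *v Y \<epsilon> x))
            - \<epsilon>^3 *\<^sub>R (A d *v (A d *v (A d *v (R \<epsilon> d *v Y \<epsilon> x))))"
          unfolding R_def by (rule resolvent_expansion[OF \<epsilon>(1) small[OF that]])
        also have "\<dots> = (x - \<epsilon>\<^sup>2 *\<^sub>R (B *v x))
            - \<epsilon> *\<^sub>R (A d *v x) + \<epsilon>\<^sup>2 *\<^sub>R (A d *v (A d *v x))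
            + \<epsilon>^3 *\<^sub>R t \<epsilon> d x"
          unfolding AA unfolding A unfolding t_def Y_def by (rule scaled_vector_identities(1))
        finally show ?thesis .
      qed
      then have "S \<epsilon> *v x = (\<Sum>d\<in>D. w d *\<^sub>R
          ((x - \<epsilon>\<^sup>2 *\<^sub>R (B *v x)) - \<epsilon> *\<^sub>R (A d *v x)
          + \<epsilon>\<^sup>2 *\<^sub>R (A d *v (A d *v x)) + \<epsilon>^3 *\<^sub>R t \<epsilon> d x))"
        unfolding S by simp
      also have "\<dots> = (\<Sum>d\<in>D. w d) *\<^sub>R (x
          - \<epsilon>\<^sup>2 *\<^sub>R (B *v x)) - \<epsilon> *\<^sub>R A1 x
          + \<epsilon>\<^sup>2 *\<^sub>R A2 x + \<epsilon>^3 *\<^sub>R T \<epsilon> x"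
        unfolding A1_def A2_def T_def scaleR_sum_right scaleR_sum_left sum.distrib[symmetric]
            sum_subtractf[symmetric]
        by (rule sum.cong[OF refl]) (simp add: scaleR_add_right scaleR_diff_right mult.commute)
      finally show ?thesis by (simp add: w1 algebra_simps)
    qed
    have T_le: "norm (T \<epsilon> x) \<le> CT * norm x" for x
    proof -
      have y: "norm (Y \<epsilon> x) \<le> (1 + b) * norm x"
      proof -
        have "norm (\<epsilon>\<^sup>2 *\<^sub>R (B *v x)) \<le> 1 * (b * norm x)"
          unfolding norm_scaleR using e2 Bx[of x] by (intro mult_mono) auto
        then show ?thesis using norm_triangle_ineq4[of x "\<epsilon>\<^sup>2 *\<^sub>R (B *v x)"]
            by (simp add: Y_def algebra_simps)
      qed
      have tt: "norm (t \<epsilon> d x) \<le> (k * b + k * (k * b) + k * (k * (k * (2 * (1 + b)))))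
          * norm x" if d: "d \<in> D" for d
      proof -
        have 1: "norm (A d *v (B *v x)) \<le> k * (b * norm x)"
          by (rule order_trans[OF Akx[OF d] mult_left_mono[OF Bx k0]])
        have 2: "norm (A d *v (A d *v (B *v x))) \<le> k * (k * (b * norm x))"
          by (rule order_trans[OF Akx[OF d] mult_left_mono[OF 1 k0]])
        have "\<epsilon> * norm (A d *v (A d *v (B *v x))) \<le> 1 * (k * (k * (b * norm x)))"
          by (rule mult_mono[OF \<epsilon>(2) 2]) auto
        then have small2: "norm (\<epsilon> *\<^sub>R (A d *v (A d *v (B *v x))))
            \<le> k * (k * (b * norm x))"
          using \<epsilon>(1) by simp
        have r: "norm (R \<epsilon> d *v Y \<epsilon> x) \<le> 2 * ((1 + b) * norm x)"
          using resolvent(2)[OF \<epsilon>(1) small[OF d], of "Y \<epsilon> x"] y by (simp add: R_def)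
        have 3: "norm (A d *v (R \<epsilon> d *v Y \<epsilon> x)) \<le> k * (2 * ((1 + b) * norm x))"
          by (rule order_trans[OF Akx[OF d] mult_left_mono[OF r k0]])
        have 4: "norm (A d *v (A d *v (R \<epsilon> d *v Y \<epsilon> x)))
            \<le> k * (k * (2 * ((1 + b) * norm x)))"
          by (rule order_trans[OF Akx[OF d] mult_left_mono[OF 3 k0]])
        have 5: "norm (A d *v (A d *v (A d *v (R \<epsilon> d *v Y \<epsilon> x))))
            \<le> k * (k * (k * (2 * ((1 + b) * norm x))))"
          by (rule order_trans[OF Akx[OF d] mult_left_mono[OF 4 k0]])
        have "norm (t \<epsilon> d x) \<le> norm (A d *v (B *v x))
            + norm (\<epsilon> *\<^sub>R (A d *v (A d *v (B *v x))))
            + norm (A d *v (A d *v (A d *v (R \<epsilon> d *v Y \<epsilon> x))))"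
          unfolding t_def by (rule order_trans[OF norm_triangle_ineq4
              add_right_mono[OF norm_triangle_ineq4]])
        then have "norm (t \<epsilon> d x) \<le> k * (b * norm x) + k * (k * (b * norm x)) + k
            * (k * (k * (2 * ((1 + b) * norm x))))"
          using 1 small2 5 by linarith
        also have "\<dots> = (k * b + k * (k * b) + k * (k * (k * (2 * (1 + b))))) * norm x"
          by (simp only: distrib_right mult.assoc)
        finally show ?thesis .
      qed
      have "norm (T \<epsilon> x) \<le> (\<Sum>d\<in>D. \<bar>w d\<bar>
          * ((k * b + k * (k * b) + k * (k * (k * (2 * (1 + b))))) * norm x))"
        unfolding T_def by (rule sum_norm_le) (use tt in \<open>auto intro!: mult_left_mono\<close>)
      then show ?thesis by (simp add: CT_def sum_distrib_right mult.assoc)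
    qed
    let ?H = "(1 / \<epsilon>) *\<^sub>R (((1 / \<epsilon>) *\<^sub>R EP + Kq) ** M ** (mat 1
        - S \<epsilon>)) - mat 1"
    \<comment> \<open>An exact formula for the error. The factor \<epsilon> is explicit, so only
      uniform bounds for the vectors in the bracket are left to prove.\<close>
    have H: "?H *v x = \<epsilon> *\<^sub>R (Kq *v (M *v (B *v x - A2 x))
        - EP *v (M *v T \<epsilon> x) - \<epsilon> *\<^sub>R (Kq *v (M *v T \<epsilon> x)))" for x
    proof -
      let ?V = "A1 x + \<epsilon> *\<^sub>R (B *v x - A2 x) - \<epsilon>\<^sup>2 *\<^sub>R T \<epsilon> x"
      have I: "(mat 1 - S \<epsilon>) *v x = \<epsilon> *\<^sub>R ?V"
        unfolding matrix_vector_mult_diff_rdistrib matrix_vector_mul_lid expand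
            by (rule scaled_vector_identities(2))
      have MV: "C *v (M *v ?V) = C *v (M *v A1 x)
          + \<epsilon> *\<^sub>R (C *v (M *v (B *v x - A2 x)))
          - \<epsilon>\<^sup>2 *\<^sub>R (C *v (M *v T \<epsilon> x))" for C
        by (simp only: matrix_vector_right_distrib
            matrix_vector_mult_diff_distrib[of _ _ "_ *\<^sub>R _"] matrix_vector_mult_scaleR)
      have "?H *v x = (1 / \<epsilon>) *\<^sub>R
          ((1 / \<epsilon>) *\<^sub>R (EP *v (M *v ((mat 1 - S \<epsilon>) *v x)))
          + Kq *v (M *v ((mat 1 - S \<epsilon>) *v x))) - x"
        by (simp only: matrix_vector_mult_diff_rdistrib[of _ "mat 1"]
            matrix_vector_mult_add_rdistrib scaleR_matrix_vector_assoc[symmetric]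
            matrix_vector_mul_assoc[symmetric] matrix_vector_mul_lid)
      also have "\<dots> = (1 / \<epsilon>) *\<^sub>R (EP *v (M *v ?V)) + Kq *v (M *v ?V) - x"
        unfolding I matrix_vector_mult_scaleR using \<epsilon>(1) by (simp add: scaleR_add_right)
      also have "\<dots> = (1 / \<epsilon>) *\<^sub>R (EP *v (M *v A1 x))
          + (EP *v (M *v (B *v x - A2 x)) + Kq *v (M *v A1 x)) - x
          + \<epsilon> *\<^sub>R (Kq *v (M *v (B *v x - A2 x)) - EP *v (M *v T \<epsilon> x)
              - \<epsilon> *\<^sub>R (Kq *v (M *v T \<epsilon> x)))"
        unfolding MV by (rule scaled_vector_identities(3)) (use \<epsilon>(1) in simp)
      also have "\<dots> = \<epsilon> *\<^sub>R (Kq *v (M *v (B *v x - A2 x))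
          - EP *v (M *v T \<epsilon> x) - \<epsilon> *\<^sub>R (Kq *v (M *v T \<epsilon> x)))"
      proof -
        have "EP *v (M *v A1 x) = 0" using order1[of x] by (simp only: A1_def w_def)
        moreover have "EP *v (M *v (B *v x - A2 x)) + Kq *v (M *v A1 x) = x"
          using order0[of x] by (simp only: A1_def A2_def w_def)
        ultimately show ?thesis by simp
      qed
      finally show ?thesis .
    qed
    have MT: "norm (M *v T \<epsilon> x) \<le> opnorm M * (CT * norm x)" for x
      by (rule order_trans[OF norm_matrix_vector_le mult_left_mono[OF T_le opnorm_nonneg]])
    have EMT: "norm (C *v (M *v T \<epsilon> x)) \<le> opnorm C * (opnorm M * (CT * norm x))" for C x
      by (rule order_trans[OF norm_matrix_vector_le mult_left_mono[OF MT opnorm_nonneg]])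
    have A2: "norm (A2 x) \<le> (\<Sum>d\<in>D. \<bar>w d\<bar>) * (k * k) * norm x" for x
    proof -
      have aa: "norm (A d *v (A d *v x)) \<le> k * (k * norm x)" if d: "d \<in> D" for d
        by (rule order_trans[OF Akx[OF d] mult_left_mono[OF Akx[OF d] k0]])
      have "norm (A2 x) \<le> (\<Sum>d\<in>D. \<bar>w d\<bar> * (k * (k * norm x)))"
        unfolding A2_def by (rule sum_norm_le) (use aa in \<open>auto intro!: mult_left_mono\<close>)
      then show ?thesis by (simp add: sum_distrib_right mult.assoc)
    qed
    have D: "norm (B *v x - A2 x) \<le> (b + (\<Sum>d\<in>D. \<bar>w d\<bar>) * (k * k)) * norm x" for x
      using norm_triangle_ineq4[of "B *v x" "A2 x"] Bx[of x] A2[of x] by (simp add: distrib_right)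
    have KD: "norm (Kq *v (M *v (B *v x - A2 x)))
        \<le> opnorm Kq * (opnorm M * ((b + (\<Sum>d\<in>D. \<bar>w d\<bar>) * (k * k)) * norm x))" for x
    proof -
      have "norm (M *v (B *v x - A2 x)) \<le> opnorm M
          * ((b + (\<Sum>d\<in>D. \<bar>w d\<bar>) * (k * k)) * norm x)"
        by (rule order_trans[OF norm_matrix_vector_le mult_left_mono[OF D opnorm_nonneg]])
      then show ?thesis
        by (rule order_trans[OF norm_matrix_vector_le mult_left_mono[OF _ opnorm_nonneg]])
    qed
    show ?thesis
    proof (rule onorm_le)
      fix x
      let ?a = "Kq *v (M *v (B *v x - A2 x))" and ?b = "EP *v (M *v T \<epsilon> x)" and ?c
          = "Kq *v (M *v T \<epsilon> x)"
      have "norm (\<epsilon> *\<^sub>R ?c) \<le> norm ?c"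
        using mult_right_mono[OF \<epsilon>(2), of "norm ?c"] \<epsilon>(1) by simp
      then have "norm (?a - ?b - \<epsilon> *\<^sub>R ?c) \<le> norm ?a + norm ?b + norm ?c"
        using norm_triangle_ineq4[of "?a - ?b" "\<epsilon> *\<^sub>R ?c"]
            norm_triangle_ineq4[of ?a ?b] by linarith
      also have "\<dots> \<le> (opnorm EP * (opnorm M * CT) + opnorm Kq
          * (opnorm M * (b + (\<Sum>d\<in>D. \<bar>w d\<bar>) * (k * k)))
          + opnorm Kq * (opnorm M * CT)) * norm x"
        using KD[of x] EMT[of EP x] EMT[of Kq x] by (simp add: distrib_right mult.assoc)
      finally have "\<epsilon> * norm (?a - ?b - \<epsilon> *\<^sub>R ?c)
          \<le> \<epsilon> * ((opnorm EP * (opnorm M * CT)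
          + opnorm Kq * (opnorm M * (b + (\<Sum>d\<in>D. \<bar>w d\<bar>) * (k * k))) + opnorm Kq
              * (opnorm M * CT)) * norm x)"
        using \<epsilon>(1) by (intro mult_left_mono) auto
      then show "norm (?H *v x) \<le> (opnorm EP * (opnorm M * CT) + opnorm Kq
          * (opnorm M * (b + (\<Sum>d\<in>D. \<bar>w d\<bar>) * (k * k)))
          + opnorm Kq * (opnorm M * CT)) * \<epsilon> * norm x"
        unfolding H using \<epsilon>(1) by (simp add: mult_ac)
    qed
  qed
  have "\<forall>\<^sub>F \<epsilon> in at_right 0. \<epsilon> < min 1 (1 / (2 * k))"
    using k(1) by (intro eventually_at_rightI[of 0 "min 1 (1 / (2 * k))"]) auto
  then have "\<forall>\<^sub>F \<epsilon> in at_right 0. 0 < \<epsilon> \<and> \<epsilon>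
      \<le> 1 \<and> \<epsilon> * k \<le> 1/2"
    using eventually_at_right_less[of 0]
    by eventually_elim (use k(1) in \<open>auto simp: field_simps\<close>)
  then show ?thesis
    by (intro exI, elim eventually_mono) (use key in blast)
qed

text \<open>\<open>matrix\<close> represents a function faithfully only if it is linear. Linearity
  of the inverse holds because both candidates lie in the range of \<open>P\<close>, a subspace on
  which the map is injective.\<close>

lemma range_solve_mult:
  fixes P A :: "real^'n::finite^'n"
  assumes inv: "range_invertible P A"
  shows "range_solve P A *v x =
    P *v inv_into (range ((*v) P)) ((*v) (transpose P ** A ** P)) (transpose P *v x)"
proof -
  let ?R = "range ((*v) P)" and ?B = "(*v) (transpose P ** A ** P)"
  define g where "g = inv_into ?R ?B"
  have bij: "bij_betw ?B ?R (range ((*v) (transpose P)))" using inv by (simp add: range_invertible_def)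
  have g: "g (transpose P *v x) \<in> ?R" "?B (g (transpose P *v x)) = transpose P *v x" for x
    using bij_betw_inv_into_right[OF bij] bij_betw_apply[OF bij_betw_inv_into[OF bij]] by (auto simp: g_def)
  have inj: "inj_on ?B ?R" using bij by (rule bij_betw_imp_inj_on)
  have subspace: "subspace ?R" by (intro linear_subspace_image matrix_vector_mul_linear subspace_UNIV)
  have "linear (\<lambda>x. P *v g (transpose P *v x))"
  proof (rule linearI)
    fix x y
    have "g (transpose P *v (x + y)) = g (transpose P *v x) + g (transpose P *v y)"
    proof (rule inj_onD[OF inj _ g(1) subspace_add[OF subspace g(1) g(1)]])
      show "?B (g (transpose P *v (x + y))) = ?B (g (transpose P *v x) + g (transpose P *v y))"
        unfolding g(2) by (simp only: matrix_vector_right_distrib g(2))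
    qed
    then show "P *v g (transpose P *v (x + y)) = P *v g (transpose P *v x) + P *v g (transpose P *v y)"
      by (simp add: matrix_vector_right_distrib)
  next
    fix r x
    have "g (transpose P *v (r *\<^sub>R x)) = r *\<^sub>R g (transpose P *v x)"
    proof (rule inj_onD[OF inj _ g(1) subspace_scale[OF subspace g(1)]])
      show "?B (g (transpose P *v (r *\<^sub>R x))) = ?B (r *\<^sub>R g (transpose P *v x))"
        unfolding g(2) by (simp only: matrix_vector_mult_scaleR g(2))
    qed
    then show "P *v g (transpose P *v (r *\<^sub>R x)) = r *\<^sub>R (P *v g (transpose P *v x))"
      by (simp add: matrix_vector_mult_scaleR)
  qed
  from fun_cong[OF matrix_vector_mul(2)[OF this], of x] show ?thesis by (simp add: range_solve_def g_def)
qed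

text \<open>The operator sees its argument only through \<open>P^T\<close>. Hence identities that
  hold merely under \<open>P^T\<close> suffice for \<open>E_P\<close>.\<close>

lemma range_solve_cong:
  fixes P A :: "real^'n::finite^'n"
  assumes "range_invertible P A" "transpose P *v x = transpose P *v y"
  shows "range_solve P A *v x = range_solve P A *v y"
  unfolding range_solve_mult[OF assms(1)] assms(2) ..

text \<open>\<open>P *v x\<close> lies in the range of \<open>P\<close> and solves the projected
  equation, and a projection fixes it.\<close>

lemma range_solve_cancel:
  fixes P A :: "real^'n::finite^'n"
  assumes inv: "range_invertible P A" and idem: "P ** P = P"
  shows "range_solve P A *v (A *v (P *v x)) = P *v x"
proof -
  let ?R = "range ((*v) P)" and ?B = "(*v) (transpose P ** A ** P)"
  have inj: "inj_on ?B ?R" using inv by (auto simp: range_invertible_def bij_betw_def)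
  have PP: "P *v (P *v x) = P *v x" by (simp add: matrix_vector_mul_assoc idem)
  have "transpose P *v (A *v (P *v x)) = ?B (P *v x)"
    by (simp add: matrix_vector_mul_assoc[symmetric] PP)
  then show ?thesis
    unfolding range_solve_mult[OF inv] using inv_into_f_f[OF inj, of "P *v x"] PP by simp
qed

section \<open>Leading coefficients of the sweep\<close>

context dg_problem
begin

text \<open>Distinct spatial coordinates select distinct components of the directions in three
  dimensions, so the constant is 1/3 for every n.\<close>

lemma second_moment:
  "(\<Sum>d=1..q_num X. q_wt X d / (4 * pi) * (sdir X d $ j * sdir X d $ k)) = (if j = k then 1/3 else 0)"
proof -
  have bij: "bij_betw (q_cpt X) UNIV (of_nat ` {1..CARD('n)})"
    and mom: "\<forall>i j. (\<Sum>d=1..q_num X. q_wt X d * (q_dir X d $ i * q_dir X d $ j))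
        = 4 * pi / 3 * (if i = j then 1 else 0)"
    using quadrature by (auto simp: valid_quadrature_def)
  have inj: "inj (q_cpt X)" using bij by (rule bij_betw_imp_inj_on)
  have "(\<Sum>d=1..q_num X. q_wt X d / (4 * pi) * (sdir X d $ j * sdir X d $ k)) =
      (\<Sum>d=1..q_num X. q_wt X d * (q_dir X d $ q_cpt X j * q_dir X d $ q_cpt X k)) / (4 * pi)"
    by (simp add: sum_divide_distrib sdir_def del: One_nat_def)
  also have "\<dots> = (if j = k then 1/3 else 0)"
    unfolding mom[rule_format] using inj by (simp add: inj_eq)
  finally show ?thesis .
qed

lemma dir_G_vec: "dir_G X d *v x = (\<Sum>j\<in>UNIV. sdir X d $ j *\<^sub>R (G_mat X j *v x))"
  by (simp add: dir_G_def sum_matrix_vector_mult scaleR_matrix_vector_assoc)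

lemma transpose_dir_G_vec:
  "transpose (dir_G X d) *v x = (\<Sum>j\<in>UNIV. sdir X d $ j *\<^sub>R (transpose (G_mat X j) *v x))"
proof (rule vector_eq_ldot[THEN iffD1], rule allI)
  fix y
  show "y \<bullet> (transpose (dir_G X d) *v x)
      = y \<bullet> (\<Sum>j\<in>UNIV. sdir X d $ j *\<^sub>R (transpose (G_mat X j) *v x))"
    by (simp add: inner_sum_right inner_transpose_mult dir_G_vec inner_sum_left)
qed

context
  fixes P :: "real^'N^'N"
  assumes proj: "projection_onto {c. dg_fun X c \<in> continuous_zero_bdry X} P"
begin

lemma P_continuous: "dg_fun X (P *v x) \<in> continuous_zero_bdry X"
  using proj by (auto simp: projection_onto_def)

lemma F0_P: "F0 X *v (P *v x) = 0"
  by (simp add: F0_def scaleR_matrix_vector_assoc[symmetric] sum_matrix_vector_mult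
      F_mat_continuous[OF P_continuous])

lemma transpose_P_F0: "transpose P *v (F0 X *v x) = transpose P *v 0"
  by (rule transpose_mult_eqI)
    (simp add: inner_transpose_mult[of x "F0 X", symmetric] inner_commute[of _ "F0 X *v x"]
        F0_transpose_continuous[OF P_continuous])

lemma transpose_P_Ft1: "(P *v y) \<bullet> (Ft1 X j *v x) = 0"
proof -
  have "(P *v y) \<bullet> (Ft_mat X d *v x) = 0" for d
    using inner_transpose_mult[of x "Ft_mat X d" "P *v y"]
    by (simp add: inner_commute Ft_mat_continuous[OF P_continuous])
  then show ?thesis
    by (simp add: Ft1_def scaleR_matrix_vector_assoc[symmetric] sum_matrix_vector_mult inner_sum_right)
qed

text \<open>Integration by parts tested against the range of \<open>P\<close>, in the form that
  meets the factors \<open>G^T\<close> of \<open>D0\<close>.\<close>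

lemma transpose_P_transport:
  "(P *v y) \<bullet> ((dir_G X d + F_mat X d) *v x) = - ((P *v y) \<bullet> (transpose (dir_G X d) *v x))"
proof -
  have "(P *v y) \<bullet> ((dir_G X d + F_mat X d) *v x)
      = x \<bullet> (transpose (dir_G X d + F_mat X d) *v (P *v y))"
    by (simp add: inner_transpose_mult inner_commute)
  also have "\<dots> = - (x \<bullet> (dir_G X d *v (P *v y)))"
    unfolding integration_by_parts[OF P_continuous] by simp
  finally show ?thesis by (simp add: inner_transpose_mult inner_commute)
qed

text \<open>Under \<open>P^T\<close> the left factor \<open>H_d\<close> becomes
  \<open>- G_d^T\<close>, while the right one is split into its volume and face parts. The volume
  part gives the factor 1/3 by the second moments, the face part is \<open>F1\<close> by definition,
  and the \<open>Ft1\<close> term of \<open>D0\<close> vanishes against \<open>P\<close>.\<close>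

lemma transpose_P_D0:
  "transpose P *v (Mt X *v (matrix_inv (Mt X) ** Ma X *v x -
      (\<Sum>d=1..q_num X. (q_wt X d / (4 * pi)) *\<^sub>R (sweep_op X d *v (sweep_op X d *v x))))) =
   transpose P *v (D0 X *v x)"
proof (rule transpose_mult_eqI)
  fix y
  let ?v = "P *v y" and ?w = "\<lambda>d. q_wt X d / (4 * pi)" and ?I = "matrix_inv (Mt X)"
  let ?H = "\<lambda>d. dir_G X d + F_mat X d" and ?G = "\<lambda>j. G_mat X j"
  note M = matrix_inv_vector_mult(1)[OF det_Mt]
  have lhs: "Mt X *v (?I ** Ma X *v x - (\<Sum>d=1..q_num X. ?w d *\<^sub>R
      (sweep_op X d *v (sweep_op X d *v x)))) =
      Ma X *v x - (\<Sum>d=1..q_num X. ?w d *\<^sub>R (?H d *v (?I *v (?H d *v x))))"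
    by (simp add: matrix_vector_mult_diff_distrib matrix_vector_mult_sum matrix_vector_mult_scaleR
        sweep_op_def
        matrix_vector_mul_assoc[symmetric] M del: One_nat_def)
  have GG: "(\<Sum>d=1..q_num X. ?w d *\<^sub>R (transpose (dir_G X d) *v (?I *v (dir_G X d *v x)))) =
      (1/3) *\<^sub>R (\<Sum>j\<in>UNIV. transpose (?G j) *v (?I *v (?G j *v x)))"
  proof -
    let ?g = "\<lambda>j k. transpose (?G j) *v (?I *v (?G k *v x))"
    have "(\<Sum>d=1..q_num X. ?w d *\<^sub>R (transpose (dir_G X d) *v (?I *v (dir_G X d *v x)))) =
        (\<Sum>d=1..q_num X. \<Sum>j\<in>UNIV. \<Sum>k\<in>UNIV. (?w d
            * (sdir X d $ j * sdir X d $ k)) *\<^sub>R ?g j k)"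
      unfolding transpose_dir_G_vec dir_G_vec
      by (simp add: matrix_vector_mult_sum matrix_vector_mult_scaleR scaleR_sum_right del: One_nat_def)
    also have "\<dots> = (\<Sum>j\<in>UNIV. \<Sum>k\<in>UNIV. \<Sum>d=1..q_num X. (?w d
        * (sdir X d $ j * sdir X d $ k)) *\<^sub>R ?g j k)"
      by (subst sum.swap, rule sum.cong[OF refl], rule sum.swap)
    also have "\<dots> = (\<Sum>j\<in>UNIV. \<Sum>k\<in>UNIV. (if j = k then 1/3 else 0) *\<^sub>R ?g j k)"
      unfolding scaleR_sum_left[symmetric] second_moment ..
    also have "\<dots> = (\<Sum>j\<in>UNIV. (1/3) *\<^sub>R ?g j j)"
      by (rule sum.cong[OF refl]) (simp add: if_distrib[of "\<lambda>r. r *\<^sub>R _"] cong: if_cong)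
    finally show ?thesis by (simp add: scaleR_sum_right)
  qed
  have GF: "(\<Sum>d=1..q_num X. ?w d *\<^sub>R (transpose (dir_G X d) *v (?I *v (F_mat X d *v x)))) =
      (\<Sum>j\<in>UNIV. transpose (?G j) *v (?I *v (F1 X j *v x)))"
  proof -
    have F1: "F1 X j *v x = (\<Sum>d=1..q_num X. (?w d * sdir X d $ j) *\<^sub>R (F_mat X d *v x))" for j
      by (simp add: F1_def scaleR_matrix_vector_assoc[symmetric] sum_matrix_vector_mult
          scaleR_sum_right del: One_nat_def)
    have "(\<Sum>d=1..q_num X. ?w d *\<^sub>R (transpose (dir_G X d) *v (?I *v (F_mat X d *v x)))) =
        (\<Sum>d=1..q_num X. \<Sum>j\<in>UNIV. (?w d
            * sdir X d $ j) *\<^sub>R (transpose (?G j) *v (?I *v (F_mat X d *v x))))"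
      unfolding transpose_dir_G_vec by (simp add: scaleR_sum_right del: One_nat_def)
    also have "\<dots> = (\<Sum>j\<in>UNIV. \<Sum>d=1..q_num X. (?w d
        * sdir X d $ j) *\<^sub>R (transpose (?G j) *v (?I *v (F_mat X d *v x))))"
      by (rule sum.swap)
    finally show ?thesis
      unfolding F1 by (simp add: matrix_vector_mult_sum matrix_vector_mult_scaleR del: One_nat_def)
  qed
  have D0: "D0 X *v x = (1/3) *\<^sub>R (\<Sum>j\<in>UNIV. transpose (?G j) *v (?I *v (?G j *v x)))
      - (\<Sum>j\<in>UNIV. Ft1 X j *v (?I *v (?G j *v x)))
      + (\<Sum>j\<in>UNIV. transpose (?G j) *v (?I *v (F1 X j *v x))) + Ma X *v x"
    by (simp add: D0_def matrix_vector_mult_add_rdistrib matrix_vector_mult_diff_rdistrib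
        scaleR_matrix_vector_assoc[symmetric] sum_matrix_vector_mult matrix_vector_mul_assoc[symmetric])
  have "?v \<bullet> (\<Sum>d=1..q_num X. ?w d *\<^sub>R (?H d *v (?I *v (?H d *v x)))) =
      - (?v \<bullet> (\<Sum>d=1..q_num X. ?w d *\<^sub>R (transpose (dir_G X d) *v (?I *v (?H d *v x)))))"
    by (simp add: inner_sum_right transpose_P_transport sum_negf del: One_nat_def)
  also have "(\<Sum>d=1..q_num X. ?w d *\<^sub>R (transpose (dir_G X d) *v (?I *v (?H d *v x)))) =
      (\<Sum>d=1..q_num X. ?w d *\<^sub>R (transpose (dir_G X d) *v (?I *v (dir_G X d *v x)))) +
      (\<Sum>d=1..q_num X. ?w d *\<^sub>R (transpose (dir_G X d) *v (?I *v (F_mat X d *v x))))"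
    by (simp add: matrix_vector_mult_add_rdistrib matrix_vector_right_distrib scaleR_add_right
        sum.distrib del: One_nat_def)
  finally have "?v \<bullet> (\<Sum>d=1..q_num X. ?w d *\<^sub>R (?H d *v (?I *v (?H d *v x)))) =
      - (?v \<bullet> ((1/3) *\<^sub>R (\<Sum>j\<in>UNIV. transpose (?G j) *v (?I *v (?G j *v x)))
        + (\<Sum>j\<in>UNIV. transpose (?G j) *v (?I *v (F1 X j *v x)))))"
    unfolding GG GF .
  moreover have "?v \<bullet> (\<Sum>j\<in>UNIV. Ft1 X j *v (?I *v (?G j *v x))) = 0"
    by (simp add: inner_sum_right transpose_P_Ft1)
  ultimately show "?v \<bullet> (Mt X *v (?I ** Ma X *v x -
      (\<Sum>d=1..q_num X. ?w d *\<^sub>R (sweep_op X d *v (sweep_op X d *v x)))))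
          = ?v \<bullet> (D0 X *v x)"
    unfolding lhs D0 by (simp add: inner_add_right inner_diff_right del: One_nat_def)
qed

text \<open>The volume part is linear in the direction and averages to 0, so only the face part
  remains at first order.\<close>

lemma F0_sweep: "Mt X *v (\<Sum>d=1..q_num X. (q_wt X d / (4 * pi)) *\<^sub>R (sweep_op X d *v x))
    = F0 X *v x"
proof -
  let ?w = "\<lambda>d. q_wt X d / (4 * pi)"
  have "Mt X *v (\<Sum>d=1..q_num X. ?w d *\<^sub>R (sweep_op X d *v x)) =
      (\<Sum>d=1..q_num X. ?w d *\<^sub>R (dir_G X d *v x))
          + (\<Sum>d=1..q_num X. ?w d *\<^sub>R (F_mat X d *v x))"
    by (simp add: matrix_vector_mult_sum matrix_vector_mult_scaleR sweep_op_def
        matrix_vector_mul_assoc[symmetric]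
        matrix_inv_vector_mult(1)[OF det_Mt] matrix_vector_mult_add_rdistrib scaleR_add_right
            sum.distrib del: One_nat_def)
  also have "(\<Sum>d=1..q_num X. ?w d *\<^sub>R (dir_G X d *v x)) = 0"
  proof -
    have w: "(\<Sum>d=1..q_num X. ?w d * sdir X d $ j) = 0" for j
    proof -
      have "(\<Sum>d=1..q_num X. ?w d * sdir X d $ j)
          = (\<Sum>d=1..q_num X. q_wt X d *\<^sub>R sdir X d) $ j / (4 * pi)"
        by (simp add: sum_divide_distrib del: One_nat_def)
      then show ?thesis unfolding weighted_directions by simp
    qed
    have "(\<Sum>d=1..q_num X. ?w d *\<^sub>R (dir_G X d *v x)) =
        (\<Sum>d=1..q_num X. \<Sum>j\<in>UNIV. (?w d * sdir X d $ j) *\<^sub>R (G_mat X j *v x))"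
      by (simp add: dir_G_vec scaleR_sum_right del: One_nat_def)
    also have "\<dots> = (\<Sum>j\<in>UNIV. (\<Sum>d=1..q_num X. ?w d
        * sdir X d $ j) *\<^sub>R (G_mat X j *v x))"
      unfolding scaleR_sum_left by (rule sum.swap)
    finally show ?thesis unfolding w by simp
  qed
  finally show ?thesis
    by (simp add: F0_def scaleR_matrix_vector_assoc[symmetric] sum_matrix_vector_mult
        scaleR_sum_right del: One_nat_def)
qed

lemma preconditioned_sweep:
  assumes invP: "range_invertible P (D0 X)" and invQ: "range_invertible (mat 1 - P) (F0 X)"
  shows "\<exists>C. \<forall>\<^sub>F \<epsilon> in at_right 0.
    opnorm ((1 / \<epsilon>) *\<^sub>R (E_eps X P \<epsilon> ** Mt X ** (mat 1
        - S_mat X \<epsilon>)) - mat 1) \<le> C * \<epsilon>"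
proof -
  let ?Q = "mat 1 - P"
  \<comment> \<open>The part of \<open>E_eps\<close> that does not depend on \<epsilon>.\<close>
  define Kq where "Kq = (mat 1 - E_P X P ** D0 X) ** E_Q X ?Q ** (mat 1 - D0 X ** E_P X P)"
  have PP: "P ** P = P" using proj by (simp add: projection_onto_def)
  have QQ: "?Q ** ?Q = ?Q"
    by (rule matrix_eq[THEN iffD2])
      (simp add: matrix_vector_mul_assoc[symmetric] matrix_vector_mult_diff_rdistrib
          matrix_vector_mult_diff_distrib
        matrix_vector_mul_assoc[of P P] PP)
  have EP0: "E_P X P *v (F0 X *v x) = 0" for x
    unfolding E_P_def using range_solve_cong[OF invP transpose_P_F0, of x] by simp
  have EQ: "E_Q X ?Q *v (F0 X *v x) = ?Q *v x" for x
  proof -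
    have "F0 X *v x = F0 X *v (?Q *v x)"
      by (simp add: matrix_vector_mult_diff_rdistrib matrix_vector_mult_diff_distrib F0_P)
    then show ?thesis unfolding E_Q_def using range_solve_cancel[OF invQ QQ, of x] by simp
  qed
  have EPD: "E_P X P *v (D0 X *v (P *v x)) = P *v x" for x
    unfolding E_P_def by (rule range_solve_cancel[OF invP PP])
  have Kq: "Kq *v (F0 X *v x) = ?Q *v x - E_P X P *v (D0 X *v (?Q *v x))" for x
    by (simp add: Kq_def matrix_vector_mul_assoc[symmetric]
        matrix_vector_mult_diff_rdistrib[of _ _ "_ *v _"]
        matrix_vector_mult_diff_rdistrib[of _ _ "F0 X *v x"] EP0 EQ)
  have E: "E_eps X P \<epsilon> = (1 / \<epsilon>) *\<^sub>R E_P X P + Kq" for \<epsilon>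
    by (simp add: E_eps_def Kq_def)
  show ?thesis
    unfolding E S_mat_def
  proof (rule two_scale_expansion)
    show "(\<Sum>d=1..q_num X. q_wt X d) = 4 * pi" using quadrature by (simp add: valid_quadrature_def)
    show "E_P X P *v (Mt X *v (\<Sum>d=1..q_num X. (q_wt X d / (4 * pi)) *\<^sub>R
        (sweep_op X d *v x))) = 0" for x
      unfolding F0_sweep by (rule EP0)
    show "E_P X P *v (Mt X *v (matrix_inv (Mt X) ** Ma X *v x -
        (\<Sum>d=1..q_num X. (q_wt X d / (4 * pi)) *\<^sub>R (sweep_op X d *v (sweep_op X d *v x))))) +
      Kq *v (Mt X *v (\<Sum>d=1..q_num X. (q_wt X d / (4 * pi)) *\<^sub>R (sweep_op X d *v x))) = x" for x
    proof -
      have "E_P X P *v (Mt X *v (matrix_inv (Mt X) ** Ma X *v x -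
          (\<Sum>d=1..q_num X. (q_wt X d / (4 * pi)) *\<^sub>R
              (sweep_op X d *v (sweep_op X d *v x))))) = E_P X P *v (D0 X *v x)"
        unfolding E_P_def by (rule range_solve_cong[OF invP transpose_P_D0])
      \<comment> \<open>The part along \<open>Q\<close> cancels against the second term of
        \<open>Kq\<close>; this is the purpose of the factor \<open>I - E_P D0\<close> in the
        preconditioner.\<close>
      also have "\<dots> = E_P X P *v (D0 X *v (P *v x)) + E_P X P *v (D0 X *v (?Q *v x))"
        by (simp add: matrix_vector_mult_diff_rdistrib matrix_vector_mult_diff_distrib)
      finally show ?thesis
        unfolding F0_sweep Kq EPD by (simp add: matrix_vector_mult_diff_rdistrib)
    qed
  qed simp
qed

end

end

theorem theorem3p2:
  fixes X :: "('n::finite, 'N::finite) transport"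
    and P Q :: "real^'N^'N"
  assumes "CARD('n) \<le> 3"
    and "valid_mesh X"
    and "valid_basis X"
    and "valid_opacities X"
    and "valid_quadrature X"
    and "projection_onto {c. dg_fun X c \<in> continuous_zero_bdry X} P"
    and "Q = mat 1 - P"
    and "range_invertible P (D0 X)"
    and "range_invertible Q (F0 X)"
  shows "\<exists>C. \<forall>\<^sub>F \<epsilon> in at_right 0.
           (\<forall>d\<in>{1..q_num X}. \<epsilon> * opnorm (sweep_op X d) < 1) \<and>
           \<epsilon>\<^sup>2 * opnorm (matrix_inv (Mt X) ** Ma X) < 1 \<longrightarrow>
           opnorm ((1 / \<epsilon>) *\<^sub>R
               (E_eps X P \<epsilon> ** Mt X ** (mat 1 - S_mat X \<epsilon>)) - mat 1) \<le> C * \<epsilon>"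
proof -
  interpret dg_problem X by unfold_locales (use assms in auto)
  obtain C where "\<forall>\<^sub>F \<epsilon> in at_right 0.
      opnorm ((1 / \<epsilon>) *\<^sub>R (E_eps X P \<epsilon> ** Mt X ** (mat 1
          - S_mat X \<epsilon>)) - mat 1) \<le> C * \<epsilon>"
    using preconditioned_sweep[OF assms(6,8)] assms(7,9) by blast
  then show ?thesis by (intro exI[of _ C]) (elim eventually_mono, blast)
qed

end
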